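(* There is an algorithm which, given as input MV-terms $\tau_1,\ldots,\tau_k$ and $\sigma_1,\ldots,\sigma_l$ in the variables $X_1,\ldots,X_n$ such that both $\{\hat\tau_1,\ldots,\hat\tau_k\}$ and $\{\hat\sigma_1,\ldots,\hat\sigma_l\}$ separate points of $[0,1]^n$, decides whether the subalgebra of $\mathcal M([0,1]^n)$ generated by $\hat\tau_1,\ldots,\hat\tau_k$ coincides with the subalgebra of $\mathcal M([0,1]^n)$ generated by $\hat\sigma_1,\ldots,\hat\sigma_l$.
   Context: A McNaughton function on $[0,1]^n$ is a continuous function $f\colon[0,1]^n\to[0,1]$ for which there are finitely many affine functions with integer coefficients $p_1,\ldots,p_m$ such that for every $x$ there is $j$ with $f(x)=p_j(x)$; $\mathcal M([0,1]^n)$ is the MV-algebra of these with pointwise operations $f\oplus g=\min(1,f+g)$, $\neg f=1-f$, $0$. An MV-term $\tau(X_1,\ldots,X_n)$ is a string built from the variables $X_i$ and the constant $0$ by finitely many applications of $\neg$ and $\oplus$; $\hat\tau$ is obtained by interpreting $X_i$ as the $i$-th coordinate function and the connectives pointwise. A set $S$ of functions separates points of $[0,1]^n$ if for all $x\neq y$ there is $f\in S$ with $f(x)\neq f(y)$. *)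

theory Defs
  imports "HOL-Analysis.Analysis" "HOL-Library.Nat_Bijection"
begin

section \<open>McNaughton functions and their subalgebras\<close>

text \<open>
  A point of the \<open>n\<close>-cube is a function on the index set \<open>{1..n}\<close>, extended by
  \<^const>\<open>undefined\<close>; on such functions the product topology of \<^typ>\<open>nat \<Rightarrow> real\<close> restricts to
  the Euclidean one. Functions on the cube are likewise extensional, so that equality of
  functions on the cube is equality in the logic.
\<close>

definition cube :: "nat \<Rightarrow> (nat \<Rightarrow> real) set" where
  "cube n = {1..n} \<rightarrow>\<^sub>E {0..1}"

definition int_affine :: "nat \<Rightarrow> ((nat \<Rightarrow> real) \<Rightarrow> real) \<Rightarrow> bool" where
  "int_affine n p \<longleftrightarrow>
     (\<exists>(b :: int) (a :: nat \<Rightarrow> int). \<forall>x. p x = of_int b + (\<Sum>i\<in>{1..n}. of_int (a i) * x i))"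

definition McNaughton :: "nat \<Rightarrow> ((nat \<Rightarrow> real) \<Rightarrow> real) set" where
  "McNaughton n = {f \<in> cube n \<rightarrow>\<^sub>E {0..1}. continuous_on (cube n) f \<and>
     (\<exists>P. finite P \<and> (\<forall>p\<in>P. int_affine n p) \<and> (\<forall>x\<in>cube n. \<exists>p\<in>P. f x = p x))}"

definition mv_zero :: "nat \<Rightarrow> (nat \<Rightarrow> real) \<Rightarrow> real" where
  "mv_zero n = (\<lambda>x\<in>cube n. 0)"

definition mv_neg :: "nat \<Rightarrow> ((nat \<Rightarrow> real) \<Rightarrow> real) \<Rightarrow> (nat \<Rightarrow> real) \<Rightarrow> real" where
  "mv_neg n f = (\<lambda>x\<in>cube n. 1 - f x)"

definition mv_plus ::
  "nat \<Rightarrow> ((nat \<Rightarrow> real) \<Rightarrow> real) \<Rightarrow> ((nat \<Rightarrow> real) \<Rightarrow> real) \<Rightarrow> (nat \<Rightarrow> real) \<Rightarrow> real" where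
  "mv_plus n f g = (\<lambda>x\<in>cube n. min 1 (f x + g x))"

definition mv_subalgebra :: "nat \<Rightarrow> ((nat \<Rightarrow> real) \<Rightarrow> real) set \<Rightarrow> bool" where
  "mv_subalgebra n A \<longleftrightarrow> A \<subseteq> McNaughton n \<and> mv_zero n \<in> A \<and>
     (\<forall>f\<in>A. mv_neg n f \<in> A) \<and> (\<forall>f\<in>A. \<forall>g\<in>A. mv_plus n f g \<in> A)"

definition mv_generated :: "nat \<Rightarrow> ((nat \<Rightarrow> real) \<Rightarrow> real) set \<Rightarrow> ((nat \<Rightarrow> real) \<Rightarrow> real) set" where
  "mv_generated n S = mv_subalgebra n hull S"

definition separates_points :: "nat \<Rightarrow> ((nat \<Rightarrow> real) \<Rightarrow> real) set \<Rightarrow> bool" where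
  "separates_points n S \<longleftrightarrow> (\<forall>x\<in>cube n. \<forall>y\<in>cube n. x \<noteq> y \<longrightarrow> (\<exists>f\<in>S. f x \<noteq> f y))"


section \<open>MV-terms\<close>

datatype mv_term = Var nat | Zero | Neg mv_term | Plus mv_term mv_term

primrec mv_vars :: "mv_term \<Rightarrow> nat set" where
  "mv_vars (Var i) = {i}"
| "mv_vars Zero = {}"
| "mv_vars (Neg t) = mv_vars t"
| "mv_vars (Plus s t) = mv_vars s \<union> mv_vars t"

primrec term_fun :: "nat \<Rightarrow> mv_term \<Rightarrow> (nat \<Rightarrow> real) \<Rightarrow> real" where
  "term_fun n (Var i) = (\<lambda>x\<in>cube n. x i)"
| "term_fun n Zero = mv_zero n"
| "term_fun n (Neg t) = mv_neg n (term_fun n t)"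
| "term_fun n (Plus s t) = mv_plus n (term_fun n s) (term_fun n t)"

text \<open>
  The next two lemmas show that for term functions the hull in \<open>mv_generated\<close> is an
  intersection over a nonempty family.
\<close>

lemma mv_subalgebra_McNaughton: "mv_subalgebra n (McNaughton n)"
proof -
  have zero: "mv_zero n \<in> McNaughton n"
  proof -
    have "int_affine n (\<lambda>_. 0)"
      unfolding int_affine_def by (rule exI[of _ 0], rule exI[of _ "\<lambda>_. 0"]) simp
    then show ?thesis
      unfolding McNaughton_def mv_zero_def
      by (auto intro!: exI[of _ "{\<lambda>_. 0}"] cong: continuous_on_cong)
  qed
  have aff_neg: "int_affine n (\<lambda>x. 1 - p x)" if "int_affine n p" for p
  proof -
    from that obtain b :: int and a where
      *: "\<And>x. p x = of_int b + (\<Sum>i\<in>{1..n}. of_int (a i) * x i)"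
      unfolding int_affine_def by blast
    show ?thesis
      unfolding int_affine_def
      by (rule exI[of _ "1 - b"], rule exI[of _ "\<lambda>i. - a i"]) (simp add: * sum_negf)
  qed
  have aff_plus: "int_affine n (\<lambda>x. p x + q x)" if "int_affine n p" "int_affine n q" for p q
  proof -
    from that obtain b c :: int and a d where
      *: "\<And>x. p x = of_int b + (\<Sum>i\<in>{1..n}. of_int (a i) * x i)"
         "\<And>x. q x = of_int c + (\<Sum>i\<in>{1..n}. of_int (d i) * x i)"
      unfolding int_affine_def by blast
    show ?thesis
      unfolding int_affine_def
      by (rule exI[of _ "b + c"], rule exI[of _ "\<lambda>i. a i + d i"])
         (simp add: * sum.distrib distrib_right)
  qed
  have aff_one: "int_affine n (\<lambda>_. 1)"
    unfolding int_affine_def by (rule exI[of _ 1], rule exI[of _ "\<lambda>_. 0"]) simp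
  have neg: "mv_neg n f \<in> McNaughton n" if f: "f \<in> McNaughton n" for f
  proof -
    from f obtain P where P: "finite P" "\<forall>p\<in>P. int_affine n p"
      "\<forall>x\<in>cube n. \<exists>p\<in>P. f x = p x" and c: "continuous_on (cube n) f"
      and r: "f \<in> cube n \<rightarrow>\<^sub>E {0..1}"
      unfolding McNaughton_def by blast
    let ?Q = "(\<lambda>p x. 1 - p x) ` P"
    have "finite ?Q" "\<forall>q\<in>?Q. int_affine n q" "\<forall>x\<in>cube n. \<exists>q\<in>?Q. mv_neg n f x = q x"
      using P aff_neg by (auto simp: mv_neg_def)
    moreover have "continuous_on (cube n) (mv_neg n f)"
      using continuous_on_diff[OF continuous_on_const c, of 1]
      by (simp add: mv_neg_def cong: continuous_on_cong)
    moreover have "mv_neg n f \<in> cube n \<rightarrow>\<^sub>E {0..1}"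
      using r by (auto simp: mv_neg_def PiE_iff)
    ultimately show ?thesis
      unfolding McNaughton_def by blast
  qed
  have plus: "mv_plus n f g \<in> McNaughton n"
    if f: "f \<in> McNaughton n" and g: "g \<in> McNaughton n" for f g
  proof -
    from f obtain P where P: "finite P" "\<forall>p\<in>P. int_affine n p"
      "\<forall>x\<in>cube n. \<exists>p\<in>P. f x = p x" and c: "continuous_on (cube n) f"
      and r: "f \<in> cube n \<rightarrow>\<^sub>E {0..1}"
      unfolding McNaughton_def by blast
    from g obtain Q where Q: "finite Q" "\<forall>p\<in>Q. int_affine n p"
      "\<forall>x\<in>cube n. \<exists>p\<in>Q. g x = p x" and d: "continuous_on (cube n) g"
      and s: "g \<in> cube n \<rightarrow>\<^sub>E {0..1}"
      unfolding McNaughton_def by blast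
    let ?R = "insert (\<lambda>_. 1) ((\<lambda>(p, q) x. p x + q x) ` (P \<times> Q))"
    have "finite ?R" "\<forall>q\<in>?R. int_affine n q"
      using P Q aff_plus aff_one by auto
    moreover have "\<exists>q\<in>?R. mv_plus n f g x = q x" if x: "x \<in> cube n" for x
    proof -
      from x P Q obtain p q where "p \<in> P" "q \<in> Q" "f x = p x" "g x = q x" by blast
      then show ?thesis using x by (auto simp: mv_plus_def min_def)
    qed
    moreover have "continuous_on (cube n) (mv_plus n f g)"
      using continuous_on_min[OF continuous_on_const continuous_on_add[OF c d], of 1]
      by (simp add: mv_plus_def cong: continuous_on_cong)
    moreover have "mv_plus n f g \<in> cube n \<rightarrow>\<^sub>E {0..1}"
      using r s by (auto simp: mv_plus_def PiE_iff)
    ultimately show ?thesis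
      unfolding McNaughton_def by blast
  qed
  show ?thesis
    unfolding mv_subalgebra_def using zero neg plus by blast
qed

lemma term_fun_in_McNaughton: "mv_vars t \<subseteq> {1..n} \<Longrightarrow> term_fun n t \<in> McNaughton n"
proof (induction t)
  case (Var i)
  then have i: "i \<in> {1..n}" by simp
  have "int_affine n (\<lambda>x. x i)"
    unfolding int_affine_def
  proof (intro exI allI)
    fix x :: "nat \<Rightarrow> real"
    have "(\<Sum>j\<in>{1..n}. of_int (if j = i then 1 else 0) * x j) =
        (\<Sum>j\<in>{1..n}. if j = i then x j else 0)"
      by (rule sum.cong) auto
    also have "\<dots> = x i" using i by simp
    finally show "x i = of_int 0 + (\<Sum>j\<in>{1..n}. of_int (if j = i then 1 else 0) * x j)" by simp
  qed
  moreover have "continuous_on (cube n) (\<lambda>x\<in>cube n. x i)"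
    using continuous_on_subset[OF continuous_on_product_coordinates[of i] subset_UNIV]
    by (simp cong: continuous_on_cong)
  moreover have "(\<lambda>x\<in>cube n. x i) \<in> cube n \<rightarrow>\<^sub>E {0..1}"
    using i by (auto simp: cube_def PiE_iff)
  ultimately show ?case
    unfolding McNaughton_def by (auto intro!: exI[of _ "{\<lambda>x. x i}"])
qed (use mv_subalgebra_McNaughton[of n] in \<open>auto simp: mv_subalgebra_def\<close>)


section \<open>Algorithms\<close>

text \<open>
  Programs for Kleene's partial recursive functions. \<open>computes e xs y\<close> means that the program
  \<open>e\<close> halts on the tuple \<open>xs\<close> with output \<open>y\<close>.
\<close>

datatype recf =
    RZero
  | RSucc
  | RProj nat
  | RComp recf "recf list"
  | RPrim recf recf
  | RMin recf

inductive computes :: "recf \<Rightarrow> nat list \<Rightarrow> nat \<Rightarrow> bool" where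
  zero: "computes RZero xs 0"
| succ: "computes RSucc [x] (Suc x)"
| proj: "i < length xs \<Longrightarrow> computes (RProj i) xs (xs ! i)"
| comp: "list_all2 (\<lambda>g y. computes g xs y) gs ys \<Longrightarrow> computes f ys z \<Longrightarrow>
    computes (RComp f gs) xs z"
| prim_0: "computes f xs y \<Longrightarrow> computes (RPrim f g) (0 # xs) y"
| prim_Suc: "computes (RPrim f g) (m # xs) y \<Longrightarrow> computes g (m # y # xs) z \<Longrightarrow>
    computes (RPrim f g) (Suc m # xs) z"
| min: "computes f (m # xs) 0 \<Longrightarrow> (\<And>k. k < m \<Longrightarrow> \<exists>y. computes f (k # xs) (Suc y)) \<Longrightarrow>
    computes (RMin f) xs m"

lemma computes_deterministic:
  "computes e xs y \<Longrightarrow> computes e xs z \<Longrightarrow> y = z"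
proof (induction e xs y arbitrary: z rule: computes.induct)
  case (comp xs gs ys f w)
  from comp.prems obtain ys' where
    ys': "list_all2 (\<lambda>g y. computes g xs y) gs ys'" "computes f ys' z"
    by (cases rule: computes.cases) auto
  have "ys = ys'"
    using comp.IH(1) ys'(1) by (auto simp: list_all2_conv_all_nth intro!: nth_equalityI)
  with comp.IH ys'(2) show ?case by blast
next
  case (prim_Suc f g m xs y w)
  from prim_Suc.prems obtain y' where
    "computes (RPrim f g) (m # xs) y'" "computes g (m # y' # xs) z"
    by (cases rule: computes.cases) auto
  with prim_Suc.IH show ?case by blast
next
  case (min f m xs)
  from min.prems have z: "computes f (z # xs) 0"
    "\<forall>k<z. \<exists>y. computes f (k # xs) (Suc y)"
    by (cases rule: computes.cases; simp)+
  have "\<not> m < z" using min.IH(1) z(2) by fastforce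
  moreover have "\<not> z < m" using min.IH(2) z(1) by fastforce
  ultimately show ?case by simp
next
  case (zero xs)
  then show ?case by (cases rule: computes.cases) simp
next
  case (succ x)
  then show ?case by (cases rule: computes.cases) simp
next
  case (proj i xs)
  from proj.prems show ?case by (cases rule: computes.cases) simp
next
  case (prim_0 f xs y g)
  from prim_0.prems have "computes f xs z" by (cases rule: computes.cases) simp
  then show ?case by (rule prim_0.IH)
qed

text \<open>Input is passed to programs through the Cantor pairing function.\<close>

primrec term_code :: "mv_term \<Rightarrow> nat" where
  "term_code (Var i) = prod_encode (0, i)"
| "term_code Zero = prod_encode (1, 0)"
| "term_code (Neg t) = prod_encode (2, term_code t)"
| "term_code (Plus s t) = prod_encode (3, prod_encode (term_code s, term_code t))"

lemma inj_term_code: "inj term_code"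
proof (rule injI)
  show "term_code s = term_code t \<Longrightarrow> s = t" for s t
    by (induction s arbitrary: t; case_tac t) auto
qed

definition terms_code :: "mv_term list \<Rightarrow> nat" where
  "terms_code ts = list_encode (map term_code ts)"

end

theory Submission
  imports Defs
begin

text \<open>
  Write \<open>g\<close> for the tuple of functions given by a separating list of terms. Its subalgebra contains
  a function \<open>f\<close> given by a term iff for all rational points \<open>x\<close> and all \<open>q \<ge> 1\<close>, integrality of
  \<open>q g(x)\<close> implies integrality of \<open>q f(x)\<close>. Hence both equality and inequality of two subalgebras have
  finite certificates, namely terms that express the generators by each other and a point violating
  the criterion, and an unbounded search for a certificate terminates.

  For sufficiency of the criterion, cut the cube into polyhedra \<open>D\<close> with nonempty interior on which
  \<open>f\<close> and \<open>g\<close> are affine. By duality, the criterion makes \<open>f\<close> an integer combination of \<open>g\<close> on \<open>D\<close>,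
  and injectivity of \<open>g\<close> yields an element of the subalgebra with zero set \<open>D\<close>; together they give
  an upper bound of \<open>f\<close> in the subalgebra that is exact on \<open>D\<close>, and \<open>f\<close> is the minimum of these bounds.

  What replaces triangulations is a descent on denominators: a rational point of large denominator
  is the mediant of two points of smaller denominator between which all small terms are affine.
  This bounds the denominators at which an identity of terms has to be tested, and it shows
  that a function is bounded by a multiple of another one if its zero set is larger.
\<close>

section \<open>Terms at rational points\<close>

text \<open>No bound is produced for the terms that express one list of generators by the other, so
  equality and inequality are both only semi-decided, and separation is what guarantees a
  certificate of inequality. A certificate must itself be checkable by a finite computation; this is
  why identities of terms are reduced to bounded denominators.

  Necessity of the criterion: the numbers \<open>r\<close> with \<open>q r\<close> integral include
  \<open>0\<close> and \<open>1\<close> and are closed under the operations. For sufficiency,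
  \<open>q\<close> must be independent of the denominators of \<open>x\<close>. The test points on a
  piece are \<open>(z + v) / q\<close> with \<open>z\<close> integral and \<open>v\<close> a
  rational vector whose pairings with the linear parts of \<open>g\<close> are integral, so the
  values of \<open>g\<close> get denominator \<open>q\<close> although the coordinates need not.
  Such points must fit into the piece, hence the nonempty interior.

  Working with upper bounds removes any compatibility condition between pieces: each bound has to be
  exact on its own piece and merely not too small elsewhere.\<close>

definition unit_pts :: "nat \<Rightarrow> (nat \<Rightarrow> real) set" where
  "unit_pts n = {x. \<forall>i\<in>{1..n}. 0 \<le> x i \<and> x i \<le> 1}"

text \<open>Terms are evaluated at any function, without the restriction to \<open>cube n\<close>,
  so that points such as \<open>\<lambda>i. a i / d\<close> and points of a segment can be used as
  they are.\<close>

primrec mval :: "(nat \<Rightarrow> real) \<Rightarrow> mv_term \<Rightarrow> real" where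
  "mval x (Var i) = x i"
| "mval x Zero = 0"
| "mval x (Neg t) = 1 - mval x t"
| "mval x (Plus s t) = min 1 (mval x s + mval x t)"

primrec leaves :: "mv_term \<Rightarrow> nat" where
  "leaves (Var i) = 1"
| "leaves Zero = 1"
| "leaves (Neg t) = leaves t"
| "leaves (Plus s t) = leaves s + leaves t"

lemma mval_bounds: "mv_vars t \<subseteq> {1..n} \<Longrightarrow> x \<in> unit_pts n \<Longrightarrow> 0 \<le> mval x t \<and> mval x t \<le> 1"
  by (induction t) (auto simp: unit_pts_def)

lemma mval_cong: "(\<And>i. i \<in> mv_vars t \<Longrightarrow> x i = y i) \<Longrightarrow> mval x t = mval y t"
  by (induction t) auto

text \<open>\<open>Neg\<close> preserves distances and truncation at \<open>1\<close> does not
  increase them, so the constants simply add up at \<open>Plus\<close>.\<close>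

lemma mval_lipschitz:
  fixes x y :: "nat \<Rightarrow> real" and \<delta> :: real
  assumes "\<And>i. i \<in> mv_vars t \<Longrightarrow> \<bar>x i - y i\<bar> \<le> \<delta>" "0 \<le> \<delta>"
  shows "\<bar>mval x t - mval y t\<bar> \<le> leaves t * \<delta>"
  using assms by (induction t) (auto simp: distrib_right min_def abs_if split: if_splits)

text \<open>At \<open>y\<close> every subterm has a value in \<open>(1/q)\<int>\<close>, and along
  the segment it moves by at most \<open>1/q\<close>. A sum under \<open>Plus\<close> therefore
  cannot cross the kink at \<open>1\<close>: it stays on one side, or it starts at \<open>1\<close>
  and the sign of its slope decides. The bound on \<open>D\<close> is carried along for the
  induction.\<close>

lemma mval_segment:
  fixes q :: nat and \<delta> :: real and y v :: "nat \<Rightarrow> real"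
  assumes "q > 0" "0 \<le> \<delta>"
    and "\<And>i. i \<in> mv_vars t \<Longrightarrow> q * y i \<in> \<int>"
    and "\<And>i. i \<in> mv_vars t \<Longrightarrow> \<bar>v i\<bar> \<le> \<delta>"
    and "leaves t * \<delta> * q \<le> 1"
  shows "q * mval y t \<in> \<int> \<and> (\<exists>D. \<bar>D\<bar> \<le> leaves t * \<delta> \<and>
     (\<forall>s\<in>{0..1}. mval (\<lambda>i. y i + s * v i) t = mval y t + s * D))"
  using assms
proof (induction t)
  case (Var i)
  then show ?case by (auto intro!: exI[of _ "v i"])
next
  case Zero
  then show ?case by (auto intro!: exI[of _ 0])
next
  case (Neg t)
  then obtain D where D: "\<bar>D\<bar> \<le> leaves t * \<delta>"
      "\<forall>s\<in>{0..1}. mval (\<lambda>i. y i + s * v i) t = mval y t + s * D"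
    and q: "q * mval y t \<in> \<int>" by auto
  from q have "q * (1 - mval y t) \<in> \<int>"
    by (simp add: right_diff_distrib)
  with D show ?case by (auto intro!: exI[of _ "-D"])
next
  case (Plus t1 t2)
  have le: "leaves t1 * \<delta> * q \<le> 1" "leaves t2 * \<delta> * q \<le> 1"
  proof -
    have "leaves t1 * \<delta> * q + leaves t2 * \<delta> * q \<le> 1"
      using Plus.prems(5) by (simp add: distrib_right)
    moreover have "0 \<le> leaves t1 * \<delta> * q" "0 \<le> leaves t2 * \<delta> * q"
      using Plus.prems by auto
    ultimately show "leaves t1 * \<delta> * q \<le> 1" "leaves t2 * \<delta> * q \<le> 1" by linarith+
  qed
  obtain D1 where D1: "\<bar>D1\<bar> \<le> leaves t1 * \<delta>"
      "\<forall>s\<in>{0..1}. mval (\<lambda>i. y i + s * v i) t1 = mval y t1 + s * D1"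
    and q1: "q * mval y t1 \<in> \<int>" using Plus.IH(1) Plus.prems le by auto
  obtain D2 where D2: "\<bar>D2\<bar> \<le> leaves t2 * \<delta>"
      "\<forall>s\<in>{0..1}. mval (\<lambda>i. y i + s * v i) t2 = mval y t2 + s * D2"
    and q2: "q * mval y t2 \<in> \<int>" using Plus.IH(2) Plus.prems le by auto
  define S where "S = mval y t1 + mval y t2"
  define D where "D = D1 + D2"
  have D: "\<bar>D\<bar> \<le> leaves (Plus t1 t2) * \<delta>"
    using D1 D2 by (simp add: D_def distrib_right)
  have "\<bar>D\<bar> * q \<le> leaves (Plus t1 t2) * \<delta> * q"
    by (rule mult_right_mono[OF D]) simp
  then have Dq: "\<bar>D\<bar> * q \<le> 1" using Plus.prems(5) by linarith
  have eq: "mval (\<lambda>i. y i + s * v i) (Plus t1 t2) = min 1 (S + s * D)" if "s \<in> {0..1}" for s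
    using D1 D2 that by (simp add: S_def D_def algebra_simps)
  from q1 q2 have qS: "q * S \<in> \<int>" by (simp add: S_def distrib_left)
  then obtain m :: int where m: "q * S = m" by (auto elim: Ints_cases)
  have int: "q * mval y (Plus t1 t2) \<in> \<int>"
    using qS by (simp add: S_def min_def)
  have sD: "\<bar>s * D\<bar> * q \<le> 1" if "s \<in> {0..1}" for s
  proof -
    have "\<bar>s * D\<bar> * q \<le> 1 * (\<bar>D\<bar> * q)"
      using that by (auto simp: abs_mult mult.assoc mult_left_le_one_le)
    with Dq show ?thesis by simp
  qed
  have lo: "- 1 \<le> q * (s * D)" and hi: "q * (s * D) \<le> 1" if "s \<in> {0..1}" for s
  proof -
    have "\<bar>q * (s * D)\<bar> \<le> 1" using sD[OF that] by (simp add: abs_mult mult.commute)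
    then show "- 1 \<le> q * (s * D)" "q * (s * D) \<le> 1" by (simp_all add: abs_le_iff)
  qed
  consider "m < int q" | "m = int q" | "m > int q" by linarith
  then have "\<exists>D. \<bar>D\<bar> \<le> leaves (Plus t1 t2) * \<delta> \<and>
     (\<forall>s\<in>{0..1}. min 1 (S + s * D') = min 1 S + s * D)" if "D' = D" for D'
  proof cases
    case 1
    have "S + s * D \<le> 1" if s: "s \<in> {0..1}" for s
    proof -
      have "real q * (S + s * D) \<le> real q * 1"
        using hi[OF s] m 1 by (simp add: distrib_left)
      then show ?thesis using \<open>q > 0\<close> by (simp add: mult_le_cancel_left)
    qed
    from this this[of 0] D that show ?thesis by (intro exI[of _ D]) auto
  next
    case 2
    then have "S = 1" using m \<open>q > 0\<close> by simp
    show ?thesis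
    proof (cases "D \<ge> 0")
      case True
      with \<open>S = 1\<close> that Plus.prems show ?thesis by (intro exI[of _ 0]) auto
    next
      case False
      then have "s * D \<le> 0" if "s \<in> {0..1}" for s
        using that by (auto simp: mult_nonneg_nonpos)
      with \<open>S = 1\<close> that D show ?thesis by (intro exI[of _ D]) auto
    qed
  next
    case 3
    have "1 \<le> S + s * D" if s: "s \<in> {0..1}" for s
    proof -
      have "real q * 1 \<le> real q * (S + s * D)"
        using lo[OF s] m 3 by (simp add: distrib_left)
      then show ?thesis using \<open>q > 0\<close> by (simp add: mult_le_cancel_left)
    qed
    from this this[of 0] that Plus.prems show ?thesis by (intro exI[of _ 0]) auto
  qed
  with eq int show ?case by (auto simp: S_def)
qed

text \<open>
  The Dirichlet approximation \<open>p / q\<close> of the rational point \<open>a / d\<close> and the Farey difference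
  \<open>(a - p) / (d - q)\<close> have \<open>a / d\<close> as their mediant, and terms with at most \<open>N\<close> leaves are affine
  on the segment between them.
\<close>

lemma farey_split:
  fixes a :: "nat \<Rightarrow> nat" and d n N :: nat
  assumes N: "N > 0" and d: "d > 2 * (2 * N) ^ n" and a: "\<And>i. i \<in> {1..n} \<Longrightarrow> a i \<le> d"
  obtains p p' :: "nat \<Rightarrow> nat" and q q' :: nat and s :: real
  where "0 < q" "q < d" "0 < q'" "q' < d" "0 \<le> s" "s \<le> 1"
    "\<And>i. i \<in> {1..n} \<Longrightarrow> p i \<le> q" "\<And>i. i \<in> {1..n} \<Longrightarrow> p' i \<le> q'"
    "\<And>t. mv_vars t \<subseteq> {1..n} \<Longrightarrow> leaves t \<le> N \<Longrightarrow>
       mval (\<lambda>i. a i / d) t = (1 - s) * mval (\<lambda>i. p i / q) t + s * mval (\<lambda>i. p' i / q') t"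
proof -
  have "2 * N > 0" using N by simp
  \<comment> \<open>The precision is \<open>1/(2N)\<close> rather than \<open>1/N\<close> because
    passing to the difference point costs the factor \<open>d / q' < 2\<close>. That factor comes
    from \<open>2 * q < d\<close>, hence from the leading \<open>2\<close> in the bound on
    \<open>d\<close>.\<close>
  then obtain Q P where Q: "0 < Q" "Q \<le> int ((2 * N) ^ n)"
    and P: "\<And>i. i < n \<Longrightarrow> \<bar>of_int Q * (a (Suc i) / d) - of_int (P i)\<bar> < 1 / (2 * N)"
    using Dirichlet_approx_simult[of "2 * N" n "\<lambda>i. a (Suc i) / d"] by auto
  define q where "q = nat Q"
  define q' where "q' = d - q"
  have "int q \<le> int ((2 * N) ^ n)" using Q by (simp add: q_def)
  then have "q \<le> (2 * N) ^ n" by (simp only: of_nat_le_iff)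
  then have q: "q > 0" "2 * q < d" using Q d by (auto simp: q_def)
  then have q': "q' > 0" "q' < d" "2 * q' > d" "real q' = real d - real q" "q < d"
    by (auto simp: q'_def)
  have d0: "d > 0" using q by simp
  \<comment> \<open>Dirichlet's theorem counts the coordinates from \<open>0\<close>, the cube from
    \<open>1\<close>.\<close>
  define p where "p i = nat (P (i - 1))" for i
  define p' where "p' i = a i - p i" for i
  define v where "v i = real (p' i) / q' - real (p i) / q" for i
  have main: "p i \<le> q \<and> p i \<le> a i \<and> p' i \<le> q' \<and> \<bar>v i\<bar> \<le> 1 / (N * q)"
    if i: "i \<in> {1..n}" for i
  proof -
    define w where "w = q * (a i / d) - of_int (P (i - 1))"
    have "\<bar>w\<bar> < 1 / (2 * N)"
      using P[of "i - 1"] i Q less_le_trans[of "i - 1" i n] by (simp add: w_def q_def)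
    also have "\<dots> \<le> 1 / 2" using N by (simp add: field_simps)
    finally have w2: "\<bar>w\<bar> < 1/2" .
    have wN: "\<bar>w\<bar> < 1 / (2 * N)" by fact
    have ad: "0 \<le> real (a i) / d" "real (a i) / d \<le> 1" using a[OF i] d0 by auto
    have "of_int (P (i - 1)) > (-1 :: real)"
      using w2 mult_nonneg_nonneg[OF of_nat_0_le_iff[of q] ad(1)] unfolding w_def by linarith
    then have P0: "P (i - 1) \<ge> 0" by linarith
    then have Pp: "of_int (P (i - 1)) = real (p i)" by (simp add: p_def)
    have wp: "w = q * (a i / d) - p i" unfolding w_def Pp ..
    have "q * (a i / d) \<le> q" using mult_left_le[OF ad(2), of q] by simp
    then have "real (p i) < q + 1" using w2 wp by linarith
    then have pq: "p i \<le> q" by linarith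
    \<comment> \<open>\<open>z\<close> is the coordinate of the difference point in real arithmetic,
      before the subtraction in \<open>p' i\<close> is known to be exact. It is closer than
      \<open>1 / q\<close> to \<open>p i / q\<close>, so \<open>z > 0\<close> unless
      \<open>p i = 0\<close>, and \<open>z < 1\<close> unless \<open>p i = q\<close>; the exceptions
      are immediate.\<close>
    define z where "z = (real (a i) - p i) / q'"
    have zv: "q * z - p i = w * (d / q')"
    proof -
      have "q * z - p i = (q * (real (a i) - p i) - p i * q') / q'"
        using q' by (simp add: z_def field_simps)
      also have "q * (real (a i) - p i) - p i * q' = w * d"
        using d0 by (simp add: wp q' field_simps)
      finally show ?thesis by simp
    qed
    have "d / q' < 2" using q' by (simp add: field_simps)
    have dq: "\<bar>w * (d / q')\<bar> \<le> \<bar>w\<bar> * 2"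
      unfolding abs_mult using \<open>d / q' < 2\<close> by (intro mult_left_mono) auto
    have z1: "\<bar>q * z - p i\<bar> < 1" using dq w2 unfolding zv by linarith
    have "\<bar>q * z - p i\<bar> \<le> 2 * (1 / (2 * N))" using dq wN unfolding zv by linarith
    then have zN: "\<bar>q * z - p i\<bar> \<le> 1 / N" by simp
    have pa: "p i \<le> a i"
    proof (cases "p i = 0")
      case False
      then have "q * z > 0" using z1 by linarith
      then have "z > 0" using q by (simp add: zero_less_mult_iff)
      then show ?thesis using q' by (simp add: z_def zero_less_divide_iff)
    qed simp
    have p': "real (p' i) = real (a i) - p i" using pa by (simp add: p'_def)
    have "p' i \<le> q'"
    proof (cases "p i = q")
      case True
      then show ?thesis using a[OF i] by (simp add: p'_def q'_def)
    next
      case False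
      then have "real (p i) + 1 \<le> q" using pq by linarith
      then have "real q * z < real q * 1" using z1 by linarith
      then have "z < 1" using q by (simp add: mult_less_cancel_left)
      then have "real (p' i) < q'" using q' by (simp add: z_def p' field_simps)
      then show ?thesis by simp
    qed
    have "v i = (q * z - p i) / q" using q by (simp add: v_def z_def p' field_simps)
    then have "\<bar>v i\<bar> = \<bar>q * z - p i\<bar> / q" by simp
    also have "\<dots> \<le> (1 / N) / q" using zN by (intro divide_right_mono) auto
    finally have "\<bar>v i\<bar> \<le> 1 / (N * q)" by simp
    with pq pa \<open>p' i \<le> q'\<close> show ?thesis by simp
  qed
  \<comment> \<open>The weight in the mediant: \<open>a / d\<close> is \<open>q / d\<close> times
    \<open>p / q\<close> plus \<open>q' / d\<close> times \<open>p' / q'\<close>.\<close>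
  define s where "s = q' / real d"
  have s: "0 \<le> s" "s \<le> 1" using q' by (auto simp: s_def field_simps)
  show ?thesis
  proof (rule that[of q q' s p p'])
    fix t assume t: "mv_vars t \<subseteq> {1..n}" "leaves t \<le> N"
    let ?y = "\<lambda>i. real (p i) / q"
    have "leaves t * (1 / (N * q)) * q = leaves t / N" using q by simp
    also have "\<dots> \<le> 1" using t N by simp
    finally obtain D where D: "\<forall>s\<in>{0..1}. mval (\<lambda>i. ?y i + s * v i) t = mval ?y t + s * D"
      using mval_segment[of q "1 / (N * q)" t ?y v] main t q by (auto simp: subset_eq)
    have "mval (\<lambda>i. ?y i + s * v i) t = mval (\<lambda>i. a i / d) t"
    proof (rule mval_cong)
      fix i assume "i \<in> mv_vars t"
      then have i: "i \<in> {1..n}" using t by auto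
      then have "real (p' i) = real (a i) - p i" using main[OF i] by (simp add: p'_def)
      have "?y i + s * v i = p' i / d + ?y i * (1 - q' / d)"
        using q'(1) by (simp add: v_def s_def right_diff_distrib mult.commute)
      also have "1 - q' / d = q / d" using d0 q' by (simp add: field_simps)
      also have "p' i / d + ?y i * (q / d) = (p' i + p i) / d"
        using q by (simp add: add_divide_distrib)
      finally show "?y i + s * v i = a i / d"
        using \<open>real (p' i) = real (a i) - p i\<close> by simp
    qed
    moreover have "mval (\<lambda>i. ?y i + 1 * v i) t = mval (\<lambda>i. p' i / q') t"
      by (rule mval_cong) (simp add: v_def)
    moreover have "mval (\<lambda>i. ?y i + 1 * v i) t = mval ?y t + 1 * D"
      "mval (\<lambda>i. ?y i + s * v i) t = mval ?y t + s * D"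
      using bspec[OF D, of 1] bspec[OF D, of s] s by simp_all
    ultimately show "mval (\<lambda>i. a i / d) t = (1 - s) * mval ?y t + s * mval (\<lambda>i. p' i / q') t"
      by (simp add: algebra_simps)
  qed (use q q' s main in auto)
qed

section \<open>Tests at points of bounded denominator\<close>

primrec nval :: "nat \<Rightarrow> (nat \<Rightarrow> nat) \<Rightarrow> mv_term \<Rightarrow> nat" where
  "nval d a (Var i) = a i"
| "nval d a Zero = 0"
| "nval d a (Neg t) = d - nval d a t"
| "nval d a (Plus s t) = min d (nval d a s + nval d a t)"

text \<open>Numerators over a fixed denominator are what a recursive function can evaluate. The
  truncated subtraction in \<open>nval\<close> is exact because numerators never exceed
  \<open>d\<close>.\<close>

lemma mval_nval:
  assumes "d > 0" "\<And>i. i \<in> mv_vars t \<Longrightarrow> a i \<le> d"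
  shows "nval d a t \<le> d \<and> mval (\<lambda>i. a i / d) t = nval d a t / d"
  using assms
proof (induction t)
  case (Neg t)
  then have "nval d a t \<le> d" "mval (\<lambda>i. a i / d) t = nval d a t / d" by auto
  then show ?case using Neg.prems(1) by (simp add: of_nat_diff diff_divide_distrib)
next
  case (Plus s t)
  then have *: "mval (\<lambda>i. a i / d) s = nval d a s / d" "mval (\<lambda>i. a i / d) t = nval d a t / d"
    by auto
  have "min 1 (real (nval d a s) / d + nval d a t / d) =
      min (real d) (real (nval d a s) + nval d a t) / d"
    using Plus.prems(1) by (simp add: min_def add_divide_distrib[symmetric] divide_le_eq)
  then show ?case using * by (simp add: of_nat_min)
qed auto

text \<open>Rounding down to denominator \<open>d\<close> changes each side by at most its Lipschitz
  constant times \<open>1 / d\<close>.\<close>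

lemma mval_le_of_rational:
  fixes m :: real
  assumes "m \<ge> 0" "mv_vars u \<subseteq> {1..n}" "mv_vars b \<subseteq> {1..n}"
    and le: "\<And>d a. \<lbrakk>0 < d; \<And>i. i \<in> {1..n} \<Longrightarrow> a i \<le> d\<rbrakk> \<Longrightarrow>
      mval (\<lambda>i. real (a i) / real d) u \<le> m * mval (\<lambda>i. real (a i) / real d) b"
    and x: "x \<in> unit_pts n"
  shows "mval x u \<le> m * mval x b"
proof (rule field_le_epsilon)
  fix e :: real assume "e > 0"
  define L where "L = leaves u + m * leaves b + 1"
  have L: "L \<ge> 1" using assms(1) by (simp add: L_def)
  define d where "d = nat \<lceil>L / e\<rceil> + 1"
  define a where "a i = nat \<lfloor>d * x i\<rfloor>" for i
  have d: "d > 0" "L / e \<le> d" by (auto simp: d_def) linarith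
  then have dL: "L * (1 / d) \<le> e" using \<open>e > 0\<close> by (simp add: field_simps)
  have a: "a i \<le> d \<and> \<bar>x i - a i / d\<bar> \<le> 1 / d" if i: "i \<in> {1..n}" for i
  proof -
    have xi: "0 \<le> x i" "x i \<le> 1" using x i by (auto simp: unit_pts_def)
    then have *: "real (a i) = of_int \<lfloor>d * x i\<rfloor>" by (simp add: a_def)
    have "d * x i \<le> d" using xi by (simp add: mult_left_le)
    then have "real (a i) \<le> d" unfolding * by linarith
    moreover have "\<bar>d * x i - a i\<bar> \<le> 1" unfolding * by linarith
    then have "\<bar>d * x i - a i\<bar> / d \<le> 1 / d" by (intro divide_right_mono) auto
    moreover have "\<bar>d * x i - a i\<bar> / d = \<bar>(d * x i - a i) / d\<bar>" by simp
    moreover have "(d * x i - a i) / d = x i - a i / d" using d by (simp add: field_simps)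
    ultimately show ?thesis by simp
  qed
  let ?y = "\<lambda>i. a i / d"
  have u: "\<bar>mval x u - mval ?y u\<bar> \<le> leaves u * (1 / d)"
    by (rule mval_lipschitz) (use assms(2) a in \<open>force+\<close>)
  have b: "\<bar>mval x b - mval ?y b\<bar> \<le> leaves b * (1 / d)"
    by (rule mval_lipschitz) (use assms(3) a in \<open>force+\<close>)
  have "mval x u \<le> mval ?y u + leaves u * (1 / d)" using u by linarith
  also have "mval ?y u \<le> m * mval ?y b" using le[of d a] d a by auto
  also have "m * mval ?y b \<le> m * (mval x b + leaves b * (1 / d))"
    using b assms(1) by (intro mult_left_mono) linarith+
  also have "m * (mval x b + leaves b * (1 / d)) + leaves u * (1 / d) =
      m * mval x b + (leaves u + m * leaves b) * (1 / d)"
    by (simp add: algebra_simps add_divide_distrib)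
  also have "(leaves u + m * leaves b) * (1 / d) \<le> L * (1 / d)"
    by (intro mult_right_mono) (auto simp: L_def)
  finally show "mval x u \<le> m * mval x b + e" using dL by linarith
qed

text \<open>Strong induction on the denominator: both terms are affine on the segment of
  \<open>farey_split\<close>, so the inequality at \<open>a / d\<close> is a convex combination of
  two inequalities at smaller denominators. The factor \<open>m\<close> lets one descent serve
  identities, with \<open>m = 1\<close>, as well as domination by a multiple.\<close>

lemma mval_le_of_small_denominators:
  fixes m :: real
  assumes "N > 0" "m \<ge> 0" "mv_vars u \<subseteq> {1..n}" "mv_vars b \<subseteq> {1..n}" "leaves u \<le> N" "leaves b \<le> N"
    and small: "\<And>d a. \<lbrakk>0 < d; d \<le> 2 * (2 * N) ^ n; \<And>i. i \<in> {1..n} \<Longrightarrow> a i \<le> d\<rbrakk> \<Longrightarrow>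
      mval (\<lambda>i. real (a i) / real d) u \<le> m * mval (\<lambda>i. real (a i) / real d) b"
    and x: "x \<in> unit_pts n"
  shows "mval x u \<le> m * mval x b"
proof (rule mval_le_of_rational[OF assms(2-4) _ x])
  fix d :: nat and a assume "0 < d" "\<And>i. i \<in> {1..n} \<Longrightarrow> a i \<le> d"
  then show "mval (\<lambda>i. a i / d) u \<le> m * mval (\<lambda>i. a i / d) b"
  proof (induction d arbitrary: a rule: less_induct)
    case (less d)
    show ?case
    proof (cases "d \<le> 2 * (2 * N) ^ n")
      case True
      with less.prems small show ?thesis by blast
    next
      case False
      then have large: "d > 2 * (2 * N) ^ n" by simp
      show ?thesis
      proof (rule farey_split[OF \<open>N > 0\<close> large less.prems(2)])
        fix p p' :: "nat \<Rightarrow> nat" and q q' :: nat and s :: real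
        assume *: "0 < q" "q < d" "0 < q'" "q' < d" "0 \<le> s" "s \<le> 1"
            "\<And>i. i \<in> {1..n} \<Longrightarrow> p i \<le> q" "\<And>i. i \<in> {1..n} \<Longrightarrow> p' i \<le> q'"
          and aff: "\<And>t. mv_vars t \<subseteq> {1..n} \<Longrightarrow> leaves t \<le> N \<Longrightarrow>
            mval (\<lambda>i. a i / d) t = (1 - s) * mval (\<lambda>i. p i / q) t + s * mval (\<lambda>i. p' i / q') t"
        have "mval (\<lambda>i. a i / d) u = (1 - s) * mval (\<lambda>i. p i / q) u + s * mval (\<lambda>i. p' i / q') u"
          using aff assms by blast
        also have "\<dots> \<le> (1 - s) * (m * mval (\<lambda>i. p i / q) b) + s * (m * mval (\<lambda>i. p' i / q') b)"
          using * less.IH by (intro add_mono mult_left_mono) auto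
        also have "\<dots> = m * ((1 - s) * mval (\<lambda>i. p i / q) b + s * mval (\<lambda>i. p' i / q') b)"
          by (simp add: algebra_simps)
        also have "(1 - s) * mval (\<lambda>i. p i / q) b + s * mval (\<lambda>i. p' i / q') b = mval (\<lambda>i. a i / d) b"
          using aff assms by simp
        finally show ?thesis .
      qed auto
    qed
  qed
qed

lemma mval_eq_of_small_denominators:
  assumes "N > 0" "mv_vars s \<subseteq> {1..n}" "mv_vars t \<subseteq> {1..n}" "leaves s \<le> N" "leaves t \<le> N"
    and small: "\<And>d a. \<lbrakk>0 < d; d \<le> 2 * (2 * N) ^ n; \<And>i. i \<in> {1..n} \<Longrightarrow> a i \<le> d\<rbrakk> \<Longrightarrow>
      nval d a s = nval d a t"
    and x: "x \<in> unit_pts n"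
  shows "mval x s = mval x t"
proof -
  have eq: "mval (\<lambda>i. a i / d) s = mval (\<lambda>i. a i / d) t"
    if "0 < d" "d \<le> 2 * (2 * N) ^ n" "\<And>i. i \<in> {1..n} \<Longrightarrow> a i \<le> d" for d and a :: "nat \<Rightarrow> nat"
    using small[OF that] that assms(2,3) mval_nval[of d s a] mval_nval[of d t a]
    by (simp add: subset_eq)
  have "mval x s \<le> 1 * mval x t"
    by (rule mval_le_of_small_denominators[OF assms(1) _ assms(2,3,4,5) _ x]) (simp_all only: eq mult_1 order_refl zero_le_one)
  moreover have "mval x t \<le> 1 * mval x s"
    by (rule mval_le_of_small_denominators[OF assms(1) _ assms(3,2,5,4) _ x]) (simp_all only: eq mult_1 order_refl zero_le_one)
  ultimately show ?thesis by simp
qed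

text \<open>At a denominator \<open>d \<le> B\<close> a nonzero value of \<open>b\<close> is at
  least \<open>1 / d \<ge> 1 / B\<close>, while \<open>u\<close> is at most \<open>1\<close>. So the
  threshold \<open>B\<close> of the descent is itself a suitable factor.\<close>

lemma mval_le_mult_if_zero_set_subset:
  assumes vars: "mv_vars u \<subseteq> {1..n}" "mv_vars b \<subseteq> {1..n}"
    and zero: "\<And>x. x \<in> unit_pts n \<Longrightarrow> mval x b = 0 \<Longrightarrow> mval x u = 0"
  shows "\<exists>m::nat. \<forall>x\<in>unit_pts n. mval x u \<le> m * mval x b"
proof -
  define N where "N = max (leaves u) (leaves b) + 1"
  define B where "B = 2 * (2 * N) ^ n"
  have N: "N > 0" "leaves u \<le> N" "leaves b \<le> N" by (auto simp: N_def)
  have "mval x u \<le> real B * mval x b" if x: "x \<in> unit_pts n" for x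
  proof (rule mval_le_of_small_denominators[OF N(1) _ vars N(2,3) _ x])
    fix d :: nat and a assume *: "0 < d" "d \<le> 2 * (2 * N) ^ n" "\<And>i. i \<in> {1..n} \<Longrightarrow> a i \<le> d"
    let ?x = "\<lambda>i. real (a i) / d"
    have x: "?x \<in> unit_pts n" using * by (auto simp: unit_pts_def)
    have nb: "mval ?x b = nval d a b / d"
      using mval_nval[of d b a] vars * by (auto simp: subset_eq)
    show "mval ?x u \<le> real B * mval ?x b"
    proof (cases "nval d a b = 0")
      case True
      then show ?thesis using zero[OF x] nb by simp
    next
      case False
      have "mval ?x u \<le> 1" using mval_bounds[OF vars(1) x] by simp
      also have "1 \<le> B / d" using * by (simp add: B_def field_simps del: of_nat_mult of_nat_power)
      also have "\<dots> \<le> B * (nval d a b / d)"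
        using False * by (simp add: field_simps mult_le_cancel_left1)
      finally show ?thesis by (simp add: nb)
    qed
  qed simp
  then show ?thesis by blast
qed

section \<open>Integer combinations and duality\<close>

definition mv_closed :: "mv_term set \<Rightarrow> bool" where
  "mv_closed G \<longleftrightarrow> Zero \<in> G \<and> (\<forall>s\<in>G. Neg s \<in> G) \<and> (\<forall>s\<in>G. \<forall>t\<in>G. Plus s t \<in> G)"

definition clip :: "real \<Rightarrow> real" where
  "clip r = max 0 (min 1 r)"

text \<open>All integer offsets occur at once because adding a generator at offset \<open>e\<close>
  also uses the offset \<open>e + 1\<close>.\<close>

definition clippable :: "nat \<Rightarrow> mv_term set \<Rightarrow> ((nat \<Rightarrow> real) \<Rightarrow> real) \<Rightarrow> bool" where
  "clippable n G \<phi> \<longleftrightarrow> (\<forall>e::int. \<exists>t\<in>G. \<forall>x\<in>unit_pts n. mval x t = clip (\<phi> x + e))"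

text \<open>The classical identity behind McNaughton's theorem: with \<open>a \<odot> b\<close> for
  \<open>Neg (Plus (Neg a) (Neg b))\<close>, the right-hand side is
  \<open>(clip r \<oplus> g) \<odot> clip (r + 1)\<close>.\<close>

lemma clip_add:
  assumes g: "0 \<le> g" "g \<le> 1"
  shows "clip (r + g) = 1 - min 1 ((1 - min 1 (clip r + g)) + (1 - clip (r + 1)))"
proof -
  consider "r \<le> -1" | "-1 \<le> r" "r \<le> 0" | "0 \<le> r" "r \<le> 1" | "1 \<le> r" by linarith
  then show ?thesis
  proof cases
    case 1
    then have "clip r = 0" "clip (r + 1) = 0" "clip (r + g) = 0" using g by (auto simp: clip_def)
    with g show ?thesis by simp
  next
    case 2
    then have "clip r = 0" "clip (r + 1) = r + 1" by (auto simp: clip_def)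
    with 2 g show ?thesis by (auto simp: clip_def min_def max_def)
  next
    case 3
    then have "clip r = r" "clip (r + 1) = 1" by (auto simp: clip_def)
    with 3 g show ?thesis by (auto simp: clip_def min_def max_def)
  next
    case 4
    then have "clip r = 1" "clip (r + 1) = 1" "clip (r + g) = 1" using g by (auto simp: clip_def)
    with g show ?thesis by simp
  qed
qed

lemma clippable_zero:
  assumes G: "mv_closed G"
  shows "clippable n G (\<lambda>_. 0)"
  unfolding clippable_def
proof
  fix e :: int
  show "\<exists>t\<in>G. \<forall>x\<in>unit_pts n. mval x t = clip (0 + of_int e)"
  proof (cases "e \<le> 0")
    case True
    with G show ?thesis by (intro bexI[of _ Zero]) (auto simp: clip_def mv_closed_def)
  next
    case False
    with G show ?thesis by (intro bexI[of _ "Neg Zero"]) (auto simp: clip_def mv_closed_def)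
  qed
qed

lemma clippable_uminus:
  assumes G: "mv_closed G" and c: "clippable n G \<phi>"
  shows "clippable n G (\<lambda>x. - \<phi> x)"
  unfolding clippable_def
proof
  fix e :: int
  \<comment> \<open>Since \<open>1 - clip s = clip (1 - s)\<close>, the offset \<open>e\<close> of
    \<open>- \<phi>\<close> needs the offset \<open>1 - e\<close> of \<open>\<phi>\<close>.\<close>
  obtain t where t: "t \<in> G" "\<forall>x\<in>unit_pts n. mval x t = clip (\<phi> x + (1 - e))"
    using c[unfolded clippable_def, THEN spec, of "1 - e"] by auto
  show "\<exists>t\<in>G. \<forall>x\<in>unit_pts n. mval x t = clip (- \<phi> x + e)"
    using t G by (intro bexI[of _ "Neg t"]) (auto simp: clip_def mv_closed_def max_def min_def)
qed

lemma clippable_add: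
  assumes G: "mv_closed G" and c: "clippable n G \<phi>" and s: "s \<in> G" "mv_vars s \<subseteq> {1..n}"
  shows "clippable n G (\<lambda>x. \<phi> x + mval x s)"
  unfolding clippable_def
proof
  fix e :: int
  obtain t where t: "t \<in> G" "\<And>x. x \<in> unit_pts n \<Longrightarrow> mval x t = clip (\<phi> x + e)"
    using c[unfolded clippable_def, THEN spec, of e] by blast
  obtain t' where t': "t' \<in> G" "\<And>x. x \<in> unit_pts n \<Longrightarrow> mval x t' = clip (\<phi> x + e + 1)"
    using c[unfolded clippable_def, THEN spec, of "e + 1"] by (auto simp: add.assoc)
  let ?u = "Neg (Plus (Neg (Plus t s)) (Neg t'))"
  have "mval x ?u = clip (\<phi> x + mval x s + e)" if x: "x \<in> unit_pts n" for x
    using clip_add[of "mval x s" "\<phi> x + e"] mval_bounds[OF s(2) x] t(2)[OF x] t'(2)[OF x]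
    by (simp add: algebra_simps)
  then show "\<exists>t\<in>G. \<forall>x\<in>unit_pts n. mval x t = clip (\<phi> x + mval x s + e)"
    using G s t(1) t'(1) by (intro bexI[of _ ?u]) (auto simp: mv_closed_def)
qed

lemma clippable_add_mult:
  assumes G: "mv_closed G" and c: "clippable n G \<phi>" and s: "s \<in> G" "mv_vars s \<subseteq> {1..n}"
  shows "clippable n G (\<lambda>x. \<phi> x + of_int u * mval x s)"
proof -
  have nat: "clippable n G (\<lambda>x. \<phi> x + real m * mval x s)" if "clippable n G \<phi>" for m \<phi>
  proof (induction m)
    case 0
    then show ?case using that by simp
  next
    case (Suc m)
    from clippable_add[OF G this s] show ?case by (simp add: algebra_simps)
  qed
  show ?thesis
  proof (cases "u \<ge> 0")
    case True
    with nat[OF c, of "nat u"] show ?thesis by simp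
  next
    case False
    have "clippable n G (\<lambda>x. - (- \<phi> x + real (nat (- u)) * mval x s))"
      by (intro clippable_uminus nat G c)
    with False show ?thesis by (simp add: add.commute)
  qed
qed

definition int_comb :: "nat \<Rightarrow> (nat \<Rightarrow> mv_term) \<Rightarrow> ((nat \<Rightarrow> real) \<Rightarrow> real) \<Rightarrow> bool" where
  "int_comb k \<gamma> \<phi> \<longleftrightarrow> (\<exists>(e::int) (u::nat \<Rightarrow> int). \<forall>x.
     \<phi> x = of_int e + (\<Sum>l<k. of_int (u l) * mval x (\<gamma> l)))"

text \<open>The summands are added one at a time, and the constant is absorbed by the offset in
  \<open>clippable\<close>.\<close>

lemma int_comb_clip:
  assumes G: "mv_closed G" and \<gamma>: "\<And>l. l < k \<Longrightarrow> \<gamma> l \<in> G \<and> mv_vars (\<gamma> l) \<subseteq> {1..n}"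
    and \<phi>: "int_comb k \<gamma> \<phi>"
  shows "\<exists>t\<in>G. \<forall>x\<in>unit_pts n. mval x t = clip (\<phi> x)"
proof -
  from \<phi> obtain e u where eu: "\<And>x. \<phi> x = of_int e + (\<Sum>l<k. of_int (u l) * mval x (\<gamma> l))"
    unfolding int_comb_def by blast
  have "clippable n G (\<lambda>x. \<Sum>l<j. of_int (u l) * mval x (\<gamma> l))" if "j \<le> k" for j
    using that
  proof (induction j)
    case 0
    then show ?case using clippable_zero[OF G] by simp
  next
    case (Suc j)
    then have "clippable n G (\<lambda>x. \<Sum>l<j. of_int (u l) * mval x (\<gamma> l))" by simp
    from clippable_add_mult[OF G this, of "\<gamma> j" "u j"] \<gamma>[of j] Suc.prems
    show ?case by simp
  qed
  from this[of k] show ?thesis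
    by (simp add: clippable_def eu add.commute)
qed

lemma int_comb_const: "int_comb k \<gamma> (\<lambda>_. of_int e)"
  unfolding int_comb_def by (intro exI[of _ e] exI[of _ "\<lambda>_. 0"]) simp

lemma int_comb_add:
  assumes "int_comb k \<gamma> \<phi>" "int_comb k \<gamma> \<psi>"
  shows "int_comb k \<gamma> (\<lambda>x. \<phi> x + \<psi> x)"
proof -
  from assms obtain e u e' u' where
    *: "\<And>x. \<phi> x = of_int e + (\<Sum>l<k. of_int (u l) * mval x (\<gamma> l))"
       "\<And>x. \<psi> x = of_int e' + (\<Sum>l<k. of_int (u' l) * mval x (\<gamma> l))"
    unfolding int_comb_def by metis
  show ?thesis
    unfolding int_comb_def
    by (intro exI[of _ "e + e'"] exI[of _ "\<lambda>l. u l + u' l"]) (simp add: * distrib_right sum.distrib)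
qed

lemma int_comb_scale:
  assumes "int_comb k \<gamma> \<phi>"
  shows "int_comb k \<gamma> (\<lambda>x. of_int c * \<phi> x)"
proof -
  from assms obtain e u where
    *: "\<And>x. \<phi> x = of_int e + (\<Sum>l<k. of_int (u l) * mval x (\<gamma> l))"
    unfolding int_comb_def by metis
  show ?thesis
    unfolding int_comb_def
    by (intro exI[of _ "c * e"] exI[of _ "\<lambda>l. c * u l"])
       (simp add: * distrib_left sum_distrib_left mult.assoc)
qed

lemma int_comb_diff:
  assumes "int_comb k \<gamma> \<phi>" "int_comb k \<gamma> \<psi>"
  shows "int_comb k \<gamma> (\<lambda>x. \<phi> x - \<psi> x)"
  using int_comb_add[OF assms(1) int_comb_scale[OF assms(2), of "-1"]] by simp

lemma int_comb_sum:
  assumes "\<And>i. i \<in> I \<Longrightarrow> int_comb k \<gamma> (\<phi> i)"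
  shows "int_comb k \<gamma> (\<lambda>x. \<Sum>i\<in>I. \<phi> i x)"
  using assms
proof (induction I rule: infinite_finite_induct)
  case (insert i I)
  then show ?case by (simp add: int_comb_add)
qed (use int_comb_const[of k \<gamma> 0] in simp_all)

lemma sum_if_mult:
  fixes k l :: nat
  assumes "l < k"
  shows "(\<Sum>j<k. (if j = l then 1 else 0) * f j) = (f l :: 'a :: comm_semiring_1)"
proof -
  have "(\<Sum>j<k. (if j = l then 1 else 0) * f j) = (\<Sum>j<k. if j = l then f j else 0)"
    by (rule sum.cong) auto
  also have "\<dots> = f l" using assms by (subst sum.delta) auto
  finally show ?thesis .
qed

lemma int_comb_term:
  assumes "l < k"
  shows "int_comb k \<gamma> (\<lambda>x. mval x (\<gamma> l))"
  unfolding int_comb_def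
  by (intro exI[of _ 0] exI[of _ "\<lambda>j. if j = l then 1 else 0"])
     (simp add: if_distrib[of of_int] sum_if_mult[OF assms] cong: if_cong)

section \<open>Subgroups of the integers and extension of characters\<close>

lemma int_subgroup_multiples:
  fixes S :: "int set"
  assumes "0 \<in> S" and diff: "\<And>a b. a \<in> S \<Longrightarrow> b \<in> S \<Longrightarrow> a - b \<in> S"
  obtains m :: nat where "int m \<in> S" "\<And>a. a \<in> S \<Longrightarrow> int m dvd a"
proof (cases "\<exists>m>0. int m \<in> S")
  case False
  have "a = 0" if "a \<in> S" for a
  proof -
    have "- a \<in> S" using diff[OF assms(1) that] by simp
    moreover have "\<not> a > 0" "\<not> - a > 0"
      using False that \<open>- a \<in> S\<close> by (metis zero_less_imp_eq_int)+
    ultimately show ?thesis by linarith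
  qed
  \<comment> \<open>The trivial subgroup has the generator \<open>m = 0\<close>.\<close>
  with assms(1) show ?thesis using that[of 0] by fastforce
next
  case True
  define m where "m = (LEAST m. m > 0 \<and> int m \<in> S)"
  have m: "m > 0" "int m \<in> S"
    using LeastI_ex[OF True] by (auto simp: m_def)
  have least: "m \<le> j" if "j > 0" "int j \<in> S" for j
    unfolding m_def by (rule Least_le) (use that in blast)
  have neg: "- a \<in> S" if "a \<in> S" for a
    using diff[OF assms(1) that] by simp
  have add: "a + b \<in> S" if "a \<in> S" "b \<in> S" for a b
    using diff[OF that(1) neg[OF that(2)]] by simp
  have nat: "int j * int m \<in> S" for j
    by (induction j) (use assms(1) m(2) add in \<open>auto simp: distrib_right\<close>)
  have int: "j * int m \<in> S" for j
  proof (cases "j \<ge> 0")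
    case True
    with nat[of "nat j"] show ?thesis by simp
  next
    case False
    with neg[OF nat[of "nat (- j)"]] show ?thesis by simp
  qed
  have "int m dvd a" if "a \<in> S" for a
  proof (rule ccontr)
    assume "\<not> int m dvd a"
    then have r: "0 < a mod int m" "a mod int m < int m"
      using m(1) pos_mod_sign[of "int m" a] pos_mod_bound[of "int m" a]
      unfolding dvd_eq_mod_eq_0 by linarith+
    have "a mod int m \<in> S"
      using diff[OF that int[of "a div int m"]] by (simp add: minus_div_mult_eq_mod)
    then have "m \<le> nat (a mod int m)" using least[of "nat (a mod int m)"] r(1) by simp
    with r show False by linarith
  qed
  with m that show ?thesis by blast
qed

text \<open>
  A homomorphism from a subgroup of \<open>\<int>\<^sup>n\<close> to \<open>\<rat> / T\<close> extends to \<open>\<int>\<^sup>n\<close>. The homomorphism is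
  given by its graph \<open>H\<close>, and the extension by the images \<open>v i\<close> of the unit vectors.
\<close>

lemma extend_character:
  fixes H :: "((nat \<Rightarrow> int) \<times> rat) set" and T :: "rat set"
  assumes T: "0 \<in> T" "\<And>a b. a \<in> T \<Longrightarrow> b \<in> T \<Longrightarrow> a - b \<in> T"
    and H0: "(\<lambda>_. 0, 0) \<in> H"
    and Hd: "\<And>h s h' s'. (h, s) \<in> H \<Longrightarrow> (h', s') \<in> H \<Longrightarrow> (\<lambda>i. h i - h' i, s - s') \<in> H"
    and Hz: "\<And>h s. (h, s) \<in> H \<Longrightarrow> \<forall>i\<in>{1..n}. h i = 0 \<Longrightarrow> s \<in> T"
  shows "\<exists>v. \<forall>(h, s)\<in>H. s - (\<Sum>i\<in>{1..n}. of_int (h i) * v i) \<in> T"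
  using H0 Hd Hz
proof (induction n arbitrary: H)
  case 0
  then show ?case by auto
next
  case (Suc n)
  note H0 = Suc.prems(1) and Hd = Suc.prems(2) and Hz = Suc.prems(3)
  \<comment> \<open>The elements with vanishing last coordinate form a problem with one dimension
    less.\<close>
  define H' where "H' = {(h, s) \<in> H. h (Suc n) = 0}"
  have "\<exists>v. \<forall>(h, s)\<in>H'. s - (\<Sum>i\<in>{1..n}. of_int (h i) * v i) \<in> T"
  proof (rule Suc.IH)
    fix h s assume hs: "(h, s) \<in> H'" "\<forall>i\<in>{1..n}. h i = 0"
    then have "\<forall>i\<in>{1..Suc n}. h i = 0" by (auto simp: H'_def le_Suc_eq)
    then show "s \<in> T" using hs(1) Hz[of h s] by (auto simp: H'_def)
  qed (use H0 Hd in \<open>auto simp: H'_def\<close>)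
  then obtain v where v: "\<And>h s. (h, s) \<in> H' \<Longrightarrow> s - (\<Sum>i\<in>{1..n}. of_int (h i) * v i) \<in> T"
    by blast
  have Hneg: "(\<lambda>i. - h i, - s) \<in> H" if "(h, s) \<in> H" for h s
    using Hd[OF H0 that] by simp
  have Hadd: "(\<lambda>i. h i + h' i, s + s') \<in> H" if "(h, s) \<in> H" "(h', s') \<in> H" for h s h' s'
    using Hd[OF that(1) Hneg[OF that(2)]] by simp
  have Hnat: "(\<lambda>i. int m * h i, of_nat m * s) \<in> H" if "(h, s) \<in> H" for m h s
  proof (induction m)
    case 0
    then show ?case using H0 by simp
  next
    case (Suc m)
    from Hadd[OF this that] show ?case by (simp add: algebra_simps)
  qed
  have Hint: "(\<lambda>i. m * h i, of_int m * s) \<in> H" if "(h, s) \<in> H" for m h s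
  proof (cases "m \<ge> 0")
    case True
    with Hnat[OF that, of "nat m"] show ?thesis by simp
  next
    case False
    with Hneg[OF Hnat[OF that, of "nat (- m)"]] show ?thesis by simp
  qed
  define S where "S = (\<lambda>(h, s). h (Suc n)) ` H"
  have S: "h (Suc n) \<in> S" if "(h, s) \<in> H" for h s
    using that by (force simp: S_def)
  have "0 \<in> S" using S[OF H0] by simp
  moreover have "b - b' \<in> S" if "b \<in> S" "b' \<in> S" for b b'
    using that Hd S by (fastforce simp: S_def)
  ultimately obtain m where mS: "int m \<in> S" and dvd: "\<And>b. b \<in> S \<Longrightarrow> int m dvd b"
    using int_subgroup_multiples[of S] by metis
  from mS obtain a \<phi> where m: "(a, \<phi>) \<in> H" "a (Suc n) = int m" by (force simp: S_def)
  \<comment> \<open>The image of the last unit vector must satisfy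
    \<open>m * c = \<phi> - \<Sum>\<close>, which is solvable because the rationals are divisible.
    For \<open>m = 0\<close> all last coordinates in \<open>H\<close> vanish and the value of
    \<open>c\<close> does not matter.\<close>
  define c where "c = (\<phi> - (\<Sum>i\<in>{1..n}. of_int (a i) * v i)) / of_nat m"
  have "s - (\<Sum>i\<in>{1..Suc n}. of_int (h i) * (v(Suc n := c)) i) \<in> T" if hs: "(h, s) \<in> H" for h s
  proof -
    have "int m dvd h (Suc n)" using dvd S[OF hs] by blast
    then obtain j' where "h (Suc n) = int m * j'" by (auto simp: dvd_def)
    then obtain j where j: "h (Suc n) = int m * j" "m = 0 \<Longrightarrow> j = 0"
      by (cases "m = 0") auto
    \<comment> \<open>Subtracting \<open>j\<close> times the pivot element clears the last
      coordinate, and \<open>v\<close> is already right on \<open>H'\<close>.\<close>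
    have "(\<lambda>i. h i - j * a i, s - of_int j * \<phi>) \<in> H'"
      using Hd[OF hs Hint[OF m(1), of j]] j m(2) by (simp add: H'_def mult.commute)
    note v[OF this]
    also have "(\<Sum>i\<in>{1..n}. of_int (h i - j * a i) * v i) =
        (\<Sum>i\<in>{1..n}. of_int (h i) * v i) - of_int j * (\<Sum>i\<in>{1..n}. of_int (a i) * v i)"
      by (simp add: left_diff_distrib sum_subtractf sum_distrib_left mult.assoc)
    also have "(\<Sum>i\<in>{1..n}. of_int (h i) * v i) = (\<Sum>i\<in>{1..n}. of_int (h i) * (v(Suc n := c)) i)"
      by (rule sum.cong) auto
    also have "s - of_int j * \<phi> - ((\<Sum>i\<in>{1..n}. of_int (h i) * (v(Suc n := c)) i) -
          of_int j * (\<Sum>i\<in>{1..n}. of_int (a i) * v i)) =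
        s - ((\<Sum>i\<in>{1..n}. of_int (h i) * (v(Suc n := c)) i) +
          of_int j * (\<phi> - (\<Sum>i\<in>{1..n}. of_int (a i) * v i)))"
      unfolding right_diff_distrib by linarith
    also have "of_int j * (\<phi> - (\<Sum>i\<in>{1..n}. of_int (a i) * v i)) = of_int (h (Suc n)) * c"
      using j(2) by (cases "m = 0") (simp_all add: j(1) c_def)
    finally show ?thesis by simp
  qed
  then show ?case by blast
qed

section \<open>Polyhedral pieces\<close>

definition aval :: "nat \<Rightarrow> int \<times> (nat \<Rightarrow> int) \<Rightarrow> (nat \<Rightarrow> real) \<Rightarrow> real" where
  "aval n p x = of_int (fst p) + (\<Sum>i\<in>{1..n}. of_int (snd p i) * x i)"

definition polyh :: "nat \<Rightarrow> (int \<times> (nat \<Rightarrow> int)) set \<Rightarrow> (nat \<Rightarrow> real) set" where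
  "polyh n D = {x \<in> unit_pts n. \<forall>\<alpha>\<in>D. aval n \<alpha> x \<le> 0}"

text \<open>A cover rather than a complex: pieces may overlap or be degenerate, so a common
  refinement is obtained by just uniting constraint sets.\<close>

definition pieces :: "nat \<Rightarrow> mv_term set \<Rightarrow> (int \<times> (nat \<Rightarrow> int)) set set \<Rightarrow> bool" where
  "pieces n F \<D> \<longleftrightarrow> finite \<D> \<and> (\<forall>D\<in>\<D>. finite D) \<and> unit_pts n \<subseteq> (\<Union>D\<in>\<D>. polyh n D) \<and>
     (\<forall>D\<in>\<D>. \<forall>t\<in>F. \<exists>p. \<forall>x\<in>polyh n D. mval x t = aval n p x)"

lemma aval_add: "aval n (a + c, \<lambda>i. b i + d i) x = aval n (a, b) x + aval n (c, d) x"
  by (simp add: aval_def distrib_right sum.distrib)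

lemma aval_uminus: "aval n (- a, \<lambda>i. - b i) x = - aval n (a, b) x"
  by (simp add: aval_def sum_negf)

lemma aval_const: "aval n (a, \<lambda>_. 0) x = of_int a"
  by (simp add: aval_def)

lemma aval_cong: "(\<And>i. i \<in> {1..n} \<Longrightarrow> x i = y i) \<Longrightarrow> aval n p x = aval n p y"
  by (simp add: aval_def)

lemma pieces_affine:
  "pieces n F \<D> \<Longrightarrow> D \<in> \<D> \<Longrightarrow> t \<in> F \<Longrightarrow> \<exists>p. \<forall>x\<in>polyh n D. mval x t = aval n p x"
  by (simp add: pieces_def)

lemma pieces_union:
  assumes "pieces n F1 \<D>1" "pieces n F2 \<D>2"
  shows "pieces n (F1 \<union> F2) ((\<lambda>(D, D'). D \<union> D') ` (\<D>1 \<times> \<D>2))"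
proof -
  have un: "polyh n (D \<union> D') = polyh n D \<inter> polyh n D'" for D D'
    by (auto simp: polyh_def)
  have "x \<in> (\<Union>D\<in>(\<lambda>(D, D'). D \<union> D') ` (\<D>1 \<times> \<D>2). polyh n D)" if x: "x \<in> unit_pts n" for x
  proof -
    obtain D D' where "D \<in> \<D>1" "D' \<in> \<D>2" "x \<in> polyh n D" "x \<in> polyh n D'"
      using assms x unfolding pieces_def by blast
    then show ?thesis by (auto simp: un)
  qed
  moreover have "\<exists>p. \<forall>x\<in>polyh n (D \<union> D'). mval x t = aval n p x"
    if "D \<in> \<D>1" "D' \<in> \<D>2" "t \<in> F1 \<union> F2" for D D' t
    using that pieces_affine[OF assms(1), of D t] pieces_affine[OF assms(2), of D' t]
    unfolding un by blast
  moreover have "finite \<D>1 \<and> finite \<D>2" "\<forall>D\<in>\<D>1 \<union> \<D>2. finite D"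
    using assms by (auto simp: pieces_def)
  ultimately show ?thesis
    by (simp add: pieces_def subset_iff)
qed

lemma pieces_term:
  assumes "mv_vars t \<subseteq> {1..n}"
  shows "\<exists>\<D>. pieces n {t} \<D>"
  using assms
proof (induction t)
  case (Var i)
  have "aval n (0, \<lambda>j. if j = i then 1 else 0) x = x i" for x
  proof -
    have "(\<Sum>j\<in>{1..n}. of_int (if j = i then 1 else 0) * x j) =
        (\<Sum>j\<in>{1..n}. if j = i then x j else 0)"
      by (rule sum.cong) auto
    with Var show ?thesis by (simp add: aval_def)
  qed
  then have "pieces n {Var i} {{}}"
    by (auto simp: pieces_def polyh_def intro!: exI[of _ 0] exI[of _ "\<lambda>j. if j = i then 1 else 0"])
  then show ?case by blast
next
  case Zero
  have "pieces n {Zero} {{}}"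
    by (auto simp: pieces_def polyh_def aval_const intro!: exI[of _ 0] exI[of _ "\<lambda>_. 0"])
  then show ?case by blast
next
  case (Neg t)
  then obtain \<D> where \<D>: "pieces n {t} \<D>" by auto
  have "\<exists>p. \<forall>x\<in>polyh n D. mval x (Neg t) = aval n p x" if "D \<in> \<D>" for D
  proof -
    obtain p where p: "\<And>x. x \<in> polyh n D \<Longrightarrow> mval x t = aval n p x"
      using pieces_affine[OF \<D> \<open>D \<in> \<D>\<close>] by blast
    have "mval x (Neg t) = aval n (1 + (- fst p), \<lambda>i. 0 + (- snd p i)) x" if "x \<in> polyh n D" for x
      using p[OF that] unfolding aval_add aval_uminus aval_const by simp
    then show ?thesis by blast
  qed
  moreover have "finite \<D>" "\<forall>D\<in>\<D>. finite D" "unit_pts n \<subseteq> (\<Union>D\<in>\<D>. polyh n D)"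
    using \<D> by (auto simp: pieces_def)
  ultimately have "pieces n {Neg t} \<D>"
    by (simp only: pieces_def simp_thms ball_simps) simp
  then show ?case by blast
next
  case (Plus s t)
  then obtain \<D>1 \<D>2 where "pieces n {s} \<D>1" "pieces n {t} \<D>2" by auto
  then obtain \<D> where \<D>: "pieces n {s, t} \<D>"
    using pieces_union[of n "{s}" \<D>1 "{t}" \<D>2] by (auto simp: insert_commute)
  then have "\<exists>p. \<forall>x\<in>polyh n D. mval x s + mval x t = aval n p x" if "D \<in> \<D>" for D
  proof -
    obtain p q where p: "\<And>x. x \<in> polyh n D \<Longrightarrow> mval x s = aval n p x"
      and q: "\<And>x. x \<in> polyh n D \<Longrightarrow> mval x t = aval n q x"
      using pieces_affine[OF \<D> \<open>D \<in> \<D>\<close>, of s] pieces_affine[OF \<D> \<open>D \<in> \<D>\<close>, of t] by auto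
    have "mval x s + mval x t = aval n (fst p + fst q, \<lambda>i. snd p i + snd q i) x"
      if "x \<in> polyh n D" for x
      using p[OF that] q[OF that] unfolding aval_add by simp
    then show ?thesis by blast
  qed
  then obtain P where P: "\<And>D x. D \<in> \<D> \<Longrightarrow> x \<in> polyh n D \<Longrightarrow> mval x s + mval x t = aval n (P D) x"
    by metis
  \<comment> \<open>Each piece is cut along the hyperplane where the sum equals \<open>1\<close>. In
    the form \<open>\<le> 0\<close>, \<open>lo\<close> says that the sum is at most
    \<open>1\<close>, so \<open>Plus\<close> is the sum, and \<open>hi\<close> that it is at least
    \<open>1\<close>, so \<open>Plus\<close> is constant.\<close>
  define lo where "lo D = (- 1 + fst (P D), \<lambda>i. 0 + snd (P D) i)" for D
  define hi where "hi D = (1 + - fst (P D), \<lambda>i. 0 + - snd (P D) i)" for D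
  have lo: "aval n (lo D) x = aval n (P D) x - 1" and hi: "aval n (hi D) x = 1 - aval n (P D) x" for D x
    unfolding lo_def hi_def aval_add aval_uminus aval_const by simp_all
  have pin: "polyh n (insert \<alpha> D) = {x \<in> polyh n D. aval n \<alpha> x \<le> 0}" for \<alpha> D
    by (auto simp: polyh_def)
  let ?\<D> = "(\<lambda>D. insert (lo D) D) ` \<D> \<union> (\<lambda>D. insert (hi D) D) ` \<D>"
  have "pieces n {Plus s t} ?\<D>"
    unfolding pieces_def
  proof (intro conjI)
    show "finite ?\<D>" "\<forall>D\<in>?\<D>. finite D"
      using \<D> by (auto simp: pieces_def)
    show "unit_pts n \<subseteq> (\<Union>D\<in>?\<D>. polyh n D)"
    proof
      fix x assume "x \<in> unit_pts n"
      then obtain D where D: "D \<in> \<D>" "x \<in> polyh n D" using \<D> by (auto simp: pieces_def)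
      then have "x \<in> polyh n (insert (lo D) D) \<or> x \<in> polyh n (insert (hi D) D)"
        by (auto simp: pin lo hi)
      with D show "x \<in> (\<Union>D\<in>?\<D>. polyh n D)" by blast
    qed
    have "\<forall>x\<in>polyh n (insert (lo D) D). mval x (Plus s t) = aval n (P D) x" if "D \<in> \<D>" for D
      using P[OF that] by (auto simp: pin lo)
    moreover have "\<forall>x\<in>polyh n (insert (hi D) D). mval x (Plus s t) = aval n (1, \<lambda>_. 0) x"
      if "D \<in> \<D>" for D
      using P[OF that] by (auto simp: pin hi aval_const)
    ultimately show "\<forall>D\<in>?\<D>. \<forall>t\<in>{Plus s t}. \<exists>p. \<forall>x\<in>polyh n D. mval x t = aval n p x"
      by blast
  qed
  then show ?case by blast
qed

lemma pieces_finite: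
  assumes "finite F" "\<And>t. t \<in> F \<Longrightarrow> mv_vars t \<subseteq> {1..n}"
  shows "\<exists>\<D>. pieces n F \<D>"
  using assms
proof (induction F)
  case empty
  have "pieces n {} {{}}" by (auto simp: pieces_def polyh_def)
  then show ?case by blast
next
  case (insert t F)
  then obtain \<D>1 \<D>2 where "pieces n {t} \<D>1" "pieces n F \<D>2"
    using pieces_term[of t n] by auto
  from pieces_union[OF this] show ?case by auto
qed

section \<open>Polyhedra with nonempty interior\<close>

definition obox :: "nat \<Rightarrow> (nat \<Rightarrow> real) \<Rightarrow> real \<Rightarrow> (nat \<Rightarrow> real) set" where
  "obox n x \<epsilon> = {y. \<forall>i\<in>{1..n}. \<bar>y i - x i\<bar> < \<epsilon>}"

definition fat :: "nat \<Rightarrow> (int \<times> (nat \<Rightarrow> int)) set \<Rightarrow> bool" where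
  "fat n D \<longleftrightarrow> (\<exists>x \<epsilon>. \<epsilon> > 0 \<and> obox n x \<epsilon> \<subseteq> polyh n D)"

lemma obox_mono: "\<epsilon> \<le> \<delta> \<Longrightarrow> obox n x \<epsilon> \<subseteq> obox n x \<delta>"
  by (force simp: obox_def)

lemma obox_open:
  assumes "y \<in> obox n x \<epsilon>"
  obtains \<delta> where "\<delta> > 0" "obox n y \<delta> \<subseteq> obox n x \<epsilon>"
proof -
  define \<delta> where "\<delta> = Min (insert 1 ((\<lambda>i. \<epsilon> - \<bar>y i - x i\<bar>) ` {1..n}))"
  have "\<delta> > 0" using assms by (auto simp: \<delta>_def obox_def)
  moreover have "\<delta> \<le> \<epsilon> - \<bar>y i - x i\<bar>" if "i \<in> {1..n}" for i
    unfolding \<delta>_def by (rule Min_le) (use that in auto)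
  then have "obox n y \<delta> \<subseteq> obox n x \<epsilon>" by (force simp: obox_def)
  ultimately show ?thesis by (rule that)
qed

lemma polyh_closed:
  assumes "x \<notin> polyh n D"
  obtains \<delta> where "\<delta> > 0" "obox n x \<delta> \<inter> polyh n D = {}"
proof -
  consider i where "i \<in> {1..n}" "x i < 0" | i where "i \<in> {1..n}" "x i > 1"
    | \<alpha> where "\<alpha> \<in> D" "aval n \<alpha> x > 0"
    using assms by (force simp: polyh_def unit_pts_def)
  then show ?thesis
  proof cases
    case 1
    then have "obox n x (- x i) \<inter> polyh n D = {}"
      by (force simp: obox_def polyh_def unit_pts_def)
    with 1 show ?thesis by (intro that[of "- x i"]) auto
  next
    case 2
    then have "obox n x (x i - 1) \<inter> polyh n D = {}"
      by (force simp: obox_def polyh_def unit_pts_def)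
    with 2 show ?thesis by (intro that[of "x i - 1"]) auto
  next
    case 3
    \<comment> \<open>The sum of the absolute coefficients bounds the slope in the maximum norm; the
      added \<open>1\<close> makes \<open>L\<close> positive and the final estimate strict.\<close>
    define L where "L = (\<Sum>i\<in>{1..n}. \<bar>real_of_int (snd \<alpha> i)\<bar>) + 1"
    have L: "L > 0" by (auto simp: L_def intro: add_nonneg_pos sum_nonneg)
    define \<delta> where "\<delta> = aval n \<alpha> x / L"
    have \<delta>: "\<delta> > 0" using 3 L by (simp add: \<delta>_def)
    have "aval n \<alpha> y > 0" if y: "y \<in> obox n x \<delta>" for y
    proof -
      have "aval n \<alpha> x - aval n \<alpha> y = (\<Sum>i\<in>{1..n}. of_int (snd \<alpha> i) * (x i - y i))"
        by (simp add: aval_def sum_subtractf right_diff_distrib)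
      also have "\<dots> \<le> (\<Sum>i\<in>{1..n}. \<bar>real_of_int (snd \<alpha> i)\<bar> * \<delta>)"
      proof (rule sum_mono)
        fix i assume i: "i \<in> {1..n}"
        have "of_int (snd \<alpha> i) * (x i - y i) \<le> \<bar>real_of_int (snd \<alpha> i)\<bar> * \<bar>x i - y i\<bar>"
          by (metis abs_ge_self abs_mult)
        also have "\<dots> \<le> \<bar>real_of_int (snd \<alpha> i)\<bar> * \<delta>"
          using y i by (intro mult_left_mono) (auto simp: obox_def abs_minus_commute less_imp_le)
        finally show "of_int (snd \<alpha> i) * (x i - y i) \<le> \<bar>real_of_int (snd \<alpha> i)\<bar> * \<delta>" .
      qed
      also have "\<dots> = (L - 1) * \<delta>" by (simp add: L_def sum_distrib_right)
      also have "\<dots> < L * \<delta>" using \<delta> by simp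
      also have "\<dots> = aval n \<alpha> x" using L by (simp add: \<delta>_def)
      finally show ?thesis by simp
    qed
    then have "obox n x \<delta> \<inter> polyh n D = {}"
      using 3(1) by (force simp: polyh_def)
    with \<delta> show ?thesis by (rule that)
  qed
qed

text \<open>If no fat piece contains \<open>x\<close>, some box around \<open>x\<close> misses all
  of them, since they are closed and finitely many. Inside it a smaller box avoids the other pieces
  one after another, because each is closed without interior. The centre of the last box is then a
  point of the cube in no piece.\<close>

lemma fat_pieces_cover:
  assumes \<D>: "pieces n F \<D>" and x: "x \<in> unit_pts n"
  obtains D where "D \<in> \<D>" "fat n D" "x \<in> polyh n D"
proof (rule ccontr)
  assume "\<not> thesis"
  with that have no: "x \<notin> polyh n D" if "D \<in> \<D>" "fat n D" for D
    using \<open>D \<in> \<D>\<close> \<open>fat n D\<close> by blast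
  have near: "\<exists>\<delta>>0. \<forall>D\<in>\<C>. obox n x \<delta> \<inter> polyh n D = {}"
    if "finite \<C>" "\<And>D. D \<in> \<C> \<Longrightarrow> x \<notin> polyh n D" for \<C>
    using that
  proof (induction \<C>)
    case (insert D \<C>)
    then obtain \<delta> where \<delta>: "\<delta> > 0" "\<forall>D\<in>\<C>. obox n x \<delta> \<inter> polyh n D = {}" by auto
    obtain \<delta>' where \<delta>': "\<delta>' > 0" "obox n x \<delta>' \<inter> polyh n D = {}"
      using polyh_closed[of x n D] insert.prems by auto
    show ?case
      using \<delta> \<delta>' obox_mono[of "min \<delta> \<delta>'" \<delta> n x] obox_mono[of "min \<delta> \<delta>'" \<delta>' n x]
      by (intro exI[of _ "min \<delta> \<delta>'"]) auto
  qed (auto intro!: exI[of _ 1])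
  have avoid: "\<exists>z \<delta>. \<delta> > 0 \<and> obox n z \<delta> \<subseteq> obox n y \<epsilon> \<and> (\<forall>D\<in>\<C>. obox n z \<delta> \<inter> polyh n D = {})"
    if "finite \<C>" "\<And>D. D \<in> \<C> \<Longrightarrow> \<not> fat n D" "\<epsilon> > 0" for \<C> y \<epsilon>
    using that
  proof (induction \<C>)
    case (insert D \<C>)
    then obtain z \<delta> where z: "\<delta> > 0" "obox n z \<delta> \<subseteq> obox n y \<epsilon>"
      "\<forall>D\<in>\<C>. obox n z \<delta> \<inter> polyh n D = {}" by auto
    have "\<not> fat n D" using insert.prems by simp
    with z(1) obtain w where w: "w \<in> obox n z \<delta>" "w \<notin> polyh n D"
      by (auto simp: fat_def)
    obtain \<delta>1 where \<delta>1: "\<delta>1 > 0" "obox n w \<delta>1 \<subseteq> obox n z \<delta>"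
      by (rule obox_open[OF w(1)])
    obtain \<delta>2 where \<delta>2: "\<delta>2 > 0" "obox n w \<delta>2 \<inter> polyh n D = {}"
      by (rule polyh_closed[OF w(2)])
    have "obox n w (min \<delta>1 \<delta>2) \<subseteq> obox n z \<delta>" "obox n w (min \<delta>1 \<delta>2) \<inter> polyh n D = {}"
      using \<delta>1 \<delta>2 obox_mono[of "min \<delta>1 \<delta>2" \<delta>1 n w] obox_mono[of "min \<delta>1 \<delta>2" \<delta>2 n w] by auto
    with z \<delta>1(1) \<delta>2(1) show ?case
      by (intro exI[of _ w] exI[of _ "min \<delta>1 \<delta>2"]) auto
  qed blast
  have fin: "finite \<D>" using \<D> by (simp add: pieces_def)
  obtain \<delta> where \<delta>: "\<delta> > 0" "\<And>D. D \<in> \<D> \<Longrightarrow> fat n D \<Longrightarrow> obox n x \<delta> \<inter> polyh n D = {}"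
    using near[of "{D \<in> \<D>. fat n D}"] fin no by auto
  define \<eta> where "\<eta> = min 1 \<delta>"
  have \<eta>: "0 < \<eta>" "\<eta> \<le> 1" "\<eta> \<le> \<delta>" using \<delta>(1) by (auto simp: \<eta>_def)
  \<comment> \<open>\<open>x\<close> is pulled towards the centre of the cube, so that the box of
    radius \<open>\<eta> / 2\<close> around \<open>c\<close> lies in the cube and within
    \<open>\<delta>\<close> of \<open>x\<close>, even if \<open>x\<close> is on the
    boundary.\<close>
  define c where "c i = (1 - \<eta>) * x i + \<eta> / 2" for i
  have c: "\<bar>c i - x i\<bar> \<le> \<eta> / 2 \<and> \<eta> / 2 \<le> c i \<and> c i \<le> 1 - \<eta> / 2" if "i \<in> {1..n}" for i
  proof -
    have xi: "0 \<le> x i" "x i \<le> 1" using x that by (auto simp: unit_pts_def)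
    have "0 \<le> \<eta> * x i" "\<eta> * x i \<le> \<eta>" using xi \<eta> by (auto simp: mult_left_le)
    moreover have "0 \<le> (1 - \<eta>) * x i" "(1 - \<eta>) * x i \<le> 1 - \<eta>" using xi \<eta> by (auto simp: mult_left_le)
    moreover have "c i = x i - \<eta> * x i + \<eta> / 2" by (simp add: c_def left_diff_distrib)
    ultimately show ?thesis unfolding abs_le_iff by (auto simp: c_def)
  qed
  have "\<exists>z \<delta>. \<delta> > 0 \<and> obox n z \<delta> \<subseteq> obox n c (\<eta> / 2) \<and>
      (\<forall>D\<in>{D \<in> \<D>. \<not> fat n D}. obox n z \<delta> \<inter> polyh n D = {})"
    by (rule avoid) (use fin \<eta> in auto)
  then obtain z \<delta>' where z: "\<delta>' > 0" "obox n z \<delta>' \<subseteq> obox n c (\<eta> / 2)"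
    "\<And>D. D \<in> \<D> \<Longrightarrow> \<not> fat n D \<Longrightarrow> obox n z \<delta>' \<inter> polyh n D = {}" by blast
  have zz: "z \<in> obox n z \<delta>'" using z(1) by (simp add: obox_def)
  then have zc: "z \<in> obox n c (\<eta> / 2)" using z(2) by blast
  have "0 \<le> z i \<and> z i \<le> 1 \<and> \<bar>z i - x i\<bar> < \<delta>" if i: "i \<in> {1..n}" for i
  proof -
    have "\<bar>z i - c i\<bar> < \<eta> / 2" using zc i by (simp add: obox_def)
    with c[OF i] \<eta> show ?thesis by linarith
  qed
  then have "z \<in> unit_pts n" "z \<in> obox n x \<delta>"
    by (simp_all add: obox_def unit_pts_def)
  then obtain D where "D \<in> \<D>" "z \<in> polyh n D" using \<D> by (auto simp: pieces_def)
  with z(3) \<delta>(2) zz \<open>z \<in> obox n x \<delta>\<close> show False by blast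
qed

text \<open>\<open>W\<close> is a left inverse of \<open>A\<close> up to the factor
  \<open>M\<close>. If no positive multiple of the \<open>i\<close>-th unit vector were in the
  integer row span, sending that vector to \<open>1\<close> and all rows to \<open>0\<close> would
  be well defined. Extending this by \<open>extend_character\<close> with \<open>T = {0}\<close>
  gives a vector in the kernel of \<open>A\<close> with \<open>i\<close>-th entry
  \<open>1\<close>.\<close>

lemma injective_coordinates:
  fixes A :: "nat \<Rightarrow> nat \<Rightarrow> int"
  assumes inj: "\<And>v :: nat \<Rightarrow> rat. (\<And>l. l < k \<Longrightarrow> (\<Sum>j\<in>{1..n}. of_int (A l j) * v j) = 0) \<Longrightarrow>
      \<forall>j\<in>{1..n}. v j = 0"
  shows "\<exists>M W. M > 0 \<and>
    (\<forall>i\<in>{1..n}. \<forall>j\<in>{1..n}. (\<Sum>l<k. W i l * A l j) = (if i = j then M else 0))"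
proof -
  have ex: "\<exists>m u. m > 0 \<and> (\<forall>j\<in>{1..n}. (\<Sum>l<k. u l * A l j) = (if i = j then m else 0))"
    if i: "i \<in> {1..n}" for i
  proof (rule ccontr)
    assume no: "\<not> ?thesis"
    define h :: "int \<Rightarrow> (nat \<Rightarrow> int) \<Rightarrow> nat \<Rightarrow> int"
      where "h c u j = c * (if i = j then 1 else 0) + (\<Sum>l<k. u l * A l j)" for c u j
    define H where "H = {(h c u, rat_of_int c) | c u. True}"
    have hd: "(\<lambda>j. h c u j - h c' u' j) = h (c - c') (\<lambda>l. u l - u' l)" for c u c' u'
      by (auto simp: h_def left_diff_distrib sum_subtractf)
    have "\<exists>v. \<forall>(h, s)\<in>H. s - (\<Sum>j\<in>{1..n}. of_int (h j) * v j) \<in> {0}"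
    proof (rule extend_character)
      have "(\<lambda>_. 0, 0) = (h 0 (\<lambda>_. 0), rat_of_int 0)" by (auto simp: h_def)
      then show "(\<lambda>_. 0, 0) \<in> H" unfolding H_def by blast
    next
      fix g s g' s' assume "(g, s) \<in> H" "(g', s') \<in> H"
      then obtain c u c' u' where "g = h c u" "s = of_int c" "g' = h c' u'" "s' = of_int c'"
        unfolding H_def by blast
      then have "(\<lambda>j. g j - g' j, s - s') = (h (c - c') (\<lambda>l. u l - u' l), of_int (c - c'))"
        by (simp add: hd)
      then show "(\<lambda>j. g j - g' j, s - s') \<in> H" unfolding H_def by blast
    next
      fix g s assume "(g, s) \<in> H" and z: "\<forall>j\<in>{1..n}. g j = 0"
      then obtain c u where g: "g = h c u" "s = of_int c" unfolding H_def by blast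
      have eq: "(\<Sum>l<k. u l * A l j) = - c * (if i = j then 1 else 0)" if "j \<in> {1..n}" for j
        using z that by (force simp: g h_def)
      have "\<not> - c > 0"
      proof
        assume "- c > 0"
        with eq have "\<forall>j\<in>{1..n}. (\<Sum>l<k. u l * A l j) = (if i = j then - c else 0)" by auto
        with no \<open>- c > 0\<close> show False by blast
      qed
      moreover have "\<not> c > 0"
      proof
        assume "c > 0"
        define u' where "u' l = - u l" for l
        have "\<forall>j\<in>{1..n}. (\<Sum>l<k. u' l * A l j) = (if i = j then c else 0)"
          using eq by (simp add: u'_def sum_negf)
        with no \<open>c > 0\<close> show False by blast
      qed
      ultimately show "s \<in> {0}" by (simp add: g)
    qed auto
    then obtain v where v: "\<forall>(h, s)\<in>H. s - (\<Sum>j\<in>{1..n}. of_int (h j) * v j) \<in> {0}" ..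
    have v: "of_int c - (\<Sum>j\<in>{1..n}. of_int (h c u j) * v j) = 0" for c u
      using bspec[OF v, of "(h c u, of_int c)"] by (auto simp: H_def)
    have "(\<Sum>j\<in>{1..n}. of_int (A l j) * v j) = 0" if "l < k" for l
      using v[of 0 "\<lambda>j. if j = l then 1 else 0"] that by (simp add: h_def sum_if_mult)
    with inj have "v i = 0" using i by blast
    moreover have "(\<Sum>j\<in>{1..n}. of_int (if i = j then 1 else 0) * v j) = (\<Sum>j\<in>{1..n}. if i = j then v j else 0)"
      by (rule sum.cong) auto
    then have "v i = 1" using v[of 1 "\<lambda>_. 0"] i by (simp add: h_def)
    ultimately show False by simp
  qed
  then obtain m u where mu: "\<And>i. i \<in> {1..n} \<Longrightarrow> m i > 0"
    "\<And>i j. i \<in> {1..n} \<Longrightarrow> j \<in> {1..n} \<Longrightarrow> (\<Sum>l<k. u i l * A l j) = (if i = j then m i else 0)"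
    by metis
  \<comment> \<open>One multiplier for all coordinates: row \<open>i\<close> is scaled by the
    multipliers of the other rows.\<close>
  define M where "M = (\<Prod>i\<in>{1..n}. m i)"
  define W where "W i l = (\<Prod>i'\<in>{1..n} - {i}. m i') * u i l" for i l
  show ?thesis
  proof (intro exI conjI ballI)
    show "M > 0" unfolding M_def by (rule prod_pos) (use mu in auto)
    fix i j assume ij: "i \<in> {1..n}" "j \<in> {1..n}"
    have "(\<Sum>l<k. W i l * A l j) = (\<Prod>i'\<in>{1..n} - {i}. m i') * (\<Sum>l<k. u i l * A l j)"
      by (simp add: W_def sum_distrib_left mult.assoc)
    also have "\<dots> = (if i = j then M else 0)"
      using mu(2)[OF ij] ij prod.remove[of "{1..n}" i m] by (simp add: M_def mult.commute)
    finally show "(\<Sum>l<k. W i l * A l j) = (if i = j then M else 0)" .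
  qed
qed

text \<open>A lattice equals its double dual. If \<open>c\<close> is outside the row lattice, a
  character modulo the integers that kills the rows but not \<open>c\<close> extends to a vector
  \<open>v\<close> contradicting \<open>dual\<close>.\<close>

lemma integer_span_dual:
  fixes A :: "nat \<Rightarrow> nat \<Rightarrow> int" and c :: "nat \<Rightarrow> int"
  assumes dual: "\<And>v :: nat \<Rightarrow> rat. (\<And>l. l < k \<Longrightarrow> (\<Sum>j\<in>{1..n}. of_int (A l j) * v j) \<in> \<int>) \<Longrightarrow>
      (\<Sum>j\<in>{1..n}. of_int (c j) * v j) \<in> \<int>"
  shows "\<exists>u. \<forall>j\<in>{1..n}. c j = (\<Sum>l<k. u l * A l j)"
proof (rule ccontr)
  assume no: "\<not> ?thesis"
  define S where "S = {m. \<exists>u. \<forall>j\<in>{1..n}. m * c j = (\<Sum>l<k. u l * A l j)}"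
  have S0: "0 \<in> S" unfolding S_def by (auto intro!: exI[of _ "\<lambda>_. 0"])
  have Sd: "a - b \<in> S" if "a \<in> S" "b \<in> S" for a b
  proof -
    from that obtain u u' where "\<forall>j\<in>{1..n}. a * c j = (\<Sum>l<k. u l * A l j)"
      "\<forall>j\<in>{1..n}. b * c j = (\<Sum>l<k. u' l * A l j)" by (auto simp: S_def)
    then have "\<forall>j\<in>{1..n}. (a - b) * c j = (\<Sum>l<k. (u l - u' l) * A l j)"
      by (simp add: left_diff_distrib sum_subtractf)
    then show ?thesis unfolding S_def by (intro CollectI exI[of _ "\<lambda>l. u l - u' l"])
  qed
  obtain m :: nat where m: "int m \<in> S" "\<And>a. a \<in> S \<Longrightarrow> int m dvd a"
    using int_subgroup_multiples[of S] S0 Sd by metis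
  have "m \<noteq> 1" using no m(1) by (auto simp: S_def)
  \<comment> \<open>\<open>m\<close> is the order of \<open>c\<close> modulo the row lattice, with
    \<open>0\<close> for infinite order. \<open>c\<close> is sent to \<open>1 / m\<close>, or to
    \<open>1 / 2\<close> if the order is infinite: a non-integer that every element of
    \<open>S\<close> makes integral.\<close>
  define r :: rat where "r = (if m = 0 then 1 / 2 else 1 / of_nat m)"
  have r: "r \<notin> \<int>"
  proof
    assume "r \<in> \<int>"
    then obtain z where "r = of_int z" by (auto elim: Ints_cases)
    moreover have "0 < r" "r < 1" using \<open>m \<noteq> 1\<close> by (auto simp: r_def field_simps)
    ultimately have "0 < z" "z < 1" by simp_all
    then show False by simp
  qed
  have Sr: "of_int a * r \<in> \<int>" if "a \<in> S" for a
  proof -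
    obtain b where "a = int m * b" using m(2)[OF \<open>a \<in> S\<close>] by (auto simp: dvd_def)
    then show ?thesis by (simp add: r_def)
  qed
  define h :: "int \<Rightarrow> (nat \<Rightarrow> int) \<Rightarrow> nat \<Rightarrow> int"
    where "h a u j = a * c j + (\<Sum>l<k. u l * A l j)" for a u j
  define H where "H = {(h a u, of_int a * r) | a u. True}"
  have hd: "(\<lambda>j. h a u j - h a' u' j) = h (a - a') (\<lambda>l. u l - u' l)" for a u a' u'
    by (auto simp: h_def left_diff_distrib sum_subtractf)
  have "\<exists>v. \<forall>(h, s)\<in>H. s - (\<Sum>j\<in>{1..n}. of_int (h j) * v j) \<in> \<int>"
  proof (rule extend_character)
    have "(\<lambda>_. 0, 0) = (h 0 (\<lambda>_. 0), of_int 0 * r)" by (auto simp: h_def)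
    then show "(\<lambda>_. 0, 0) \<in> H" unfolding H_def by blast
  next
    fix g s g' s' assume "(g, s) \<in> H" "(g', s') \<in> H"
    then obtain a u a' u' where "g = h a u" "s = of_int a * r" "g' = h a' u'" "s' = of_int a' * r"
      unfolding H_def by blast
    then have "(\<lambda>j. g j - g' j, s - s') = (h (a - a') (\<lambda>l. u l - u' l), of_int (a - a') * r)"
      by (simp add: hd left_diff_distrib)
    then show "(\<lambda>j. g j - g' j, s - s') \<in> H" unfolding H_def by blast
  next
    fix g s assume "(g, s) \<in> H" and z: "\<forall>j\<in>{1..n}. g j = 0"
    then obtain a u where g: "g = h a u" "s = of_int a * r" unfolding H_def by blast
    have "\<forall>j\<in>{1..n}. a * c j = (\<Sum>l<k. - u l * A l j)"
      using z by (auto simp: g h_def sum_negf add_eq_0_iff2)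
    then have "a \<in> S" unfolding S_def by (intro CollectI exI[of _ "\<lambda>l. - u l"])
    with Sr show "s \<in> \<int>" by (simp add: g)
  qed auto
  then obtain v where v: "\<forall>(h, s)\<in>H. s - (\<Sum>j\<in>{1..n}. of_int (h j) * v j) \<in> \<int>" ..
  have v: "of_int a * r - (\<Sum>j\<in>{1..n}. of_int (h a u j) * v j) \<in> \<int>" for a u
    using bspec[OF v, of "(h a u, of_int a * r)"] by (auto simp: H_def)
  have "(\<Sum>j\<in>{1..n}. of_int (A l j) * v j) \<in> \<int>" if "l < k" for l
    using v[of 0 "\<lambda>j. if j = l then 1 else 0"] that by (simp add: h_def sum_if_mult)
  then have "(\<Sum>j\<in>{1..n}. of_int (c j) * v j) \<in> \<int>" by (rule dual)
  moreover have "r - (\<Sum>j\<in>{1..n}. of_int (c j) * v j) \<in> \<int>"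
    using v[of 1 "\<lambda>_. 0"] by (simp add: h_def)
  ultimately have "r \<in> \<int>" by (metis Ints_add diff_add_cancel)
  with r show False ..
qed

section \<open>The integrality criterion\<close>

lemma of_rat_Ints_iff: "(of_rat r :: real) \<in> \<int> \<longleftrightarrow> r \<in> \<int>"
proof
  assume "(of_rat r :: real) \<in> \<int>"
  then obtain z where "(of_rat r :: real) = of_int z" by (auto elim: Ints_cases)
  then have "(of_rat r :: real) = of_rat (of_int z)" by simp
  then have "r = of_int z" by (simp only: of_rat_eq_iff)
  then show "r \<in> \<int>" by simp
qed (auto elim!: Ints_cases)

text \<open>Each dual vector \<open>v\<close> is realized by a point: for large \<open>q\<close> the
  shifted lattice \<open>(\<int>\<^sup>n + v) / q\<close> meets the interior of the piece, and there
  the criterion for \<open>q\<close> turns into the integrality of pairings with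
  \<open>v\<close>.\<close>

lemma fat_piece_integer_span:
  fixes p :: "nat \<Rightarrow> int \<times> (nat \<Rightarrow> int)" and \<gamma> :: "nat \<Rightarrow> mv_term"
  assumes fat: "fat n D"
    and p: "\<And>l x. l < k \<Longrightarrow> x \<in> polyh n D \<Longrightarrow> mval x (\<gamma> l) = aval n (p l) x"
    and c: "\<And>x. x \<in> polyh n D \<Longrightarrow> mval x \<sigma> = aval n c x"
    and int: "\<And>x q. \<lbrakk>x \<in> unit_pts n; \<And>j. j \<in> {1..n} \<Longrightarrow> x j \<in> \<rat>; 0 < q;
        \<And>l. l < k \<Longrightarrow> real q * mval x (\<gamma> l) \<in> \<int>\<rbrakk> \<Longrightarrow> real q * mval x \<sigma> \<in> \<int>"
  shows "\<exists>u. \<forall>j\<in>{1..n}. snd c j = (\<Sum>l<k. u l * snd (p l) j)"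
proof (rule integer_span_dual[where k = k and n = n and A = "\<lambda>l j. snd (p l) j" and c = "snd c"])
  fix v :: "nat \<Rightarrow> rat"
  assume v: "\<And>l. l < k \<Longrightarrow> (\<Sum>j\<in>{1..n}. of_int (snd (p l) j) * v j) \<in> \<int>"
  obtain x0 \<epsilon> where x0: "\<epsilon> > 0" "obox n x0 \<epsilon> \<subseteq> polyh n D"
    using fat by (auto simp: fat_def)
  obtain q' :: nat where q': "inverse (real (Suc q')) < \<epsilon>" using reals_Archimedean[OF x0(1)] by auto
  define q where "q = Suc q'"
  have q: "q > 0" "1 / q < \<epsilon>" using q' by (auto simp: q_def inverse_eq_divide)
  \<comment> \<open>Rounding down places \<open>x\<close> within \<open>1 / q < \<epsilon>\<close>
    of \<open>x0\<close>.\<close>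
  define z where "z j = \<lfloor>q * x0 j - of_rat (v j)\<rfloor>" for j
  define x :: "nat \<Rightarrow> real" where "x j = (of_int (z j) + of_rat (v j)) / q" for j
  have "\<bar>x j - x0 j\<bar> < \<epsilon>" for j
  proof -
    have "\<bar>of_int (z j) + of_rat (v j) - q * x0 j\<bar> \<le> 1" unfolding z_def by linarith
    then have "\<bar>of_int (z j) + of_rat (v j) - q * x0 j\<bar> / q \<le> 1 / q"
      by (intro divide_right_mono) auto
    moreover have "x j - x0 j = (of_int (z j) + of_rat (v j) - q * x0 j) / q"
      using q by (simp add: x_def field_simps)
    ultimately show ?thesis using q by (simp add: abs_divide)
  qed
  then have x: "x \<in> polyh n D" using x0(2) by (auto simp: obox_def)
  then have xu: "x \<in> unit_pts n" by (simp add: polyh_def)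
  \<comment> \<open>\<open>q * aval n \<alpha> x\<close> is an integer plus the pairing of the
    linear part of \<open>\<alpha>\<close> with \<open>v\<close>.\<close>
  have key: "real q * aval n \<alpha> x \<in> \<int> \<longleftrightarrow> (\<Sum>j\<in>{1..n}. of_int (snd \<alpha> j) * v j) \<in> \<int>" for \<alpha>
  proof -
    have "q * (\<Sum>j\<in>{1..n}. of_int (snd \<alpha> j) * x j) = (\<Sum>j\<in>{1..n}. of_int (snd \<alpha> j * z j) + of_rat (of_int (snd \<alpha> j) * v j))"
      unfolding sum_distrib_left
      by (rule sum.cong) (use q in \<open>auto simp: x_def field_simps of_rat_mult\<close>)
    also have "\<dots> = of_int (\<Sum>j\<in>{1..n}. snd \<alpha> j * z j) + of_rat (\<Sum>j\<in>{1..n}. of_int (snd \<alpha> j) * v j)"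
      by (simp add: sum.distrib of_rat_sum)
    finally have "q * aval n \<alpha> x = of_int (int q * fst \<alpha> + (\<Sum>j\<in>{1..n}. snd \<alpha> j * z j)) +
        of_rat (\<Sum>j\<in>{1..n}. of_int (snd \<alpha> j) * v j)"
      by (simp add: aval_def distrib_left)
    moreover have "of_int m + r \<in> \<int> \<longleftrightarrow> r \<in> \<int>" for m and r :: real
      by (metis Ints_add Ints_diff Ints_of_int add_diff_cancel_left')
    ultimately show ?thesis by (simp only: of_rat_Ints_iff)
  qed
  have "real q * mval x \<sigma> \<in> \<int>"
  proof (rule int[OF xu _ q(1)])
    show "x j \<in> \<rat>" for j by (simp add: x_def)
    show "real q * mval x (\<gamma> l) \<in> \<int>" if "l < k" for l
      using key[of "p l"] v[OF that] p[OF that x] by simp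
  qed
  then show "(\<Sum>j\<in>{1..n}. of_int (snd c j) * v j) \<in> \<int>"
    using key[of c] c[OF x] by simp
qed

text \<open>Moving from an interior point in a direction \<open>v\<close> killed by all linear parts
  keeps the values of the generators, so injectivity forces \<open>v = 0\<close>.\<close>

lemma fat_piece_coordinates:
  fixes p :: "nat \<Rightarrow> int \<times> (nat \<Rightarrow> int)" and \<gamma> :: "nat \<Rightarrow> mv_term"
  assumes fat: "fat n D"
    and p: "\<And>l x. l < k \<Longrightarrow> x \<in> polyh n D \<Longrightarrow> mval x (\<gamma> l) = aval n (p l) x"
    and inj: "\<And>x y. \<lbrakk>x \<in> unit_pts n; y \<in> unit_pts n; \<And>l. l < k \<Longrightarrow> mval x (\<gamma> l) = mval y (\<gamma> l)\<rbrakk> \<Longrightarrow>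
        \<forall>i\<in>{1..n}. x i = y i"
  shows "\<exists>M W. M > 0 \<and>
    (\<forall>i\<in>{1..n}. \<forall>j\<in>{1..n}. (\<Sum>l<k. W i l * snd (p l) j) = (if i = j then M else 0))"
proof (rule injective_coordinates[where k = k and n = n and A = "\<lambda>l j. snd (p l) j"])
  fix v :: "nat \<Rightarrow> rat"
  assume v: "\<And>l. l < k \<Longrightarrow> (\<Sum>j\<in>{1..n}. of_int (snd (p l) j) * v j) = 0"
  obtain x \<epsilon> where x: "\<epsilon> > 0" "obox n x \<epsilon> \<subseteq> polyh n D"
    using fat by (auto simp: fat_def)
  define S :: real where "S = 1 + (\<Sum>j\<in>{1..n}. \<bar>of_rat (v j)\<bar>)"
  have S: "S > 0" by (auto simp: S_def intro!: add_pos_nonneg sum_nonneg)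
  define \<eta> where "\<eta> = \<epsilon> / S"
  have \<eta>: "\<eta> > 0" using x S by (simp add: \<eta>_def)
  define y :: "nat \<Rightarrow> real" where "y j = x j + \<eta> * of_rat (v j)" for j
  have "\<bar>y j - x j\<bar> < \<epsilon>" if "j \<in> {1..n}" for j
  proof -
    have "\<bar>of_rat (v j) :: real\<bar> \<le> (\<Sum>j\<in>{1..n}. \<bar>of_rat (v j)\<bar>)"
      by (rule member_le_sum) (use that in auto)
    then have "\<bar>of_rat (v j) :: real\<bar> < S" by (simp add: S_def)
    then have "\<eta> * \<bar>of_rat (v j) :: real\<bar> < \<eta> * S" using \<eta> by simp
    also have "\<eta> * S = \<epsilon>" using S by (simp add: \<eta>_def)
    finally show ?thesis using \<eta> by (simp add: y_def abs_mult)
  qed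
  then have xy: "x \<in> polyh n D" "y \<in> polyh n D" using x by (auto simp: obox_def)
  have "aval n \<alpha> y = aval n \<alpha> x + \<eta> * of_rat (\<Sum>j\<in>{1..n}. of_int (snd \<alpha> j) * v j)" for \<alpha>
    by (simp add: aval_def y_def distrib_left sum.distrib of_rat_sum of_rat_mult sum_distrib_left mult.left_commute)
  then have "mval x (\<gamma> l) = mval y (\<gamma> l)" if "l < k" for l
    using p[OF that] xy v[OF that] by simp
  then have "\<forall>j\<in>{1..n}. x j = y j"
    using inj[of x y] xy by (simp add: polyh_def)
  with \<eta> show "\<forall>j\<in>{1..n}. v j = 0" by (auto simp: y_def)
qed

text \<open>\<open>clip r\<close> vanishes exactly for \<open>r \<le> 0\<close>, and
  \<open>Plus\<close> intersects zero sets because values are nonnegative.\<close>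

lemma zero_set_term:
  assumes G: "mv_closed G" "\<And>t. t \<in> G \<Longrightarrow> mv_vars t \<subseteq> {1..n}" and \<gamma>: "\<And>l. l < k \<Longrightarrow> \<gamma> l \<in> G"
    and \<Phi>: "finite \<Phi>" "\<And>\<phi>. \<phi> \<in> \<Phi> \<Longrightarrow> int_comb k \<gamma> \<phi>"
  shows "\<exists>t\<in>G. \<forall>x\<in>unit_pts n. mval x t = 0 \<longleftrightarrow> (\<forall>\<phi>\<in>\<Phi>. \<phi> x \<le> 0)"
  using \<Phi>
proof (induction \<Phi>)
  case empty
  with G show ?case by (intro bexI[of _ Zero]) (auto simp: mv_closed_def)
next
  case (insert \<phi> \<Phi>)
  then obtain t where t: "t \<in> G" "\<And>x. x \<in> unit_pts n \<Longrightarrow> mval x t = 0 \<longleftrightarrow> (\<forall>\<phi>\<in>\<Phi>. \<phi> x \<le> 0)"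
    by auto
  obtain s where s: "s \<in> G" "\<And>x. x \<in> unit_pts n \<Longrightarrow> mval x s = clip (\<phi> x)"
    using int_comb_clip[OF G(1), of k \<gamma> n \<phi>] \<gamma> G insert.prems by auto
  have "mval x (Plus s t) = 0 \<longleftrightarrow> (\<forall>\<phi>\<in>insert \<phi> \<Phi>. \<phi> x \<le> 0)" if x: "x \<in> unit_pts n" for x
  proof -
    have "mval x (Plus s t) = 0 \<longleftrightarrow> mval x s = 0 \<and> mval x t = 0"
      using mval_bounds[OF G(2)[OF s(1)] x] mval_bounds[OF G(2)[OF t(1)] x]
      by (auto simp: min_def)
    moreover have "clip (\<phi> x) = 0 \<longleftrightarrow> \<phi> x \<le> 0" by (auto simp: clip_def max_def min_def)
    ultimately show ?thesis using s(2)[OF x] t(2)[OF x] by simp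
  qed
  with s(1) t(1) G(1) show ?case by (intro bexI[of _ "Plus s t"]) (auto simp: mv_closed_def)
qed

lemma multiple_term:
  assumes G: "mv_closed G" "\<And>t. t \<in> G \<Longrightarrow> mv_vars t \<subseteq> {1..n}" and "w \<in> G"
  shows "\<exists>t\<in>G. \<forall>x\<in>unit_pts n. mval x t = min 1 (real m * mval x w)"
proof (induction m)
  case 0
  with G show ?case by (intro bexI[of _ Zero]) (auto simp: mv_closed_def)
next
  case (Suc m)
  then obtain t where t: "t \<in> G" "\<And>x. x \<in> unit_pts n \<Longrightarrow> mval x t = min 1 (real m * mval x w)"
    by auto
  have "mval x (Plus t w) = min 1 (real (Suc m) * mval x w)" if x: "x \<in> unit_pts n" for x
    using mval_bounds[OF G(2)[OF \<open>w \<in> G\<close>] x] t(2)[OF x] by (auto simp: min_def distrib_right)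
  with t(1) G(1) \<open>w \<in> G\<close> show ?case by (intro bexI[of _ "Plus t w"]) (auto simp: mv_closed_def)
qed

text \<open>
  On a fat piece \<open>D\<close> the coordinates are rational combinations of the generators, because the
  generators are injective there. This expresses membership in \<open>D\<close>, as well as the affine form of
  the generators on \<open>D\<close>, by inequalities between the values of the generators, so that by
  injectivity some \<open>w\<close> in the generated algebra vanishes exactly on \<open>D\<close>. Adding a large multiple
  of \<open>w\<close> to the integer combination \<open>r\<close> that represents \<open>\<sigma>\<close> on \<open>D\<close> gives an upper bound of \<open>\<sigma>\<close>.
\<close>

lemma fat_piece_majorant:
  fixes p :: "nat \<Rightarrow> int \<times> (nat \<Rightarrow> int)" and \<gamma> :: "nat \<Rightarrow> mv_term"
  assumes G: "mv_closed G" "\<And>t. t \<in> G \<Longrightarrow> mv_vars t \<subseteq> {1..n}" and \<gamma>: "\<And>l. l < k \<Longrightarrow> \<gamma> l \<in> G"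
    and \<sigma>: "mv_vars \<sigma> \<subseteq> {1..n}"
    and fat: "fat n D" and fin: "finite D"
    and p: "\<And>l x. l < k \<Longrightarrow> x \<in> polyh n D \<Longrightarrow> mval x (\<gamma> l) = aval n (p l) x"
    and c: "\<And>x. x \<in> polyh n D \<Longrightarrow> mval x \<sigma> = aval n c x"
    and inj: "\<And>x y. \<lbrakk>x \<in> unit_pts n; y \<in> unit_pts n; \<And>l. l < k \<Longrightarrow> mval x (\<gamma> l) = mval y (\<gamma> l)\<rbrakk> \<Longrightarrow>
        \<forall>i\<in>{1..n}. x i = y i"
    and int: "\<And>x q. \<lbrakk>x \<in> unit_pts n; \<And>j. j \<in> {1..n} \<Longrightarrow> x j \<in> \<rat>; 0 < q;
        \<And>l. l < k \<Longrightarrow> real q * mval x (\<gamma> l) \<in> \<int>\<rbrakk> \<Longrightarrow> real q * mval x \<sigma> \<in> \<int>"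
  shows "\<exists>h\<in>G. (\<forall>x\<in>unit_pts n. mval x \<sigma> \<le> mval x h) \<and> (\<forall>x\<in>polyh n D. mval x h = mval x \<sigma>)"
proof -
  have "\<exists>u. \<forall>j\<in>{1..n}. snd c j = (\<Sum>l<k. u l * snd (p l) j)"
    using fat p c int by (rule fat_piece_integer_span)
  then obtain u where u: "\<And>j. j \<in> {1..n} \<Longrightarrow> snd c j = (\<Sum>l<k. u l * snd (p l) j)" by blast
  have "\<exists>M W. M > 0 \<and>
      (\<forall>i\<in>{1..n}. \<forall>j\<in>{1..n}. (\<Sum>l<k. W i l * snd (p l) j) = (if i = j then M else 0))"
    using fat p inj by (rule fat_piece_coordinates)
  then obtain M W where M: "M > 0" and W: "\<And>i j. i \<in> {1..n} \<Longrightarrow> j \<in> {1..n} \<Longrightarrow>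
      (\<Sum>l<k. W i l * snd (p l) j) = (if i = j then M else 0)" by blast
  have polyh_unit: "x \<in> unit_pts n" if "x \<in> polyh n D" for x using that by (simp add: polyh_def)
  have comb: "(\<Sum>l<k. of_int (U l) * (aval n (p l) x - of_int (fst (p l)))) =
      (\<Sum>j\<in>{1..n}. of_int (\<Sum>l<k. U l * snd (p l) j) * x j)" for U :: "nat \<Rightarrow> int" and x
  proof -
    have "(\<Sum>l<k. of_int (U l) * (aval n (p l) x - of_int (fst (p l)))) =
        (\<Sum>l<k. \<Sum>j\<in>{1..n}. of_int (U l * snd (p l) j) * x j)"
      by (simp add: aval_def sum_distrib_left mult.assoc)
    also have "\<dots> = (\<Sum>j\<in>{1..n}. \<Sum>l<k. of_int (U l * snd (p l) j) * x j)"
      by (rule sum.swap)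
    finally show ?thesis by (simp add: sum_distrib_right)
  qed
  \<comment> \<open>An integer combination of the generators, defined on all points, that recovers
    \<open>M * x i\<close> on \<open>D\<close>.\<close>
  define \<phi> where "\<phi> i x = (\<Sum>l<k. of_int (W i l) * (mval x (\<gamma> l) - of_int (fst (p l))))" for i x
  have \<phi>_D: "\<phi> i x = of_int M * x i" if x: "x \<in> polyh n D" and i: "i \<in> {1..n}" for i x
  proof -
    have "\<phi> i x = (\<Sum>l<k. of_int (W i l) * (aval n (p l) x - of_int (fst (p l))))"
      unfolding \<phi>_def by (rule sum.cong) (use p x in auto)
    also have "\<dots> = (\<Sum>j\<in>{1..n}. if i = j then of_int M * x j else 0)"
      unfolding comb by (rule sum.cong) (use W i in auto)
    also have "\<dots> = of_int M * x i" using i by simp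
    finally show ?thesis .
  qed
  have \<phi>_comb: "int_comb k \<gamma> (\<phi> i)" for i
    unfolding \<phi>_def
    by (intro int_comb_sum int_comb_scale int_comb_diff int_comb_term int_comb_const) simp
  \<comment> \<open>\<open>M\<close> times the affine form \<open>\<alpha>\<close> at the candidate
    point \<open>\<phi> i x / M\<close>; the factor \<open>M\<close> keeps it an integer combination
    of the generators.\<close>
  define \<psi> where "\<psi> \<alpha> x = of_int M * of_int (fst \<alpha>) + (\<Sum>i\<in>{1..n}. of_int (snd \<alpha> i) * \<phi> i x)"
    for \<alpha> :: "int \<times> (nat \<Rightarrow> int)" and x
  have \<psi>_comb: "int_comb k \<gamma> (\<psi> \<alpha>)" for \<alpha>
    unfolding \<psi>_def of_int_mult[symmetric]
    by (intro int_comb_add int_comb_sum int_comb_scale \<phi>_comb int_comb_const)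
  have \<psi>_aval: "\<psi> \<alpha> x = of_int M * aval n \<alpha> (\<lambda>i. \<phi> i x / of_int M)" for \<alpha> x
    using M by (simp add: \<psi>_def aval_def distrib_left sum_distrib_left)
  have \<psi>_D: "\<psi> \<alpha> x = of_int M * aval n \<alpha> x" if "x \<in> polyh n D" for \<alpha> x
  proof -
    have "aval n \<alpha> (\<lambda>i. \<phi> i x / of_int M) = aval n \<alpha> x"
      by (rule aval_cong) (use \<phi>_D[OF that] M in simp)
    then show ?thesis by (simp add: \<psi>_aval)
  qed
  \<comment> \<open>For the candidate point \<open>y\<close> with
    \<open>y i = \<phi> i x / M\<close>, the first three families say that \<open>y\<close> lies in
    \<open>D\<close>. The last two say that the generators take the same values at \<open>x\<close>
    and at \<open>y\<close>, so that \<open>x\<close> and \<open>y\<close> agree by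
    injectivity.\<close>
  define \<Phi> where "\<Phi> = \<psi> ` D \<union> (\<lambda>i x. - \<phi> i x) ` {1..n} \<union> (\<lambda>i x. \<phi> i x - of_int M) ` {1..n} \<union>
      (\<lambda>l x. of_int M * mval x (\<gamma> l) - \<psi> (p l) x) ` {..<k} \<union>
      (\<lambda>l x. \<psi> (p l) x - of_int M * mval x (\<gamma> l)) ` {..<k}"
  have \<Phi>_comb: "int_comb k \<gamma> f" if "f \<in> \<Phi>" for f
    using that int_comb_diff[OF int_comb_const[of k \<gamma> 0] \<phi>_comb] unfolding \<Phi>_def
    by (auto intro!: int_comb_diff int_comb_scale \<phi>_comb \<psi>_comb int_comb_term int_comb_const)
  have \<Phi>_D: "(\<forall>f\<in>\<Phi>. f x \<le> 0) \<longleftrightarrow> x \<in> polyh n D" if x: "x \<in> unit_pts n" for x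
  proof
    assume D: "x \<in> polyh n D"
    then show "\<forall>f\<in>\<Phi>. f x \<le> 0"
      using x M p by (auto simp: \<Phi>_def \<psi>_D \<phi>_D polyh_def unit_pts_def mult_le_0_iff)
  next
    assume f: "\<forall>f\<in>\<Phi>. f x \<le> 0"
    define y where "y i = \<phi> i x / of_int M" for i
    have "y \<in> unit_pts n"
      using f M by (auto simp: \<Phi>_def unit_pts_def y_def ball_Un)
    moreover have "aval n \<alpha> y \<le> 0" if "\<alpha> \<in> D" for \<alpha>
      using f that M by (auto simp: \<Phi>_def ball_Un \<psi>_aval y_def[symmetric] mult_le_0_iff)
    ultimately have yD: "y \<in> polyh n D" by (simp add: polyh_def)
    have "mval x (\<gamma> l) = mval y (\<gamma> l)" if "l < k" for l
    proof -
      have "of_int M * mval x (\<gamma> l) \<le> \<psi> (p l) x" "\<psi> (p l) x \<le> of_int M * mval x (\<gamma> l)"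
        using f that by (auto simp: \<Phi>_def ball_Un)
      then have "of_int M * mval x (\<gamma> l) = of_int M * aval n (p l) y"
        by (auto simp: \<psi>_aval y_def[abs_def])
      then show ?thesis using M p[OF that yD] by simp
    qed
    then have xy: "\<forall>i\<in>{1..n}. x i = y i" using inj[OF x polyh_unit[OF yD]] by blast
    then have "aval n \<alpha> x = aval n \<alpha> y" for \<alpha> by (intro aval_cong) simp
    with x yD show "x \<in> polyh n D" by (simp add: polyh_def)
  qed
  have "finite \<Phi>" using fin by (simp add: \<Phi>_def)
  then obtain w where w: "w \<in> G" "\<And>x. x \<in> unit_pts n \<Longrightarrow> mval x w = 0 \<longleftrightarrow> x \<in> polyh n D"
    using zero_set_term[OF G \<gamma> \<open>finite \<Phi>\<close> \<Phi>_comb] \<Phi>_D by auto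
  \<comment> \<open>The combination \<open>u\<close> matches only the linear part of
    \<open>\<sigma>\<close> on \<open>D\<close>, so the constants of the generators are exchanged
    for that of \<open>c\<close>.\<close>
  define \<rho> where "\<rho> x = (\<Sum>l<k. of_int (u l) * (mval x (\<gamma> l) - of_int (fst (p l)))) + of_int (fst c)" for x
  have "int_comb k \<gamma> \<rho>"
    unfolding \<rho>_def
    by (intro int_comb_add int_comb_sum int_comb_scale int_comb_diff int_comb_term int_comb_const) simp
  from int_comb_clip[OF G(1) _ this] \<gamma> G(2)
  obtain r where r: "r \<in> G" "\<And>x. x \<in> unit_pts n \<Longrightarrow> mval x r = clip (\<rho> x)" by blast
  have rD: "mval x r = mval x \<sigma>" if x: "x \<in> polyh n D" for x
  proof -
    have "(\<Sum>l<k. of_int (u l) * (mval x (\<gamma> l) - of_int (fst (p l)))) =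
        (\<Sum>l<k. of_int (u l) * (aval n (p l) x - of_int (fst (p l))))"
      by (rule sum.cong) (use p x in auto)
    also have "\<dots> = (\<Sum>j\<in>{1..n}. of_int (snd c j) * x j)"
      unfolding comb by (rule sum.cong) (use u in auto)
    finally have "\<rho> x = mval x \<sigma>" using c[OF x] by (simp add: \<rho>_def aval_def)
    then show ?thesis
      using r(2)[OF polyh_unit[OF x]] mval_bounds[OF \<sigma> polyh_unit[OF x]] by (simp add: clip_def)
  qed
  \<comment> \<open>The truncated difference of \<open>\<sigma>\<close> and \<open>r\<close>: it
    vanishes on \<open>D\<close>, the zero set of \<open>w\<close>, and is thus dominated by a
    multiple of \<open>w\<close>.\<close>
  let ?d = "Neg (Plus (Neg \<sigma>) r)"
  have d: "mval x ?d = max 0 (mval x \<sigma> - mval x r)" for x by (simp add: min_def max_def)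
  have "\<exists>m::nat. \<forall>x\<in>unit_pts n. mval x ?d \<le> m * mval x w"
  proof (rule mval_le_mult_if_zero_set_subset)
    show "mv_vars ?d \<subseteq> {1..n}" "mv_vars w \<subseteq> {1..n}"
      using \<sigma> G(2)[OF r(1)] G(2)[OF w(1)] by auto
    show "mval x ?d = 0" if "x \<in> unit_pts n" "mval x w = 0" for x
      using that w(2) rD unfolding d by simp
  qed
  then obtain m :: nat where m: "\<And>x. x \<in> unit_pts n \<Longrightarrow> mval x ?d \<le> m * mval x w" by blast
  obtain t where t: "t \<in> G" "\<And>x. x \<in> unit_pts n \<Longrightarrow> mval x t = min 1 (real m * mval x w)"
    using multiple_term[OF G w(1), of m] by blast
  show ?thesis
  proof (intro bexI[of _ "Plus r t"] conjI ballI)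
    show "Plus r t \<in> G" using G(1) r(1) t(1) by (simp add: mv_closed_def)
    fix x assume x: "x \<in> unit_pts n"
    show "mval x \<sigma> \<le> mval x (Plus r t)"
      using m[OF x, unfolded d] t(2)[OF x] mval_bounds[OF \<sigma> x] mval_bounds[OF G(2)[OF r(1)] x]
      by (simp add: min_def)
  next
    fix x assume D: "x \<in> polyh n D"
    then have x: "x \<in> unit_pts n" by (rule polyh_unit)
    show "mval x (Plus r t) = mval x \<sigma>"
      using t(2)[OF x] w(2)[OF x] D rD[OF D] mval_bounds[OF \<sigma> x] by simp
  qed
qed

theorem generated_if_integrality:
  fixes \<gamma> :: "nat \<Rightarrow> mv_term"
  assumes G: "mv_closed G" "\<And>t. t \<in> G \<Longrightarrow> mv_vars t \<subseteq> {1..n}" and \<gamma>: "\<And>l. l < k \<Longrightarrow> \<gamma> l \<in> G"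
    and \<sigma>: "mv_vars \<sigma> \<subseteq> {1..n}"
    and inj: "\<And>x y. \<lbrakk>x \<in> unit_pts n; y \<in> unit_pts n; \<And>l. l < k \<Longrightarrow> mval x (\<gamma> l) = mval y (\<gamma> l)\<rbrakk> \<Longrightarrow>
        \<forall>i\<in>{1..n}. x i = y i"
    and int: "\<And>x q. \<lbrakk>x \<in> unit_pts n; \<And>j. j \<in> {1..n} \<Longrightarrow> x j \<in> \<rat>; 0 < q;
        \<And>l. l < k \<Longrightarrow> real q * mval x (\<gamma> l) \<in> \<int>\<rbrakk> \<Longrightarrow> real q * mval x \<sigma> \<in> \<int>"
  shows "\<exists>t\<in>G. \<forall>x\<in>unit_pts n. mval x t = mval x \<sigma>"
proof -
  have "\<exists>\<D>. pieces n (insert \<sigma> (\<gamma> ` {..<k})) \<D>"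
    by (rule pieces_finite) (use \<sigma> \<gamma> G(2) in auto)
  then obtain \<D> where \<D>: "pieces n (insert \<sigma> (\<gamma> ` {..<k})) \<D>" ..
  have maj: "\<exists>h\<in>G. (\<forall>x\<in>unit_pts n. mval x \<sigma> \<le> mval x h) \<and> (\<forall>x\<in>polyh n D. mval x h = mval x \<sigma>)"
    if D: "D \<in> \<D>" "fat n D" for D
  proof -
    have "\<exists>p. \<forall>x\<in>polyh n D. mval x (\<gamma> l) = aval n p x" if "l < k" for l
      by (rule pieces_affine[OF \<D> D(1)]) (use that in auto)
    then obtain p where p: "\<And>l x. l < k \<Longrightarrow> x \<in> polyh n D \<Longrightarrow> mval x (\<gamma> l) = aval n (p l) x"
      by metis
    obtain c where c: "\<And>x. x \<in> polyh n D \<Longrightarrow> mval x \<sigma> = aval n c x"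
      using pieces_affine[OF \<D> D(1), of \<sigma>] by blast
    have "finite D" using \<D> D(1) by (simp add: pieces_def)
    from fat_piece_majorant[OF G \<gamma> \<sigma> D(2) this p c inj int] show ?thesis .
  qed
  have "\<exists>h\<in>G. (\<forall>x\<in>unit_pts n. mval x \<sigma> \<le> mval x h) \<and> (\<forall>D\<in>\<C>. \<forall>x\<in>polyh n D. mval x h = mval x \<sigma>)"
    if "finite \<C>" "\<C> \<subseteq> {D \<in> \<D>. fat n D}" for \<C>
    using that
  proof (induction \<C>)
    case empty
    \<comment> \<open>The constant \<open>1\<close> is the minimum over no pieces.\<close>
    have "mval x \<sigma> \<le> mval x (Neg Zero)" if "x \<in> unit_pts n" for x
      using mval_bounds[OF \<sigma> that] by simp
    with G(1) show ?case by (intro bexI[of _ "Neg Zero"]) (auto simp: mv_closed_def)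
  next
    case (insert D \<C>)
    then obtain h where h: "h \<in> G" "\<And>x. x \<in> unit_pts n \<Longrightarrow> mval x \<sigma> \<le> mval x h"
      "\<And>D x. D \<in> \<C> \<Longrightarrow> x \<in> polyh n D \<Longrightarrow> mval x h = mval x \<sigma>" by auto
    obtain h' where h': "h' \<in> G" "\<And>x. x \<in> unit_pts n \<Longrightarrow> mval x \<sigma> \<le> mval x h'"
      "\<And>x. x \<in> polyh n D \<Longrightarrow> mval x h' = mval x \<sigma>" using maj[of D] insert.prems by auto
    \<comment> \<open>The minimum in MV-form,
      \<open>h \<odot> (\<not> h \<oplus> h')\<close>.\<close>
    let ?m = "Neg (Plus (Neg h) (Neg (Plus (Neg h) h')))"
    have m: "mval x ?m = min (mval x h) (mval x h')" if x: "x \<in> unit_pts n" for x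
      using mval_bounds[OF G(2)[OF h(1)] x] mval_bounds[OF G(2)[OF h'(1)] x]
      by (simp add: min_def)
    have polyh_unit: "x \<in> unit_pts n" if "x \<in> polyh n D" for x D using that by (simp add: polyh_def)
    show ?case
    proof (intro bexI[of _ ?m] conjI ballI)
      show "?m \<in> G" using G(1) h(1) h'(1) by (simp add: mv_closed_def)
      show "mval x \<sigma> \<le> mval x ?m" if "x \<in> unit_pts n" for x
        using m[OF that] h(2)[OF that] h'(2)[OF that] by simp
      fix C x assume "C \<in> insert D \<C>" and x: "x \<in> polyh n C"
      then have "mval x h = mval x \<sigma> \<or> mval x h' = mval x \<sigma>" using h(3) h'(3) by blast
      with m[OF polyh_unit[OF x]] h(2)[OF polyh_unit[OF x]] h'(2)[OF polyh_unit[OF x]]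
      show "mval x ?m = mval x \<sigma>" by auto
    qed
  qed
  from this[of "{D \<in> \<D>. fat n D}"] obtain h where h: "h \<in> G"
    "\<And>D x. D \<in> \<D> \<Longrightarrow> fat n D \<Longrightarrow> x \<in> polyh n D \<Longrightarrow> mval x h = mval x \<sigma>"
    using \<D> by (auto simp: pieces_def)
  have "mval x h = mval x \<sigma>" if "x \<in> unit_pts n" for x
    by (rule fat_pieces_cover[OF \<D> that]) (rule h(2))
  with h(1) show ?thesis by blast
qed

section \<open>Recursive functions\<close>

text \<open>
  Arguments are passed as the initial segment of a sequence \<open>e\<close>, for every sufficiently large
  length, so that no arities have to be tracked; under a binder, the bound variables become the
  first entries and the old ones are shifted.
\<close>

definition rec_fun :: "((nat \<Rightarrow> nat) \<Rightarrow> nat) \<Rightarrow> bool" where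
  "rec_fun f \<longleftrightarrow> (\<exists>K. \<forall>k\<ge>K. \<exists>p. \<forall>e. computes p (map e [0..<k]) (f e))"

definition rec_pred :: "((nat \<Rightarrow> nat) \<Rightarrow> bool) \<Rightarrow> bool" where
  "rec_pred P \<longleftrightarrow> rec_fun (\<lambda>e. of_bool (P e))"

lemma rec_fun_proj: "rec_fun (\<lambda>e. e i)"
  unfolding rec_fun_def
proof (intro exI allI impI)
  fix k e assume "Suc i \<le> k"
  then show "computes (RProj i) (map e [0..<k]) (e i)"
    using computes.proj[of i "map e [0..<k]"] by simp
qed

lemma rec_fun_subst:
  assumes "rec_fun f" "\<And>i. rec_fun (g i)"
  shows "rec_fun (\<lambda>e. f (\<lambda>i. g i e))"
proof -
  from assms(1) obtain m p where p: "\<And>e. computes p (map e [0..<m]) (f e)"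
    unfolding rec_fun_def by blast
  from assms(2) obtain K where K: "\<And>i k. k \<ge> K i \<Longrightarrow> \<exists>p. \<forall>e. computes p (map e [0..<k]) (g i e)"
    unfolding rec_fun_def by metis
  \<comment> \<open>\<open>f\<close> is read at the single length \<open>m\<close>, so only finitely
    many \<open>g i\<close> enter and the sum bounds all their thresholds.\<close>
  define K' where "K' = (\<Sum>i<m. K i)"
  show ?thesis
    unfolding rec_fun_def
  proof (intro exI[of _ K'] allI impI)
    fix k assume k: "K' \<le> k"
    have "\<exists>p. \<forall>e. computes p (map e [0..<k]) (g i e)" if "i < m" for i
    proof (rule K)
      have "K i \<le> K'" unfolding K'_def by (rule member_le_sum) (use that in auto)
      with k show "K i \<le> k" by simp
    qed
    then obtain P where P: "\<And>i e. i < m \<Longrightarrow> computes (P i) (map e [0..<k]) (g i e)"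
      by metis
    have "computes (RComp p (map P [0..<m])) (map e [0..<k]) (f (\<lambda>i. g i e))" for e
    proof (rule computes.comp)
      show "list_all2 (\<lambda>g y. computes g (map e [0..<k]) y) (map P [0..<m]) (map (\<lambda>i. g i e) [0..<m])"
        using P by (auto simp: list_all2_conv_all_nth)
      show "computes p (map (\<lambda>i. g i e) [0..<m]) (f (\<lambda>i. g i e))"
        by (rule p)
    qed
    then show "\<exists>p. \<forall>e. computes p (map e [0..<k]) (f (\<lambda>i. g i e))" by blast
  qed
qed

lemma map_case_nat_upt: "map (case_nat a e) [0..<Suc k] = a # map e [0..<k]"
  by (simp add: upt_conv_Cons map_Suc_upt[symmetric] del: upt_Suc)

text \<open>The conclusion is restricted to inputs on which the search succeeds, so it cannot be
  phrased by \<open>rec_fun\<close>. The main program needs this form, as its search ends only on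
  valid inputs.\<close>

lemma rec_fun_search:
  assumes P: "rec_pred (\<lambda>e. P (e 0) (\<lambda>i. e (i + 1)))" and Q: "rec_fun (\<lambda>e. Q (e 0) (\<lambda>i. e (i + 1)))"
  shows "\<exists>K. \<forall>k\<ge>K. \<exists>p. \<forall>e. (\<exists>m. P m e) \<longrightarrow> computes p (map e [0..<k]) (Q (LEAST m. P m e) e)"
proof -
  obtain K1 where K1: "\<And>k. k \<ge> K1 \<Longrightarrow> \<exists>p. \<forall>e. computes p (map e [0..<k]) (of_bool (P (e 0) (\<lambda>i. e (i + 1))))"
    using P unfolding rec_pred_def rec_fun_def by blast
  obtain K2 where K2: "\<And>k. k \<ge> K2 \<Longrightarrow> \<exists>p. \<forall>e. computes p (map e [0..<k]) (Q (e 0) (\<lambda>i. e (i + 1)))"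
    using Q unfolding rec_fun_def by blast
  \<comment> \<open>\<open>RMin\<close> stops at the value \<open>0\<close>, whereas truth is coded
    by \<open>1\<close>.\<close>
  have neg: "computes (RPrim (RComp RSucc [RZero]) RZero) [of_bool b] (of_bool (\<not> b))" for b
  proof -
    have 0: "computes (RPrim (RComp RSucc [RZero]) RZero) [0] 1"
      by (intro computes.prim_0 computes.comp[of _ _ "[0]"])
         (auto intro: computes.zero computes.succ[of 0, simplified])
    then have "computes (RPrim (RComp RSucc [RZero]) RZero) [Suc 0] 0"
      by (intro computes.prim_Suc[of _ _ 0 "[]" 1] computes.zero)
    with 0 show ?thesis by (cases b) auto
  qed
  show ?thesis
  proof (intro exI[of _ "K1 + K2"] allI impI)
    fix k assume k: "K1 + K2 \<le> k"
    obtain p where p: "\<And>e. computes p (map e [0..<Suc k]) (of_bool (P (e 0) (\<lambda>i. e (i + 1))))"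
      using K1[of "Suc k"] k by auto
    obtain q where q: "\<And>e. computes q (map e [0..<Suc k]) (Q (e 0) (\<lambda>i. e (i + 1)))"
      using K2[of "Suc k"] k by auto
    define p' where "p' = RComp (RPrim (RComp RSucc [RZero]) RZero) [p]"
    have p': "computes p' (m # map e [0..<k]) (of_bool (\<not> P m e))" for m e
      unfolding p'_def
      by (rule computes.comp[of _ _ "[of_bool (P m e)]"])
         (use p[of "case_nat m e"] in \<open>auto simp: map_case_nat_upt neg simp del: upt_Suc\<close>)
    define r where "r = RComp q (RMin p' # map RProj [0..<k])"
    have "computes r (map e [0..<k]) (Q (LEAST m. P m e) e)" if ex: "\<exists>m. P m e" for e
    proof -
      define m where "m = (LEAST m. P m e)"
      have "P m e" unfolding m_def by (rule LeastI_ex[OF ex])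
      moreover have "\<not> P j e" if "j < m" for j using that not_less_Least unfolding m_def by blast
      then have "computes p' (j # map e [0..<k]) (Suc 0)" if "j < m" for j
        using p'[of j e] that by simp
      ultimately have "computes (RMin p') (map e [0..<k]) m"
        using p'[of m e] by (intro computes.min) auto
      moreover have "list_all2 (\<lambda>g y. computes g (map e [0..<k]) y) (map RProj [0..<k]) (map e [0..<k])"
        using computes.proj[of _ "map e [0..<k]"] by (auto simp: list_all2_conv_all_nth)
      ultimately have "list_all2 (\<lambda>g y. computes g (map e [0..<k]) y) (RMin p' # map RProj [0..<k]) (m # map e [0..<k])"
        by simp
      moreover have "computes q (m # map e [0..<k]) (Q m e)"
        using q[of "case_nat m e"] by (simp add: map_case_nat_upt del: upt_Suc)
      ultimately show ?thesis unfolding r_def m_def by (rule computes.comp)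
    qed
    then show "\<exists>p. \<forall>e. (\<exists>m. P m e) \<longrightarrow> computes p (map e [0..<k]) (Q (LEAST m. P m e) e)" by blast
  qed
qed

lemma rec_fun_least:
  assumes "rec_pred (\<lambda>e. P (e 0) (\<lambda>i. e (i + 1)))" "\<And>e. \<exists>m. P m e"
  shows "rec_fun (\<lambda>e. LEAST m. P m e)"
  using rec_fun_search[of P "\<lambda>m e. m", OF assms(1) rec_fun_proj] assms(2)
  unfolding rec_fun_def by simp

lemma rec_fun_rec_nat:
  assumes a: "rec_fun a" and z: "rec_fun z" and s: "rec_fun (\<lambda>e. s (e 0) (e 1) (\<lambda>i. e (i + 2)))"
  shows "rec_fun (\<lambda>e. rec_nat (z e) (\<lambda>m y. s m y e) (a e))"
proof -
  \<comment> \<open>\<open>RPrim\<close> recurses on its first argument, so the recursion is built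
    with the counter there, and \<open>a\<close> is substituted afterwards.\<close>
  define h where "h e = rec_nat (z (\<lambda>i. e (Suc i))) (\<lambda>m y. s m y (\<lambda>i. e (Suc i))) (e 0)" for e
  have "rec_fun h"
  proof -
    obtain K1 where K1: "\<And>k. k \<ge> K1 \<Longrightarrow> \<exists>p. \<forall>e. computes p (map e [0..<k]) (z e)"
      using z unfolding rec_fun_def by blast
    obtain K2 where K2: "\<And>k. k \<ge> K2 \<Longrightarrow> \<exists>p. \<forall>e. computes p (map e [0..<k]) (s (e 0) (e 1) (\<lambda>i. e (i + 2)))"
      using s unfolding rec_fun_def by blast
    show ?thesis
      unfolding rec_fun_def
    proof (intro exI[of _ "Suc (K1 + K2)"] allI impI)
      fix k' assume "Suc (K1 + K2) \<le> k'"
      then obtain k where k': "k' = Suc k" and k: "K1 + K2 \<le> k" by (cases k') auto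
      obtain p where p: "\<And>e. computes p (map e [0..<k]) (z e)"
        using K1[of k] k by auto
      obtain q where q: "\<And>e. computes q (map e [0..<Suc (Suc k)]) (s (e 0) (e 1) (\<lambda>i. e (i + 2)))"
        using K2[of "Suc (Suc k)"] k by auto
      have q: "computes q (m # y # map e [0..<k]) (s m y e)" for m y e
        using q[of "case_nat m (case_nat y e)"] by (simp add: map_case_nat_upt del: upt_Suc)
      have "computes (RPrim p q) (m # map e [0..<k]) (rec_nat (z e) (\<lambda>m y. s m y e) m)" for m e
      proof (induction m)
        case 0
        then show ?case using computes.prim_0[OF p[of e]] by simp
      next
        case (Suc m)
        then show ?case using computes.prim_Suc[OF _ q] by simp
      qed
      from this[of "e 0" "\<lambda>i. e (Suc i)" for e]
      have "computes (RPrim p q) (map e [0..<k']) (h e)" for e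
        by (simp add: h_def k' upt_conv_Cons map_Suc_upt[symmetric] comp_def del: upt_Suc)
      then show "\<exists>p. \<forall>e. computes p (map e [0..<k']) (h e)" by blast
    qed
  qed
  moreover have "rec_fun (case i of 0 \<Rightarrow> a | Suc j \<Rightarrow> (\<lambda>e. e j))" for i
    using a by (cases i) (auto intro: rec_fun_proj)
  ultimately have "rec_fun (\<lambda>e. h (\<lambda>i. (case i of 0 \<Rightarrow> a | Suc j \<Rightarrow> (\<lambda>e. e j)) e))"
    by (rule rec_fun_subst)
  then show ?thesis by (simp add: h_def)
qed

lemma rec_fun_Suc:
  assumes "rec_fun a"
  shows "rec_fun (\<lambda>e. Suc (a e))"
proof -
  have "rec_fun (\<lambda>e. Suc (e 0))"
    unfolding rec_fun_def
  proof (intro exI allI impI)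
    fix k :: nat and e assume "1 \<le> k"
    then have "computes (RProj 0) (map e [0..<k]) (e 0)"
      using computes.proj[of 0 "map e [0..<k]"] by simp
    then show "computes (RComp RSucc [RProj 0]) (map e [0..<k]) (Suc (e 0))"
      by (intro computes.comp[of _ _ "[e 0]"] computes.succ) simp
  qed
  from rec_fun_subst[OF this, of "\<lambda>_. a"] assms show ?thesis by simp
qed

lemma rec_fun_const: "rec_fun (\<lambda>_. c)"
proof (induction c)
  case 0
  show ?case unfolding rec_fun_def by (intro exI allI impI) (rule computes.zero)
next
  case (Suc c)
  then show ?case by (rule rec_fun_Suc)
qed

text \<open>Nested binders accumulate shifts as sums such as \<open>i + 1 + 1\<close>, which
  resolution meets unsimplified. Depth three occurs in \<open>represents\<close>.\<close>

lemma rec_fun_shift: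
  assumes "rec_fun a"
  shows "rec_fun (\<lambda>e. a (\<lambda>i. e (i + j)))"
    and "rec_fun (\<lambda>e. a (\<lambda>i. e (i + j + k)))"
    and "rec_fun (\<lambda>e. a (\<lambda>i. e (i + j + k + l)))"
  using rec_fun_subst[where f = a and g = "\<lambda>i e. e (i + j)", OF assms rec_fun_proj]
    rec_fun_subst[where f = a and g = "\<lambda>i e. e (i + j + k)", OF assms rec_fun_proj]
    rec_fun_subst[where f = a and g = "\<lambda>i e. e (i + j + k + l)", OF assms rec_fun_proj]
  by simp_all

lemma rec_fun_add:
  assumes "rec_fun a" "rec_fun b"
  shows "rec_fun (\<lambda>e. a e + b e)"
proof -
  have "rec_fun (\<lambda>e. rec_nat (b e) (\<lambda>m y. Suc y) (a e))"
    by (intro rec_fun_rec_nat assms rec_fun_Suc rec_fun_proj)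
  moreover have "rec_nat y (\<lambda>m y. Suc y) x = x + y" for x y :: nat by (induction x) auto
  ultimately show ?thesis by simp
qed

lemma rec_fun_mult:
  assumes "rec_fun a" "rec_fun b"
  shows "rec_fun (\<lambda>e. a e * b e)"
proof -
  have "rec_fun (\<lambda>e. rec_nat 0 (\<lambda>m y. b e + y) (a e))"
    by (intro rec_fun_rec_nat assms rec_fun_const rec_fun_add rec_fun_shift rec_fun_proj)
  moreover have "rec_nat 0 (\<lambda>m z. y + z) x = x * y" for x y :: nat by (induction x) auto
  ultimately show ?thesis by simp
qed

lemma rec_fun_power:
  assumes "rec_fun a" "rec_fun b"
  shows "rec_fun (\<lambda>e. a e ^ b e)"
proof -
  have "rec_fun (\<lambda>e. rec_nat 1 (\<lambda>m y. a e * y) (b e))"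
    by (intro rec_fun_rec_nat assms rec_fun_const rec_fun_mult rec_fun_shift rec_fun_proj)
  moreover have "rec_nat 1 (\<lambda>m z. x * z) y = x ^ y" for x y :: nat by (induction y) auto
  ultimately show ?thesis by simp
qed

lemma rec_fun_minus:
  assumes "rec_fun a" "rec_fun b"
  shows "rec_fun (\<lambda>e. a e - b e)"
proof -
  have pred: "rec_fun (\<lambda>e. a e - 1)" if "rec_fun a" for a
  proof -
    have "rec_fun (\<lambda>e. rec_nat 0 (\<lambda>m y. m) (a e))"
      by (intro rec_fun_rec_nat that rec_fun_const rec_fun_proj)
    moreover have "rec_nat 0 (\<lambda>m y. m) x = x - 1" for x :: nat by (cases x) auto
    ultimately show ?thesis by simp
  qed
  have "rec_fun (\<lambda>e. rec_nat (a e) (\<lambda>m y. y - 1) (b e))"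
    by (intro rec_fun_rec_nat assms pred rec_fun_proj)
  moreover have "rec_nat x (\<lambda>m y. y - 1) y = x - y" for x y :: nat by (induction y) auto
  ultimately show ?thesis by simp
qed

lemma rec_pred_le:
  assumes "rec_fun a" "rec_fun b"
  shows "rec_pred (\<lambda>e. a e \<le> b e)"
proof -
  have "rec_fun (\<lambda>e. 1 - (a e - b e))"
    by (intro rec_fun_minus rec_fun_const assms)
  moreover have "1 - (x - y) = of_bool (x \<le> y)" for x y :: nat by auto
  ultimately show ?thesis by (simp add: rec_pred_def)
qed

lemma rec_pred_not:
  assumes "rec_pred P"
  shows "rec_pred (\<lambda>e. \<not> P e)"
proof -
  have "rec_fun (\<lambda>e. 1 - of_bool (P e))"
    using assms by (intro rec_fun_minus rec_fun_const) (simp add: rec_pred_def)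
  moreover have "1 - of_bool b = (of_bool (\<not> b) :: nat)" for b by simp
  ultimately show ?thesis by (simp add: rec_pred_def del: One_nat_def)
qed

lemma rec_pred_conj:
  assumes "rec_pred P" "rec_pred Q"
  shows "rec_pred (\<lambda>e. P e \<and> Q e)"
  using rec_fun_mult[OF assms[unfolded rec_pred_def]] by (simp add: rec_pred_def of_bool_conj)

lemma rec_pred_disj:
  assumes "rec_pred P" "rec_pred Q"
  shows "rec_pred (\<lambda>e. P e \<or> Q e)"
proof -
  have "rec_pred (\<lambda>e. \<not> (\<not> P e \<and> \<not> Q e))"
    by (intro rec_pred_not rec_pred_conj assms)
  then show ?thesis by simp
qed

lemma rec_pred_imp:
  assumes "rec_pred P" "rec_pred Q"
  shows "rec_pred (\<lambda>e. P e \<longrightarrow> Q e)"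
  unfolding imp_conv_disj by (intro rec_pred_disj rec_pred_not assms)

lemma rec_pred_less:
  assumes "rec_fun a" "rec_fun b"
  shows "rec_pred (\<lambda>e. a e < b e)"
  using rec_pred_le[OF rec_fun_Suc[OF assms(1)] assms(2)] by (simp only: Suc_le_eq)

lemma rec_pred_eq:
  assumes "rec_fun a" "rec_fun b"
  shows "rec_pred (\<lambda>e. a e = b e)"
  using rec_pred_conj[OF rec_pred_le[OF assms] rec_pred_le[OF assms(2,1)]]
  by (simp only: order_eq_iff)

lemma rec_fun_if:
  assumes "rec_pred P" "rec_fun a" "rec_fun b"
  shows "rec_fun (\<lambda>e. if P e then a e else b e)"
proof -
  have "rec_fun (\<lambda>e. of_bool (P e) * a e + of_bool (\<not> P e) * b e)"
    using assms(1) rec_pred_not[OF assms(1)] assms(2,3)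
    by (intro rec_fun_add rec_fun_mult) (simp_all add: rec_pred_def)
  moreover have "of_bool (P e) * a e + of_bool (\<not> P e) * b e = (if P e then a e else b e)" for e
    by simp
  ultimately show ?thesis by simp
qed

lemma rec_pred_all:
  assumes a: "rec_fun a" and P: "rec_pred (\<lambda>e. P (e 0) (\<lambda>i. e (i + 1)))"
  shows "rec_pred (\<lambda>e. \<forall>i<a e. P i e)"
proof -
  \<comment> \<open>Inside the recursion the accumulated product sits between the counter and the
    outer variables, so \<open>P\<close> has to skip one entry.\<close>
  have "rec_fun (\<lambda>e. of_bool (P (case_nat (e 0) (\<lambda>i. e (i + 2)) 0) (\<lambda>i. case_nat (e 0) (\<lambda>i. e (i + 2)) (i + 1))))"
  proof (rule rec_fun_subst[where g = "\<lambda>i e. case_nat (e 0) (\<lambda>i. e (i + 2)) i", OF P[unfolded rec_pred_def]])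
    show "rec_fun (\<lambda>e. case_nat (e 0) (\<lambda>i. e (i + 2)) i)" for i
      by (cases i) (simp_all add: rec_fun_proj)
  qed
  then have "rec_fun (\<lambda>e. of_bool (P (e 0) (\<lambda>i. e (i + 2))))" by simp
  then have "rec_fun (\<lambda>e. rec_nat 1 (\<lambda>m y. of_bool (P m e) * y) (a e))"
    by (intro rec_fun_rec_nat a rec_fun_const rec_fun_mult rec_fun_proj)
  moreover have "rec_nat 1 (\<lambda>m y. of_bool (P m e) * y) x = (of_bool (\<forall>i<x. P i e) :: nat)" for x :: nat and e
    by (induction x) (auto simp: less_Suc_eq)
  ultimately show ?thesis by (simp add: rec_pred_def)
qed

lemma rec_pred_ex:
  assumes a: "rec_fun a" and P: "rec_pred (\<lambda>e. P (e 0) (\<lambda>i. e (i + 1)))"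
  shows "rec_pred (\<lambda>e. \<exists>i<a e. P i e)"
proof -
  have "rec_pred (\<lambda>e. \<not> (\<forall>i<a e. \<not> P i e))"
    by (intro rec_pred_not rec_pred_all a P)
  then show ?thesis by simp
qed

lemmas rec_basic_intros = rec_fun_proj rec_fun_const rec_fun_Suc rec_fun_add rec_fun_mult
  rec_fun_power rec_fun_minus rec_fun_if rec_pred_le rec_pred_less rec_pred_eq rec_pred_not
  rec_pred_conj rec_pred_disj rec_pred_imp rec_pred_all rec_pred_ex

section \<open>Division, pairing, lists and terms as recursive functions\<close>

lemma rec_fun_div:
  assumes "rec_fun a" "rec_fun b"
  shows "rec_fun (\<lambda>e. a e div b e)"
proof -
  \<comment> \<open>The disjunct \<open>y = 0\<close> keeps the search total and yields the
    convention \<open>x div 0 = 0\<close>.\<close>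
  have eq: "(LEAST k. y = 0 \<or> x < y * Suc k) = x div y" for x y :: nat
  proof (cases "y = 0")
    case False
    show ?thesis
    proof (rule Least_equality)
      show "y = 0 \<or> x < y * Suc (x div y)"
        using False by (simp add: dividend_less_times_div)
      fix k assume "y = 0 \<or> x < y * Suc k"
      with False have "x div y < Suc k" by (simp add: less_mult_imp_div_less mult.commute)
      then show "x div y \<le> k" by simp
    qed
  qed (auto intro: Least_equality)
  have "rec_fun (\<lambda>e. LEAST k. b e = 0 \<or> a e < b e * Suc k)"
  proof (rule rec_fun_least)
    show "rec_pred (\<lambda>e. b (\<lambda>i. e (i + 1)) = 0 \<or> a (\<lambda>i. e (i + 1)) < b (\<lambda>i. e (i + 1)) * Suc (e 0))"
      by (intro rec_basic_intros rec_fun_shift assms)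
    show "\<exists>k. b e = 0 \<or> a e < b e * Suc k" for e
      by (cases "b e = 0") (auto intro!: exI[of _ "a e div b e"] simp: dividend_less_times_div)
  qed
  then show ?thesis by (simp only: eq)
qed

lemma rec_fun_mod:
  assumes "rec_fun a" "rec_fun b"
  shows "rec_fun (\<lambda>e. a e mod b e)"
proof -
  have "rec_fun (\<lambda>e. a e - b e * (a e div b e))"
    by (intro rec_basic_intros rec_fun_div assms)
  then show ?thesis by (simp add: minus_mult_div_eq_mod)
qed

lemma rec_pred_dvd:
  assumes "rec_fun a" "rec_fun b"
  shows "rec_pred (\<lambda>e. a e dvd b e)"
  unfolding dvd_eq_mod_eq_0 by (intro rec_basic_intros rec_fun_mod assms)

lemma rec_fun_prod_encode:
  assumes "rec_fun a" "rec_fun b"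
  shows "rec_fun (\<lambda>e. prod_encode (a e, b e))"
  unfolding prod_encode_def triangle_def prod.case by (intro rec_basic_intros rec_fun_div assms)

definition pfst :: "nat \<Rightarrow> nat" where "pfst p = fst (prod_decode p)"
definition psnd :: "nat \<Rightarrow> nat" where "psnd p = snd (prod_decode p)"

lemma pfst_prod_encode [simp]: "pfst (prod_encode (a, b)) = a"
  and psnd_prod_encode [simp]: "psnd (prod_encode (a, b)) = b"
  by (simp_all add: pfst_def psnd_def)

lemma prod_encode_pfst_psnd: "prod_encode (pfst p, psnd p) = p"
  by (simp add: pfst_def psnd_def)

lemma pfst_le: "pfst p \<le> p" and psnd_le: "psnd p \<le> p"
  using le_prod_encode_1[of "pfst p" "psnd p"] le_prod_encode_2[of "psnd p" "pfst p"]
  by (simp_all add: prod_encode_pfst_psnd)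

lemma pfst_0 [simp]: "pfst 0 = 0" and psnd_0 [simp]: "psnd 0 = 0"
  using pfst_le[of 0] psnd_le[of 0] by simp_all

lemma rec_fun_pfst:
  assumes "rec_fun a"
  shows "rec_fun (\<lambda>e. pfst (a e))"
proof -
  have eq: "(LEAST x. \<exists>y<Suc p. prod_encode (x, y) = p) = pfst p" for p
  proof (rule Least_equality)
    show "\<exists>y<Suc p. prod_encode (pfst p, y) = p"
      using psnd_le[of p] by (intro exI[of _ "psnd p"]) (simp add: prod_encode_pfst_psnd)
  qed auto
  have "rec_fun (\<lambda>e. LEAST x. \<exists>y<Suc (a e). prod_encode (x, y) = a e)"
  proof (rule rec_fun_least)
    show "rec_pred (\<lambda>e. \<exists>y<Suc (a (\<lambda>i. e (i + 1))). prod_encode (e 0, y) = a (\<lambda>i. e (i + 1)))"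
      by (intro rec_basic_intros rec_fun_prod_encode rec_fun_shift assms)
    show "\<exists>x. \<exists>y<Suc (a e). prod_encode (x, y) = a e" for e
      using psnd_le[of "a e"] by (intro exI[of _ "pfst (a e)"] exI[of _ "psnd (a e)"]) (simp add: prod_encode_pfst_psnd)
  qed
  then show ?thesis by (simp only: eq)
qed

lemma rec_fun_psnd:
  assumes "rec_fun a"
  shows "rec_fun (\<lambda>e. psnd (a e))"
proof -
  have eq: "(LEAST y. prod_encode (pfst p, y) = p) = psnd p" for p
    by (rule Least_equality) (auto simp: prod_encode_pfst_psnd dest: arg_cong[of _ _ psnd])
  have "rec_fun (\<lambda>e. LEAST y. prod_encode (pfst (a e), y) = a e)"
  proof (rule rec_fun_least)
    show "rec_pred (\<lambda>e. prod_encode (pfst (a (\<lambda>i. e (i + 1))), e 0) = a (\<lambda>i. e (i + 1)))"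
      by (intro rec_basic_intros rec_fun_prod_encode rec_fun_pfst rec_fun_shift assms)
    show "\<exists>y. prod_encode (pfst (a e), y) = a e" for e
      by (intro exI[of _ "psnd (a e)"]) (simp add: prod_encode_pfst_psnd)
  qed
  then show ?thesis by (simp only: eq)
qed

text \<open>A nonempty list is coded by the successor of a pair of head and tail, so
  \<open>y - 1\<close> followed by \<open>psnd\<close> drops the head. Past the end the code stays
  \<open>0\<close>, and so does the entry read.\<close>

definition list_nth_code :: "nat \<Rightarrow> nat \<Rightarrow> nat" where
  "list_nth_code L i = pfst (rec_nat L (\<lambda>_ y. psnd (y - 1)) i - 1)"

lemma list_nth_code_encode:
  "list_nth_code (list_encode xs) i = (if i < length xs then xs ! i else 0)"
proof -
  have "rec_nat (list_encode xs) (\<lambda>_ y. psnd (y - 1)) i = list_encode (drop i xs)"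
  proof (induction i)
    case (Suc i)
    then show ?case by (cases "drop i xs") (auto simp: drop_Suc tl_drop[symmetric])
  qed simp
  then show ?thesis
    by (cases "drop i xs") (auto simp: list_nth_code_def nth_via_drop split: if_splits)
qed

lemma list_nth_code_Cons:
  "list_nth_code (Suc (prod_encode (x, L))) i = (case i of 0 \<Rightarrow> x | Suc j \<Rightarrow> list_nth_code L j)"
  using list_nth_code_encode[of "x # list_decode L" i] list_nth_code_encode[of "list_decode L"]
  by (auto split: nat.split)

lemma rec_fun_list_nth_code:
  assumes "rec_fun a" "rec_fun b"
  shows "rec_fun (\<lambda>e. list_nth_code (a e) (b e))"
  unfolding list_nth_code_def
  by (intro rec_basic_intros rec_fun_pfst rec_fun_psnd rec_fun_rec_nat assms)

text \<open>Every number decodes to a term, so that no syntax check on codes is needed.\<close>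

function term_decode :: "nat \<Rightarrow> mv_term" where
  "term_decode c =
     (if pfst c = 0 then Var (psnd c)
      else if pfst c = 1 then Zero
      else if pfst c = 2 then Neg (term_decode (psnd c))
      else Plus (term_decode (pfst (psnd c))) (term_decode (psnd (psnd c))))"
  by auto

lemma psnd_less: "pfst c \<noteq> 0 \<Longrightarrow> psnd c < c"
proof -
  assume "pfst c \<noteq> 0"
  moreover have "c = triangle (pfst c + psnd c) + pfst c"
    using prod_encode_pfst_psnd[of c] by (simp add: prod_encode_def)
  moreover have "m \<le> triangle m" for m by (induction m) auto
  from this[of "pfst c + psnd c"] have "psnd c \<le> triangle (pfst c + psnd c)" by simp
  ultimately show ?thesis by simp
qed

termination
  by (relation less_than)
     (auto simp: psnd_less intro: le_less_trans[OF pfst_le] le_less_trans[OF psnd_le])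

declare term_decode.simps [simp del]

lemma term_decode_code [simp]: "term_decode (term_code t) = t"
  by (induction t) (subst term_decode.simps, simp)+

text \<open>Course-of-values recursion: subterms have smaller codes but not the preceding one.
  \<open>H\<close> therefore collects the values of all codes below \<open>m\<close> in one
  list.\<close>

lemma rec_fun_nval:
  assumes q: "rec_fun q" and c: "rec_fun c" and V: "rec_fun (\<lambda>e. V (e 0) (\<lambda>i. e (i + 1)))"
  shows "rec_fun (\<lambda>e. nval (q e) (\<lambda>i. V i e) (term_decode (c e)))"
proof -
  \<comment> \<open>The newest value is at the head, so the value of code \<open>i\<close> is at
    position \<open>m - 1 - i\<close>.\<close>
  define look where "look m y i = list_nth_code y (m - 1 - i)" for m y i
  define step where "step q V m y =
      (if pfst m = 0 then V (psnd m) else if pfst m = 1 then 0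
       else if pfst m = 2 then q - look m y (psnd m)
       else if q \<le> look m y (pfst (psnd m)) + look m y (psnd (psnd m)) then q
       else look m y (pfst (psnd m)) + look m y (psnd (psnd m)))" for q :: nat and V m y
  define H where "H q V m = rec_nat 0 (\<lambda>m y. Suc (prod_encode (step q V m y, y))) m" for q V m
  have look: "list_nth_code (H q V m) (m - 1 - i) = nval q V (term_decode i)" if "i < m" for q V m i
    using that
  proof (induction m arbitrary: i)
    case (Suc m)
    have IH: "look m (H q V m) j = nval q V (term_decode j)" if "j < m" for j
      using Suc.IH[OF that] by (simp add: look_def)
    have "step q V m (H q V m) = nval q V (term_decode m)"
    proof (cases "pfst m = 0")
      case False
      then have "psnd m < m" "pfst (psnd m) < m" "psnd (psnd m) < m"
        using psnd_less[of m] pfst_le[of "psnd m"] psnd_le[of "psnd m"] by auto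
      with False show ?thesis
        by (subst term_decode.simps) (simp add: step_def IH min_def)
    qed (subst term_decode.simps, simp add: step_def)
    moreover have "H q V (Suc m) = Suc (prod_encode (step q V m (H q V m), H q V m))"
      by (simp add: H_def)
    ultimately have H: "list_nth_code (H q V (Suc m)) j =
        (case j of 0 \<Rightarrow> nval q V (term_decode m) | Suc j \<Rightarrow> list_nth_code (H q V m) j)" for j
      by (simp add: list_nth_code_Cons)
    show ?case
    proof (cases "i = m")
      case False
      with Suc.prems have "i < m" "Suc m - 1 - i = Suc (m - 1 - i)" by auto
      with Suc.IH show ?thesis by (simp add: H)
    qed (simp add: H)
  qed simp
  have eq: "nval q V (term_decode c) = list_nth_code (H q V (Suc c)) 0" for q V c
    using look[of c "Suc c" q V] by simp
  have V2: "rec_fun (\<lambda>e. V (a e) (\<lambda>i. e (i + 2)))" if "rec_fun a" for a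
  proof -
    have "rec_fun (\<lambda>e. V (case_nat (a e) (\<lambda>i. e (i + 2)) 0) (\<lambda>i. case_nat (a e) (\<lambda>i. e (i + 2)) (i + 1)))"
    proof (rule rec_fun_subst[where g = "\<lambda>i e. case_nat (a e) (\<lambda>i. e (i + 2)) i", OF V])
      show "rec_fun (\<lambda>e. case_nat (a e) (\<lambda>i. e (i + 2)) i)" for i
        using that by (cases i) (simp_all add: rec_fun_proj)
    qed
    then show ?thesis by simp
  qed
  show ?thesis
    unfolding eq H_def step_def look_def
    by (intro rec_basic_intros rec_fun_list_nth_code rec_fun_rec_nat rec_fun_prod_encode
        rec_fun_pfst rec_fun_psnd V2 rec_fun_shift q c)
qed

section \<open>Searching for certificates\<close>

text \<open>
  A point of denominator \<open>d\<close> is given by the digits in base \<open>d + 1\<close> of one number; digit \<open>0\<close>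
  is suppressed, so that the code \<open>0\<close> of \<open>Var 0\<close>, which is read beyond the end of a list of
  codes, has the value \<open>0\<close>.
\<close>

definition digit :: "nat \<Rightarrow> nat \<Rightarrow> nat \<Rightarrow> nat" where
  "digit d c i = (if i = 0 then 0 else c div Suc d ^ i mod Suc d)"

definition code_val :: "nat \<Rightarrow> nat \<Rightarrow> nat \<Rightarrow> nat" where
  "code_val d c t = nval d (digit d c) (term_decode t)"

text \<open>\<open>Suc r\<close> bounds the leaves of the decoded term and \<open>Suc T\<close>
  those of each substituted generator, so the product bounds the composite. \<open>Suc s\<close>
  bounds the target.\<close>

definition leaf_bound :: "nat \<Rightarrow> nat \<Rightarrow> nat \<Rightarrow> nat" where
  "leaf_bound T s r = Suc r * Suc T + Suc s"

text \<open>The range of \<open>d\<close> is the threshold of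
  \<open>mval_eq_of_small_denominators\<close>, and \<open>n + 1\<close> digits leave room for the
  suppressed digit \<open>0\<close>. All quantifiers are bounded, so the check is recursive.\<close>

definition represents :: "nat \<Rightarrow> nat \<Rightarrow> nat \<Rightarrow> nat \<Rightarrow> bool" where
  "represents n T s r \<longleftrightarrow>
     (\<forall>d<Suc (2 * (2 * leaf_bound T s r) ^ n). \<forall>c<Suc d ^ Suc n. 0 < d \<longrightarrow>
        nval d (\<lambda>i. code_val d c (list_nth_code T i)) (term_decode r) = code_val d c s)"

text \<open>A list code is at least the length of the list, so \<open>Suc S\<close> reaches all
  entries; the surplus ones stand for the constant \<open>0\<close>.\<close>

definition generates :: "nat \<Rightarrow> nat \<Rightarrow> nat \<Rightarrow> nat \<Rightarrow> bool" where
  "generates n T S w \<longleftrightarrow> (\<forall>j<Suc S. represents n T (list_nth_code S j) (list_nth_code w j))"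

definition equal_witness :: "nat \<Rightarrow> nat \<Rightarrow> nat \<Rightarrow> nat \<Rightarrow> bool" where
  "equal_witness n T S w \<longleftrightarrow> generates n T S (pfst w) \<and> generates n S T (psnd w)"

text \<open>\<open>w\<close> packs the denominator minus one, the digit code of the point, and the
  multiplier \<open>q\<close>. For \<open>q = 0\<close> the condition holds for every list, so such
  a \<open>w\<close> distinguishes nothing.\<close>

definition integral_at :: "nat \<Rightarrow> nat \<Rightarrow> bool" where
  "integral_at w T \<longleftrightarrow> (\<forall>j<Suc T. Suc (pfst w) dvd
     psnd (psnd w) * code_val (Suc (pfst w)) (pfst (psnd w)) (list_nth_code T j))"

definition witness :: "nat \<Rightarrow> nat \<Rightarrow> nat \<Rightarrow> nat \<Rightarrow> bool" where
  "witness n T S w \<longleftrightarrow> equal_witness n T S w \<or> integral_at w T \<noteq> integral_at w S"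

lemma rec_fun_digit:
  assumes "rec_fun d" "rec_fun c" "rec_fun i"
  shows "rec_fun (\<lambda>e. digit (d e) (c e) (i e))"
  unfolding digit_def by (intro rec_basic_intros rec_fun_div rec_fun_mod assms)

lemma rec_fun_code_val:
  assumes "rec_fun d" "rec_fun c" "rec_fun t"
  shows "rec_fun (\<lambda>e. code_val (d e) (c e) (t e))"
  unfolding code_val_def
  by (intro rec_fun_nval rec_fun_digit rec_fun_proj rec_fun_shift assms)

lemma rec_pred_represents:
  assumes "rec_fun n" "rec_fun T" "rec_fun s" "rec_fun r"
  shows "rec_pred (\<lambda>e. represents (n e) (T e) (s e) (r e))"
  unfolding represents_def leaf_bound_def
  by (intro rec_basic_intros rec_fun_nval rec_fun_code_val rec_fun_list_nth_code rec_fun_shift assms)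

lemma rec_pred_generates:
  assumes "rec_fun n" "rec_fun T" "rec_fun S" "rec_fun w"
  shows "rec_pred (\<lambda>e. generates (n e) (T e) (S e) (w e))"
  unfolding generates_def
  by (intro rec_basic_intros rec_pred_represents rec_fun_list_nth_code rec_fun_shift assms)

lemma rec_pred_integral_at:
  assumes "rec_fun w" "rec_fun T"
  shows "rec_pred (\<lambda>e. integral_at (w e) (T e))"
  unfolding integral_at_def
  by (intro rec_basic_intros rec_pred_dvd rec_fun_code_val rec_fun_list_nth_code rec_fun_pfst
      rec_fun_psnd rec_fun_shift assms)

lemma rec_pred_equal_witness:
  assumes "rec_fun n" "rec_fun T" "rec_fun S" "rec_fun w"
  shows "rec_pred (\<lambda>e. equal_witness (n e) (T e) (S e) (w e))"
  unfolding equal_witness_def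
  by (intro rec_basic_intros rec_pred_generates rec_fun_pfst rec_fun_psnd assms)

lemma rec_pred_witness:
  assumes "rec_fun n" "rec_fun T" "rec_fun S" "rec_fun w"
  shows "rec_pred (\<lambda>e. witness (n e) (T e) (S e) (w e))"
proof -
  have "rec_pred (\<lambda>e. equal_witness (n e) (T e) (S e) (w e) \<or>
      \<not> ((integral_at (w e) (T e) \<longrightarrow> integral_at (w e) (S e)) \<and>
         (integral_at (w e) (S e) \<longrightarrow> integral_at (w e) (T e))))"
    by (intro rec_basic_intros rec_pred_equal_witness rec_pred_integral_at assms)
  moreover have "witness n T S w \<longleftrightarrow> equal_witness n T S w \<or>
      \<not> ((integral_at w T \<longrightarrow> integral_at w S) \<and> (integral_at w S \<longrightarrow> integral_at w T))" for n T S w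
    by (auto simp: witness_def)
  ultimately show ?thesis by simp
qed

lemma witness_search:
  "\<exists>p. \<forall>n T S. (\<exists>w. witness n T S w) \<longrightarrow>
     computes p [n, T, S] (of_bool (equal_witness n T S (LEAST w. witness n T S w)))"
proof -
  have "\<exists>K. \<forall>k\<ge>K. \<exists>p. \<forall>e. (\<exists>w. witness (e 0) (e 1) (e 2) w) \<longrightarrow>
      computes p (map e [0..<k])
        (of_bool (equal_witness (e 0) (e 1) (e 2) (LEAST w. witness (e 0) (e 1) (e 2) w)))"
  proof (rule rec_fun_search)
    show "rec_pred (\<lambda>e. witness (e (0 + 1)) (e (1 + 1)) (e (2 + 1)) (e 0))"
      by (intro rec_pred_witness rec_fun_proj)
    show "rec_fun (\<lambda>e. of_bool (equal_witness (e (0 + 1)) (e (1 + 1)) (e (2 + 1)) (e 0)))"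
      unfolding rec_pred_def[symmetric] by (intro rec_pred_equal_witness rec_fun_proj)
  qed
  then obtain K where K: "\<And>k. k \<ge> K \<Longrightarrow> \<exists>p. \<forall>e. (\<exists>w. witness (e 0) (e 1) (e 2) w) \<longrightarrow>
      computes p (map e [0..<k])
        (of_bool (equal_witness (e 0) (e 1) (e 2) (LEAST w. witness (e 0) (e 1) (e 2) w)))"
    by blast
  define k where "k = K + 3"
  obtain p where p: "\<And>e. (\<exists>w. witness (e 0) (e 1) (e 2) w) \<Longrightarrow>
      computes p (map e [0..<k])
        (of_bool (equal_witness (e 0) (e 1) (e 2) (LEAST w. witness (e 0) (e 1) (e 2) w)))"
    using K[of k] by (auto simp: k_def)
  \<comment> \<open>The search program expects a long argument tuple; the three inputs are padded
    with zeros.\<close>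
  define q where "q = RComp p (map (\<lambda>i. if i < 3 then RProj i else RZero) [0..<k])"
  have "computes q [n, T, S] (of_bool (equal_witness n T S (LEAST w. witness n T S w)))"
    if "\<exists>w. witness n T S w" for n T S
  proof -
    define e where "e i = (if i < 3 then [n, T, S] ! i else 0)" for i
    have e: "e 0 = n" "e 1 = T" "e 2 = S" by (simp_all add: e_def)
    have "list_all2 (\<lambda>g y. computes g [n, T, S] y)
        (map (\<lambda>i. if i < 3 then RProj i else RZero) [0..<k]) (map e [0..<k])"
      using computes.proj[of _ "[n, T, S]"] computes.zero
      by (auto simp: list_all2_conv_all_nth e_def)
    moreover have "computes p (map e [0..<k])
        (of_bool (equal_witness n T S (LEAST w. witness n T S w)))"
      using p[of e] that unfolding e by blast
    ultimately show ?thesis unfolding q_def by (rule computes.comp)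
  qed
  then show ?thesis by blast
qed

section \<open>Correctness of the search\<close>

primrec mv_subst :: "(nat \<Rightarrow> mv_term) \<Rightarrow> mv_term \<Rightarrow> mv_term" where
  "mv_subst \<theta> (Var i) = \<theta> i"
| "mv_subst \<theta> Zero = Zero"
| "mv_subst \<theta> (Neg t) = Neg (mv_subst \<theta> t)"
| "mv_subst \<theta> (Plus s t) = Plus (mv_subst \<theta> s) (mv_subst \<theta> t)"

text \<open>Padding with \<open>Zero\<close> makes every term, whatever its variables, a valid
  expression in the generators.\<close>

definition entry :: "mv_term list \<Rightarrow> nat \<Rightarrow> mv_term" where
  "entry ts i = (if i < length ts then ts ! i else Zero)"

lemma entry_vars: "\<forall>t\<in>set ts. mv_vars t \<subseteq> A \<Longrightarrow> mv_vars (entry ts i) \<subseteq> A"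
  by (simp add: entry_def)

lemma mv_vars_subst: "(\<And>i. mv_vars (\<theta> i) \<subseteq> A) \<Longrightarrow> mv_vars (mv_subst \<theta> t) \<subseteq> A"
  by (induction t) auto

lemma mv_closed_subst: "mv_closed (range (mv_subst \<theta>))"
  unfolding mv_closed_def
proof (intro conjI ballI)
  show "Zero \<in> range (mv_subst \<theta>)" by (rule range_eqI[of _ _ Zero]) simp
  show "Neg s \<in> range (mv_subst \<theta>)" if s: "s \<in> range (mv_subst \<theta>)" for s
  proof -
    obtain s' where "s = mv_subst \<theta> s'" using s by blast
    then show ?thesis by (intro range_eqI[of _ _ "Neg s'"]) simp
  qed
  show "Plus s t \<in> range (mv_subst \<theta>)" if st: "s \<in> range (mv_subst \<theta>)" "t \<in> range (mv_subst \<theta>)" for s t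
  proof -
    obtain s' t' where "s = mv_subst \<theta> s'" "t = mv_subst \<theta> t'" using st by blast
    then show ?thesis by (intro range_eqI[of _ _ "Plus s' t'"]) simp
  qed
qed

lemma nval_subst: "nval d a (mv_subst \<theta> t) = nval d (\<lambda>i. nval d a (\<theta> i)) t"
  by (induction t) auto

lemma nval_cong: "(\<And>i. i \<in> mv_vars t \<Longrightarrow> a i = b i) \<Longrightarrow> nval d a t = nval d b t"
  by (induction t) auto

lemma leaves_subst: "(\<And>i. leaves (\<theta> i) \<le> M) \<Longrightarrow> M > 0 \<Longrightarrow> leaves (mv_subst \<theta> t) \<le> leaves t * M"
  by (induction t) (auto simp: distrib_right intro: add_mono)

text \<open>Pairing satisfies \<open>m + n \<le> prod_encode (m, n)\<close>, and the tag
  \<open>3\<close> pays for the extra leaf at \<open>Plus\<close>.\<close>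

lemma leaves_le_code: "leaves t \<le> Suc (term_code t)"
proof (induction t)
  case (Neg t)
  have "term_code t \<le> prod_encode (2, term_code t)" by (rule le_prod_encode_2)
  with Neg show ?case by simp
next
  case (Plus s t)
  have sum: "m + n \<le> prod_encode (m, n)" for m n
  proof -
    have "j \<le> triangle j" for j by (induction j) auto
    from this[of "m + n"] show ?thesis by (simp add: prod_encode_def)
  qed
  have "3 + (term_code s + term_code t) \<le> 3 + prod_encode (term_code s, term_code t)"
    using sum by simp
  also have "\<dots> \<le> term_code (Plus s t)" using sum[of 3] by simp
  finally show ?case using Plus by simp
qed simp_all

lemma list_encode_ge: "x \<in> set xs \<Longrightarrow> x \<le> list_encode xs" and length_le_list_encode: "length xs \<le> list_encode xs"
proof -
  show "x \<in> set xs \<Longrightarrow> x \<le> list_encode xs"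
  proof (induction xs)
    case (Cons y xs)
    then show ?case
      using le_prod_encode_1[of y "list_encode xs"] le_prod_encode_2[of "list_encode xs" y] by auto
  qed simp
  show "length xs \<le> list_encode xs"
  proof (induction xs)
    case (Cons y xs)
    then show ?case using le_prod_encode_2[of "list_encode xs" y] by simp
  qed simp
qed

lemma list_nth_terms_code:
  "list_nth_code (terms_code ts) i = (if i < length ts then term_code (ts ! i) else 0)"
  by (simp add: terms_code_def list_nth_code_encode)

lemma code_val_0: "code_val d c 0 = 0"
  by (simp add: code_val_def term_decode.simps[of 0] digit_def)

lemma code_val_nth: "code_val d c (list_nth_code (terms_code ts) i) = nval d (digit d c) (entry ts i)"
  by (simp add: list_nth_terms_code code_val_0 entry_def) (simp add: code_val_def)

lemma leaves_entry: "leaves (entry ts i) \<le> Suc (list_nth_code (terms_code ts) i)"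
  by (simp add: entry_def list_nth_terms_code leaves_le_code)

lemma leaves_entry_le: "leaves (entry ts i) \<le> Suc (terms_code ts)"
proof (cases "i < length ts")
  case True
  then have "term_code (ts ! i) \<le> terms_code ts" unfolding terms_code_def by (intro list_encode_ge) simp
  with leaves_le_code[of "ts ! i"] True show ?thesis by (simp add: entry_def)
qed (simp add: entry_def)

text \<open>Entries of a certificate are arbitrary numbers, on which \<open>term_decode\<close> need
  not invert \<open>term_code\<close>, so the size bound follows the decoding.\<close>

lemma leaves_decode: "leaves (term_decode c) \<le> Suc c"
proof (induction c rule: less_induct)
  case (less c)
  show ?case
  proof (cases "pfst c = 0")
    case False
    define r where "r = psnd c"
    have r: "r < c" using False psnd_less by (simp add: r_def)
    have "pfst r < c" "psnd r < c" using r pfst_le[of r] psnd_le[of r] by auto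
    moreover have "pfst r + psnd r + 2 \<le> c + 1"
    proof -
      have "j \<le> triangle j" for j by (induction j) auto
      from this[of "pfst r + psnd r"] have "pfst r + psnd r \<le> prod_encode (pfst r, psnd r)"
        by (simp add: prod_encode_def)
      with r show ?thesis by (simp add: prod_encode_pfst_psnd)
    qed
    ultimately show ?thesis
      using less[of r] less[of "pfst r"] less[of "psnd r"] r
      by (subst term_decode.simps) (auto simp: r_def[symmetric])
  qed (subst term_decode.simps, simp)
qed

lemma digits_surj:
  assumes "\<forall>i\<in>{1..n}. a i \<le> d"
  shows "\<exists>c < Suc d ^ Suc n. \<forall>i\<in>{1..n}. digit d c i = a i"
proof -
  have "\<exists>c < Suc d ^ Suc n. \<forall>i\<in>{1..n}. c div Suc d ^ i mod Suc d = a i"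
    using assms
  proof (induction n)
    case 0
    then show ?case by (intro exI[of _ 0]) auto
  next
    case (Suc n)
    then obtain c where c: "c < Suc d ^ Suc n" "\<forall>i\<in>{1..n}. c div Suc d ^ i mod Suc d = a i" by auto
    define b where "b = a (Suc n)"
    have b: "b \<le> d" using Suc.prems by (simp add: b_def)
    let ?c = "c + b * Suc d ^ Suc n"
    have "?c < Suc d ^ Suc n + b * Suc d ^ Suc n" using c by simp
    also have "\<dots> = Suc b * Suc d ^ Suc n" by simp
    also have "\<dots> \<le> Suc d * Suc d ^ Suc n" using b by (intro mult_right_mono) auto
    finally have "?c < Suc d ^ Suc (Suc n)" by simp
    moreover have "?c div Suc d ^ i mod Suc d = a i" if i: "i \<in> {1..Suc n}" for i
    proof (cases "i = Suc n")
      case True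
      have "?c div Suc d ^ Suc n = b" using c(1) by (subst div_mult_self1) (simp_all del: power_Suc)
      with True b show ?thesis by (simp add: b_def del: power_Suc)
    next
      case False
      with i have i: "i \<in> {1..n}" by auto
      \<comment> \<open>The added number is a multiple of \<open>Suc d ^ Suc i\<close> and cannot
        affect digit \<open>i\<close>.\<close>
      have "Suc d ^ Suc n = Suc d ^ i * (Suc d * Suc d ^ (n - i))"
        using i by (simp flip: power_add power_Suc)
      then have "?c = c + (b * Suc d ^ (n - i) * Suc d) * Suc d ^ i" by (simp only: mult.assoc mult.commute mult.left_commute)
      then have "?c div Suc d ^ i = b * Suc d ^ (n - i) * Suc d + c div Suc d ^ i"
        by (simp only: div_mult_self1) simp
      then show ?thesis using c(2) i by (simp only: mod_mult_self3)
    qed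
    ultimately show ?case by blast
  qed
  then show ?thesis by (simp add: digit_def)
qed

lemma digit_le: "digit d c i \<le> d"
  by (simp add: digit_def less_Suc_eq_le[symmetric])

section \<open>Term functions on the cube and generated subalgebras\<close>

lemma mval_term_fun: "x \<in> cube n \<Longrightarrow> term_fun n t x = mval x t"
  by (induction t) (auto simp: mv_zero_def mv_neg_def mv_plus_def)

lemma term_fun_extensional: "term_fun n t \<in> extensional (cube n)"
  by (cases t) (auto simp: mv_zero_def mv_neg_def mv_plus_def)

lemma cube_subset_unit_pts: "cube n \<subseteq> unit_pts n"
  by (auto simp: cube_def unit_pts_def PiE_iff)

lemma restrict_unit_pts: "x \<in> unit_pts n \<Longrightarrow> restrict x {1..n} \<in> cube n"
  by (auto simp: cube_def unit_pts_def)

lemma mval_restrict: "mv_vars t \<subseteq> {1..n} \<Longrightarrow> mval (restrict x {1..n}) t = mval x t"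
  by (rule mval_cong) auto

lemma term_fun_eq_iff:
  assumes "mv_vars s \<subseteq> {1..n}" "mv_vars t \<subseteq> {1..n}"
  shows "term_fun n s = term_fun n t \<longleftrightarrow> (\<forall>x\<in>unit_pts n. mval x s = mval x t)"
proof
  assume eq: "term_fun n s = term_fun n t"
  show "\<forall>x\<in>unit_pts n. mval x s = mval x t"
  proof
    fix x assume "x \<in> unit_pts n"
    then have "restrict x {1..n} \<in> cube n" by (rule restrict_unit_pts)
    with eq mval_term_fun[of "restrict x {1..n}" n] show "mval x s = mval x t"
      using mval_restrict[OF assms(1)] mval_restrict[OF assms(2)] by metis
  qed
next
  assume "\<forall>x\<in>unit_pts n. mval x s = mval x t"
  then show "term_fun n s = term_fun n t"
    using cube_subset_unit_pts[of n]
    by (intro extensionalityI[OF term_fun_extensional term_fun_extensional]) (auto simp: mval_term_fun)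
qed

text \<open>The instances are closed under the operations, and induction on \<open>r\<close> puts
  each of them into any subalgebra containing the generators.\<close>

lemma mv_generated_terms:
  assumes vars: "\<forall>t\<in>set ts. mv_vars t \<subseteq> {1..n}"
  shows "mv_generated n (term_fun n ` set ts) = term_fun n ` range (mv_subst (entry ts))"
  unfolding mv_generated_def
proof (rule hull_unique)
  show "term_fun n ` set ts \<subseteq> term_fun n ` range (mv_subst (entry ts))"
  proof (rule image_mono, rule subsetI)
    fix t assume "t \<in> set ts"
    then obtain i where "i < length ts" "t = ts ! i" by (auto simp: in_set_conv_nth)
    then show "t \<in> range (mv_subst (entry ts))"
      by (intro range_eqI[of _ _ "Var i"]) (simp add: entry_def)
  qed
  have "mv_vars (mv_subst (entry ts) r) \<subseteq> {1..n}" for r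
    by (intro mv_vars_subst entry_vars vars)
  then show "mv_subalgebra n (term_fun n ` range (mv_subst (entry ts)))"
    using mv_closed_subst[of "entry ts"] term_fun_in_McNaughton
    by (auto simp: mv_subalgebra_def mv_closed_def simp flip: term_fun.simps)
  fix A assume A: "term_fun n ` set ts \<subseteq> A" "mv_subalgebra n A"
  have "term_fun n (mv_subst (entry ts) r) \<in> A" for r
    using A by (induction r) (auto simp: mv_subalgebra_def entry_def)
  then show "term_fun n ` range (mv_subst (entry ts)) \<subseteq> A" by blast
qed

lemma in_generated_iff:
  assumes "\<forall>t\<in>set ts. mv_vars t \<subseteq> {1..n}" "mv_vars s \<subseteq> {1..n}"
  shows "term_fun n s \<in> mv_generated n (term_fun n ` set ts) \<longleftrightarrow>
    (\<exists>r. \<forall>x\<in>unit_pts n. mval x (mv_subst (entry ts) r) = mval x s)"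
proof -
  have "mv_vars (mv_subst (entry ts) r) \<subseteq> {1..n}" for r
    by (intro mv_vars_subst entry_vars assms(1))
  note eq = term_fun_eq_iff[OF this assms(2)]
  have "term_fun n s \<in> mv_generated n (term_fun n ` set ts) \<longleftrightarrow>
      (\<exists>r. term_fun n (mv_subst (entry ts) r) = term_fun n s)"
    unfolding mv_generated_terms[OF assms(1)] by (simp add: image_iff eq_commute)
  then show ?thesis by (simp only: eq)
qed

text \<open>Containment is tested on generators; the padding allows \<open>j\<close> to run over all
  numbers.\<close>

lemma generated_subset_iff:
  assumes "\<forall>t\<in>set ts. mv_vars t \<subseteq> {1..n}" "\<forall>t\<in>set ss. mv_vars t \<subseteq> {1..n}"
  shows "mv_generated n (term_fun n ` set ss) \<subseteq> mv_generated n (term_fun n ` set ts) \<longleftrightarrow>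
    (\<forall>j. \<exists>r. \<forall>x\<in>unit_pts n. mval x (mv_subst (entry ts) r) = mval x (entry ss j))"
proof -
  have vs: "mv_vars (entry ss j) \<subseteq> {1..n}" for j by (intro entry_vars assms(2))
  have *: "term_fun n (entry ss j) \<in> mv_generated n (term_fun n ` set ts) \<longleftrightarrow>
      (\<exists>r. \<forall>x\<in>unit_pts n. mval x (mv_subst (entry ts) r) = mval x (entry ss j))" for j
    by (rule in_generated_iff[OF assms(1) vs])
  have "mv_generated n (term_fun n ` set ss) \<subseteq> mv_generated n (term_fun n ` set ts) \<longleftrightarrow>
      (\<forall>j. term_fun n (entry ss j) \<in> mv_generated n (term_fun n ` set ts))"
  proof
    assume sub: "mv_generated n (term_fun n ` set ss) \<subseteq> mv_generated n (term_fun n ` set ts)"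
    have "entry ss j \<in> range (mv_subst (entry ss))" for j by (rule range_eqI[of _ _ "Var j"]) simp
    then have "term_fun n (entry ss j) \<in> mv_generated n (term_fun n ` set ss)" for j
      unfolding mv_generated_terms[OF assms(2)] by blast
    with sub show "\<forall>j. term_fun n (entry ss j) \<in> mv_generated n (term_fun n ` set ts)" by blast
  next
    assume el: "\<forall>j. term_fun n (entry ss j) \<in> mv_generated n (term_fun n ` set ts)"
    have "mv_vars (mv_subst (entry ts) r) \<subseteq> {1..n}" for r
      by (intro mv_vars_subst entry_vars assms(1))
    then have "mv_subalgebra n (mv_generated n (term_fun n ` set ts))"
      unfolding mv_generated_terms[OF assms(1)]
      using mv_closed_subst[of "entry ts"] term_fun_in_McNaughton
      by (auto simp: mv_subalgebra_def mv_closed_def simp flip: term_fun.simps)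
    moreover have "term_fun n ` set ss \<subseteq> mv_generated n (term_fun n ` set ts)"
      using el by (fastforce simp: in_set_conv_nth entry_def split: if_splits)
    ultimately show "mv_generated n (term_fun n ` set ss) \<subseteq> mv_generated n (term_fun n ` set ts)"
      by (metis hull_minimal mv_generated_def)
  qed
  then show ?thesis by (simp only: *)
qed

text \<open>\<open>N\<close> bounds the leaves of both sides, and every numerator vector on
  \<open>{1..n}\<close> occurs as digits, so the finite check decides the identity on the whole
  cube.\<close>

lemma represents_iff:
  assumes "\<forall>t\<in>set ts. mv_vars t \<subseteq> {1..n}" "\<forall>t\<in>set ss. mv_vars t \<subseteq> {1..n}"
  shows "represents n (terms_code ts) (list_nth_code (terms_code ss) j) r \<longleftrightarrow>
    (\<forall>x\<in>unit_pts n. mval x (mv_subst (entry ts) (term_decode r)) = mval x (entry ss j))"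
proof -
  let ?s = "mv_subst (entry ts) (term_decode r)" and ?t = "entry ss j"
  define N where "N = leaf_bound (terms_code ts) (list_nth_code (terms_code ss) j) r"
  have vs: "mv_vars ?s \<subseteq> {1..n}" by (intro mv_vars_subst entry_vars assms(1))
  have vt: "mv_vars ?t \<subseteq> {1..n}" by (intro entry_vars assms(2))
  have rep: "represents n (terms_code ts) (list_nth_code (terms_code ss) j) r \<longleftrightarrow>
      (\<forall>d<Suc (2 * (2 * N) ^ n). \<forall>c<Suc d ^ Suc n. 0 < d \<longrightarrow> nval d (digit d c) ?s = nval d (digit d c) ?t)"
    by (simp add: represents_def N_def code_val_nth nval_subst del: power_Suc)
  show ?thesis
  proof
    assume R: "represents n (terms_code ts) (list_nth_code (terms_code ss) j) r"
    have "leaves ?s \<le> leaves (term_decode r) * Suc (terms_code ts)"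
      by (rule leaves_subst) (simp_all add: leaves_entry_le)
    also have "\<dots> \<le> Suc r * Suc (terms_code ts)"
      by (intro mult_right_mono leaves_decode) simp
    finally have "leaves ?s \<le> N" by (simp add: N_def leaf_bound_def)
    moreover have "leaves ?t \<le> N" using leaves_entry[of ss j] by (simp add: N_def leaf_bound_def)
    moreover have "N > 0" by (simp add: N_def leaf_bound_def)
    moreover have "nval d a ?s = nval d a ?t"
      if d: "0 < d" "d \<le> 2 * (2 * N) ^ n" and a: "\<And>i. i \<in> {1..n} \<Longrightarrow> a i \<le> d" for d a
    proof -
      obtain c where c: "c < Suc d ^ Suc n" "\<And>i. i \<in> {1..n} \<Longrightarrow> digit d c i = a i"
        using digits_surj[of n a d] a by blast
      have "nval d a ?s = nval d (digit d c) ?s" by (rule nval_cong) (use vs c in auto)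
      also have "\<dots> = nval d (digit d c) ?t" using R c(1) d unfolding rep by auto
      also have "\<dots> = nval d a ?t" by (rule nval_cong) (use vt c in auto)
      finally show ?thesis .
    qed
    ultimately show "\<forall>x\<in>unit_pts n. mval x ?s = mval x ?t"
      using mval_eq_of_small_denominators[OF _ vs vt] by blast
  next
    assume eq: "\<forall>x\<in>unit_pts n. mval x ?s = mval x ?t"
    have "nval d (digit d c) ?s = nval d (digit d c) ?t" if "0 < d" for d c
    proof -
      have "(\<lambda>i. digit d c i / d) \<in> unit_pts n"
        using that digit_le by (simp add: unit_pts_def)
      with eq have "mval (\<lambda>i. digit d c i / d) ?s = mval (\<lambda>i. digit d c i / d) ?t" by blast
      with mval_nval[OF that digit_le] that show ?thesis by simp
    qed
    then show "represents n (terms_code ts) (list_nth_code (terms_code ss) j) r" unfolding rep by blast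
  qed
qed

lemma generates_iff:
  assumes "\<forall>t\<in>set ts. mv_vars t \<subseteq> {1..n}" "\<forall>t\<in>set ss. mv_vars t \<subseteq> {1..n}"
  shows "(\<exists>w. generates n (terms_code ts) (terms_code ss) w) \<longleftrightarrow>
    mv_generated n (term_fun n ` set ss) \<subseteq> mv_generated n (term_fun n ` set ts)"
proof -
  let ?R = "\<lambda>j r. \<forall>x\<in>unit_pts n. mval x (mv_subst (entry ts) r) = mval x (entry ss j)"
  have gen: "generates n (terms_code ts) (terms_code ss) w \<longleftrightarrow>
      (\<forall>j<Suc (terms_code ss). ?R j (term_decode (list_nth_code w j)))" for w
    by (simp only: generates_def represents_iff[OF assms])
  show ?thesis
    unfolding generated_subset_iff[OF assms]
  proof
    assume "\<exists>w. generates n (terms_code ts) (terms_code ss) w"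
    then obtain w where w: "\<And>j. j < Suc (terms_code ss) \<Longrightarrow> ?R j (term_decode (list_nth_code w j))"
      unfolding gen by blast
    show "\<forall>j. \<exists>r. ?R j r"
    proof
      fix j
      show "\<exists>r. ?R j r"
      proof (cases "j < Suc (terms_code ss)")
        case False
        then have "\<not> j < length ss"
          using length_le_list_encode[of "map term_code ss"] by (simp add: terms_code_def)
        then show ?thesis by (intro exI[of _ Zero]) (simp add: entry_def)
      qed (use w in blast)
    qed
  next
    assume "\<forall>j. \<exists>r. ?R j r"
    then obtain r where r: "\<And>j. ?R j (r j)" by metis
    define w where "w = list_encode (map (\<lambda>j. term_code (r j)) [0..<Suc (terms_code ss)])"
    have "term_decode (list_nth_code w j) = r j" if "j < Suc (terms_code ss)" for j
      using that by (simp add: w_def list_nth_code_encode del: upt_Suc)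
    then have "\<forall>j<Suc (terms_code ss). ?R j (term_decode (list_nth_code w j))" using r by simp
    then show "\<exists>w. generates n (terms_code ts) (terms_code ss) w" unfolding gen by (rule exI)
  qed
qed

lemma integral_at_iff:
  "integral_at w (terms_code ts) \<longleftrightarrow> (\<forall>j. Suc (pfst w) dvd
     psnd (psnd w) * nval (Suc (pfst w)) (digit (Suc (pfst w)) (pfst (psnd w))) (entry ts j))"
  (is "_ \<longleftrightarrow> (\<forall>j. ?D j)")
proof -
  have "?D j" if "\<not> j < Suc (terms_code ts)" for j
  proof -
    have "\<not> j < length ts"
      using that length_le_list_encode[of "map term_code ts"] by (simp add: terms_code_def)
    then show ?thesis by (simp add: entry_def)
  qed
  then show ?thesis unfolding integral_at_def code_val_nth by blast
qed

text \<open>Necessity of the criterion: the numerators \<open>v\<close> with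
  \<open>d dvd q * v\<close> include \<open>0\<close> and \<open>d\<close> and are closed under
  subtraction from \<open>d\<close> and truncated addition.\<close>

lemma dvd_nval_subst:
  assumes "d > 0" and "\<And>i j. i \<in> mv_vars (\<theta> j) \<Longrightarrow> a i \<le> d" and "\<And>j. d dvd q * nval d a (\<theta> j)"
  shows "d dvd q * nval d a (mv_subst \<theta> t)"
proof (induction t)
  case (Neg t)
  then show ?case by (simp add: diff_mult_distrib2)
next
  case (Plus s t)
  then show ?case by (auto simp: min_def distrib_left)
qed (use assms in auto)

lemma integral_at_mono:
  assumes vars: "\<forall>t\<in>set ts. mv_vars t \<subseteq> {1..n}" "\<forall>t\<in>set ss. mv_vars t \<subseteq> {1..n}"
    and sub: "mv_generated n (term_fun n ` set ss) \<subseteq> mv_generated n (term_fun n ` set ts)"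
    and int: "integral_at w (terms_code ts)"
  shows "integral_at w (terms_code ss)"
  unfolding integral_at_iff
proof
  fix j
  define d where "d = Suc (pfst w)"
  define a where "a = digit d (pfst (psnd w))"
  define q where "q = psnd (psnd w)"
  have d: "d > 0" by (simp add: d_def)
  have a: "a i \<le> d" for i unfolding a_def by (rule digit_le)
  obtain r where r: "\<And>x. x \<in> unit_pts n \<Longrightarrow> mval x (mv_subst (entry ts) r) = mval x (entry ss j)"
    using sub unfolding generated_subset_iff[OF vars] by blast
  have "(\<lambda>i. a i / d) \<in> unit_pts n" using d a by (simp add: unit_pts_def)
  from r[OF this] have "nval d a (mv_subst (entry ts) r) = nval d a (entry ss j)"
    using mval_nval[OF d a] d by simp
  moreover have "d dvd q * nval d a (mv_subst (entry ts) r)"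
    by (rule dvd_nval_subst[OF d a]) (use int in \<open>simp add: integral_at_iff d_def a_def q_def\<close>)
  ultimately show "Suc (pfst w) dvd
     psnd (psnd w) * nval (Suc (pfst w)) (digit (Suc (pfst w)) (pfst (psnd w))) (entry ss j)"
    by (simp add: d_def a_def q_def)
qed

lemma common_denominator:
  assumes "\<And>j. j \<in> {1..n} \<Longrightarrow> x j \<in> \<rat>" "\<And>j. j \<in> {1..n} \<Longrightarrow> (0::real) \<le> x j"
  shows "\<exists>d>0. \<exists>a::nat \<Rightarrow> nat. \<forall>j\<in>{1..n}. x j = a j / real d"
  using assms
proof (induction n)
  case 0
  then show ?case by (intro exI[of _ 1]) auto
next
  case (Suc n)
  then obtain d and a :: "nat \<Rightarrow> nat" where da: "d > 0" "\<forall>j\<in>{1..n}. x j = a j / real d" by auto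
  have xS: "x (Suc n) \<in> \<rat>" "0 \<le> x (Suc n)" using Suc.prems by auto
  then obtain m k :: nat where mk: "k \<noteq> 0" "\<bar>x (Suc n)\<bar> = m / k"
    by (auto elim: Rats_abs_nat_div_natE)
  have "x j = ((\<lambda>j. k * a j)(Suc n := d * m)) j / real (d * k)" if "j \<in> {1..Suc n}" for j
    using that da mk xS by (cases "j = Suc n") auto
  moreover have "d * k > 0" using da mk by simp
  ultimately show ?case by blast
qed

text \<open>The contrapositive of \<open>generated_if_integrality\<close>, with the violating
  rational point brought to a common denominator and coded.\<close>

lemma not_generated_witness:
  assumes vars: "\<forall>t\<in>set ts. mv_vars t \<subseteq> {1..n}" "\<forall>t\<in>set ss. mv_vars t \<subseteq> {1..n}"
    and sep: "separates_points n (term_fun n ` set ts)"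
    and not: "\<not> mv_generated n (term_fun n ` set ss) \<subseteq> mv_generated n (term_fun n ` set ts)"
  shows "\<exists>w. integral_at w (terms_code ts) \<and> \<not> integral_at w (terms_code ss)"
proof -
  let ?G = "range (mv_subst (entry ts))"
  obtain j where j: "\<not> (\<exists>r. \<forall>x\<in>unit_pts n. mval x (mv_subst (entry ts) r) = mval x (entry ss j))"
    using not unfolding generated_subset_iff[OF vars] by blast
  have vt: "mv_vars (entry ts i) \<subseteq> {1..n}" and vs: "mv_vars (entry ss i) \<subseteq> {1..n}" for i
    by (intro entry_vars vars)+
  have "\<exists>x q. x \<in> unit_pts n \<and> (\<forall>i\<in>{1..n}. x i \<in> \<rat>) \<and> 0 < q \<and>
      (\<forall>l<length ts. real q * mval x (entry ts l) \<in> \<int>) \<and> real q * mval x (entry ss j) \<notin> \<int>"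
  proof (rule ccontr)
    assume no: "\<not> ?thesis"
    have "\<exists>t\<in>?G. \<forall>x\<in>unit_pts n. mval x t = mval x (entry ss j)"
    proof (rule generated_if_integrality[where k = "length ts" and \<gamma> = "entry ts"])
      show "mv_closed ?G" by (rule mv_closed_subst)
      show "mv_vars t \<subseteq> {1..n}" if "t \<in> ?G" for t
      proof -
        obtain r where "t = mv_subst (entry ts) r" using \<open>t \<in> ?G\<close> by blast
        then show ?thesis using mv_vars_subst[of "entry ts" "{1..n}" r] vt by blast
      qed
      show "entry ts l \<in> ?G" for l by (rule range_eqI[of _ _ "Var l"]) simp
      show "mv_vars (entry ss j) \<subseteq> {1..n}" by (rule vs)
      show "real q * mval x (entry ss j) \<in> \<int>"
        if "x \<in> unit_pts n" "\<And>i. i \<in> {1..n} \<Longrightarrow> x i \<in> \<rat>" "0 < q"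
          "\<And>l. l < length ts \<Longrightarrow> real q * mval x (entry ts l) \<in> \<int>" for x q
        using that no by blast
      fix x y assume xy: "x \<in> unit_pts n" "y \<in> unit_pts n"
        and eq: "\<And>l. l < length ts \<Longrightarrow> mval x (entry ts l) = mval y (entry ts l)"
      \<comment> \<open>Separation speaks about extensional points of \<open>cube n\<close>, so the
        points are restricted first.\<close>
      let ?x = "restrict x {1..n}" and ?y = "restrict y {1..n}"
      have c: "?x \<in> cube n" "?y \<in> cube n" using xy by (blast intro: restrict_unit_pts)+
      have "f ?x = f ?y" if "f \<in> term_fun n ` set ts" for f
      proof -
        obtain l where l: "l < length ts" "f = term_fun n (entry ts l)"
          using \<open>f \<in> term_fun n ` set ts\<close> by (auto simp: in_set_conv_nth entry_def)
        then show ?thesis using eq[OF l(1)] mval_restrict[OF vt] c by (simp add: mval_term_fun)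
      qed
      with sep c have "?x = ?y" unfolding separates_points_def by blast
      then show "\<forall>i\<in>{1..n}. x i = y i" by (metis restrict_apply')
    qed
    with j show False by blast
  qed
  then obtain x q where x: "x \<in> unit_pts n" "\<And>i. i \<in> {1..n} \<Longrightarrow> x i \<in> \<rat>" and q: "0 < q"
    and int: "\<And>l. l < length ts \<Longrightarrow> real q * mval x (entry ts l) \<in> \<int>"
    and nint: "real q * mval x (entry ss j) \<notin> \<int>" by blast
  obtain d and a :: "nat \<Rightarrow> nat" where d: "d > 0" and a: "\<And>i. i \<in> {1..n} \<Longrightarrow> x i = a i / real d"
    using common_denominator[of n x] x by (auto simp: unit_pts_def)
  have ad: "a i \<le> d" if "i \<in> {1..n}" for i
  proof -
    have "x i \<le> 1" using x(1) that by (simp add: unit_pts_def)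
    then show ?thesis using a[OF that] d by simp
  qed
  obtain c where c: "\<And>i. i \<in> {1..n} \<Longrightarrow> digit d c i = a i"
    using digits_surj[of n a d] ad by blast
  have key: "d dvd q * nval d (digit d c) t \<longleftrightarrow> real q * mval x t \<in> \<int>" if t: "mv_vars t \<subseteq> {1..n}" for t
  proof -
    have "mval x t = mval (\<lambda>i. digit d c i / d) t"
      by (rule mval_cong) (use t a c in auto)
    also have "\<dots> = nval d (digit d c) t / d" using mval_nval[of d t "digit d c"] d digit_le by blast
    finally have "real q * mval x t = real (q * nval d (digit d c) t) / real d" by simp
    then show ?thesis
      using d of_int_div_of_int_in_Ints_iff[of "int (q * nval d (digit d c) t)" "int d", where ?'a = real]
      by (simp only: of_int_of_nat_eq int_dvd_int_iff of_nat_eq_0_iff) simp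
  qed
  \<comment> \<open>The denominator is stored as \<open>d - 1\<close> since
    \<open>integral_at\<close> adds \<open>1\<close>.\<close>
  define w where "w = prod_encode (d - 1, prod_encode (c, q))"
  have w: "Suc (pfst w) = d" "pfst (psnd w) = c" "psnd (psnd w) = q"
    using d by (simp_all add: w_def)
  have "d dvd q * nval d (digit d c) (entry ts l)" for l
  proof (cases "l < length ts")
    case True
    then show ?thesis using key[OF vt] int by blast
  qed (simp add: entry_def)
  then have "integral_at w (terms_code ts)" unfolding integral_at_iff w by blast
  moreover have "\<not> integral_at w (terms_code ss)"
    unfolding integral_at_iff w using key[OF vs] nint by blast
  ultimately show ?thesis by blast
qed

theorem theorem7p1:
  "\<exists>e. \<forall>n \<tau>s \<sigma>s.
     (\<forall>t \<in> set \<tau>s \<union> set \<sigma>s. mv_vars t \<subseteq> {1..n}) \<longrightarrow>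
     separates_points n (term_fun n ` set \<tau>s) \<longrightarrow>
     separates_points n (term_fun n ` set \<sigma>s) \<longrightarrow>
     computes e [n, terms_code \<tau>s, terms_code \<sigma>s]
       (if mv_generated n (term_fun n ` set \<tau>s) = mv_generated n (term_fun n ` set \<sigma>s)
        then 1 else 0)"
proof -
  obtain p where p: "\<And>n T S. \<exists>w. witness n T S w \<Longrightarrow>
      computes p [n, T, S] (of_bool (equal_witness n T S (LEAST w. witness n T S w)))"
    using witness_search by blast
  show ?thesis
  proof (intro exI[of _ p] allI impI)
    fix n \<tau>s \<sigma>s
    assume vars: "\<forall>t \<in> set \<tau>s \<union> set \<sigma>s. mv_vars t \<subseteq> {1..n}"
      and sep: "separates_points n (term_fun n ` set \<tau>s)" "separates_points n (term_fun n ` set \<sigma>s)"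
    let ?T = "terms_code \<tau>s" and ?S = "terms_code \<sigma>s"
    let ?A = "mv_generated n (term_fun n ` set \<tau>s)" and ?B = "mv_generated n (term_fun n ` set \<sigma>s)"
    have v: "\<forall>t\<in>set \<tau>s. mv_vars t \<subseteq> {1..n}" "\<forall>t\<in>set \<sigma>s. mv_vars t \<subseteq> {1..n}"
      using vars by auto
    have eqw: "(\<exists>w. equal_witness n ?T ?S w) \<longleftrightarrow> ?A = ?B"
    proof
      assume "\<exists>w. equal_witness n ?T ?S w"
      then show "?A = ?B"
        using generates_iff[OF v] generates_iff[OF v(2,1)] by (auto simp: equal_witness_def)
    next
      assume "?A = ?B"
      then obtain w1 w2 where "generates n ?T ?S w1" "generates n ?S ?T w2"
        using generates_iff[OF v] generates_iff[OF v(2,1)] by blast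
      then show "\<exists>w. equal_witness n ?T ?S w"
        by (intro exI[of _ "prod_encode (w1, w2)"]) (simp add: equal_witness_def)
    qed
    \<comment> \<open>Together with \<open>eqw\<close> this makes the two kinds of certificate
      exclude each other, so the kind of the least one found is the answer.\<close>
    have neq: "integral_at w ?T = integral_at w ?S" if "?A = ?B" for w
      using integral_at_mono[OF v] integral_at_mono[OF v(2,1)] that by blast
    have ex: "\<exists>w. witness n ?T ?S w"
    proof (cases "?A = ?B")
      case True
      with eqw show ?thesis by (auto simp: witness_def)
    next
      case False
      then consider "\<not> ?B \<subseteq> ?A" | "\<not> ?A \<subseteq> ?B" by blast
      then show ?thesis
      proof cases
        case 1
        from not_generated_witness[OF v sep(1) this] show ?thesis by (auto simp: witness_def)
      next
        case 2
        from not_generated_witness[OF v(2,1) sep(2) this] show ?thesis by (auto simp: witness_def)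
      qed
    qed
    have "witness n ?T ?S (LEAST w. witness n ?T ?S w)" by (rule LeastI_ex[OF ex])
    then have "equal_witness n ?T ?S (LEAST w. witness n ?T ?S w) \<longleftrightarrow> ?A = ?B"
      using eqw neq by (auto simp: witness_def)
    with p[OF ex] show "computes p [n, ?T, ?S] (if ?A = ?B then 1 else 0)"
      by (simp add: of_bool_def)
  qed
qed

end
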